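(* Let $H$ be a finite-dimensional Hopf algebra over $\mathbb{C}$. Then the anti-Drinfeld double $A(H)$ is a bicomodule algebra and a left and right Galois object over the Drinfeld double $D(H)$ for the left and right coactions given respectively by the formulas $${}_{A(H)}\Delta(\psi\otimes k)=\big(\psi_{(2)}\otimes S^2(k_{(1)})\big)\otimes\big(\psi_{(1)}\otimes k_{(2)}\big)\in D(H)\otimes A(H),$$ $$\Delta_{A(H)}(\varphi\otimes h)=\big(\varphi_{(2)}\otimes h_{(1)}\big)\otimes\big(\varphi_{(1)}\otimes h_{(2)}\big)\in A(H)\otimes D(H).$$
   Context: $H$ is a finite-dimensional Hopf algebra over $\mathbb{C}$ with coproduct $\Delta$, counit $\varepsilon$ and antipode $S$ (which is automatically bijective). $H^*$ is the dual Hopf algebra. Sweedler indices refer to the coalgebra structures on $H^*$ and $H$: $\Delta(h)=h_{(1)}\otimes h_{(2)}$, $\Delta(\varphi)=\varphi_{(1)}\otimes\varphi_{(2)}$, with $\varphi(hh')=\varphi_{(1)}(h)\varphi_{(2)}(h')$ and $(\varphi\psi)(h)=\varphi(h_{(1)})\psi(h_{(2)})$. The Drinfeld double is the Hopf algebra $D(H):=H^*\otimes H$ (as a vector space) with unit $\varepsilon\otimes 1$ and $$(\varphi\otimes h)(\varphi'\otimes h')=\varphi'_{(1)}(S^{-1}(h_{(3)}))\,\varphi'_{(3)}(h_{(1)})\;\varphi\varphi'_{(2)}\otimes h_{(2)}h',$$ $$\Delta(\varphi\otimes h)=(\varphi_{(2)}\otimes h_{(1)})\otimes(\varphi_{(1)}\otimes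 h_{(2)}).$$ The anti-Drinfeld double is the algebra $A(H):=H^*\otimes H$ (as a vector space) with unit $\varepsilon\otimes1$ and $$(\varphi\otimes h)(\varphi'\otimes h')=\varphi'_{(1)}(S^{-1}(h_{(3)}))\,\varphi'_{(3)}(S^2(h_{(1)}))\;\varphi\varphi'_{(2)}\otimes h_{(2)}h'.$$ For a Hopf algebra $K$ (here $K=D(H)$): a bicomodule algebra $A$ over $K$ is a unital algebra with a right coaction $\Delta_A\colon A\to A\otimes K$, $a\mapsto a_{(0)}\otimes a_{(1)}$, and a left coaction ${}_A\Delta\colon A\to K\otimes A$, $a\mapsto a_{(-1)}\otimes a_{(0)}$, both unital algebra homomorphisms, such that $({}_A\Delta\otimes\mathrm{id})\circ\Delta_A=(\mathrm{id}\otimes\Delta_A)\circ{}_A\Delta$. $A$ is a right Galois object over $K$ if $\{a\,|\,\Delta_A(a)=a\otimes1\}=\mathbb{C}$ and $A\otimes A\to A\otimes K$, $p\otimes p'\mapsto pp'_{(0)}\otimes p'_{(1)}$, is bijective. $A$ is a left Galois object over $K$ if $\{a\,|\,{}_A\Delta(a)=1\otimes a\}=\mathbb{C}$ and $A\otimes A\to K\otimes A$, $q\otimes q'\mapsto q_{(-1)}\otimes q_{(0)}q'$, is bijective. *)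

theory Defs
  imports Complex_Main "HOL-Library.Poly_Mapping"
begin

section \<open>Complex vector spaces\<close>

class complex_vector = ab_group_add +
  fixes scaleC :: "complex \<Rightarrow> 'a \<Rightarrow> 'a"  (infixr \<open>*\<^sub>C\<close> 75)
  assumes scaleC_add_right: "c *\<^sub>C (x + y) = c *\<^sub>C x + c *\<^sub>C y"
    and scaleC_add_left: "(c + d) *\<^sub>C x = c *\<^sub>C x + d *\<^sub>C x"
    and scaleC_scaleC: "c *\<^sub>C d *\<^sub>C x = (c * d) *\<^sub>C x"
    and scaleC_one: "1 *\<^sub>C x = x"

interpretation complex_vector: vector_space "scaleC :: complex \<Rightarrow> 'a \<Rightarrow> 'a::complex_vector"
  by unfold_locales (rule scaleC_add_right scaleC_add_left scaleC_scaleC scaleC_one)+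

abbreviation clinear :: "('a::complex_vector \<Rightarrow> 'b::complex_vector) \<Rightarrow> bool" where
  "clinear \<equiv> Vector_Spaces.linear scaleC scaleC"

lemma clinear_iff:
  "clinear f \<longleftrightarrow> (\<forall>x y. f (x + y) = f x + f y) \<and> (\<forall>c x. f (c *\<^sub>C x) = c *\<^sub>C f x)"
  by (simp add: Vector_Spaces.linear_iff complex_vector.vector_space_axioms)

definition cbilinear ::
  "('a::complex_vector \<Rightarrow> 'b::complex_vector \<Rightarrow> 'c::complex_vector) \<Rightarrow> bool" where
  "cbilinear F \<longleftrightarrow> (\<forall>a. clinear (F a)) \<and> (\<forall>b. clinear (\<lambda>a. F a b))"

instantiation complex :: complex_vector
begin
definition scaleC_complex_def [simp]: "scaleC c (x::complex) = c * x"
instance by standard (simp_all add: algebra_simps)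
end

instantiation poly_mapping :: (type, complex_vector) complex_vector
begin
lift_definition scaleC_poly_mapping :: "complex \<Rightarrow> ('a \<Rightarrow>\<^sub>0 'b) \<Rightarrow> ('a \<Rightarrow>\<^sub>0 'b)"
  is "\<lambda>c f x. c *\<^sub>C f x"
  by (rule finite_subset[rotated]) (auto simp: complex_vector.scale_zero_right)
instance
  by standard (transfer; simp add: fun_eq_iff scaleC_add_right scaleC_add_left
      scaleC_scaleC scaleC_one)+
end


section \<open>Dual spaces\<close>

typedef (overloaded) 'a dual = "{f :: 'a::complex_vector \<Rightarrow> complex. clinear f}"
  morphisms eval Abs_dual
  by (rule exI[of _ "\<lambda>_. 0"]) (simp add: clinear_iff)

setup_lifting type_definition_dual

notation eval (\<open>\<langle>_, _\<rangle>\<close>)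

instantiation dual :: (complex_vector) complex_vector
begin
lift_definition zero_dual :: "'a dual" is "\<lambda>_. 0" by (simp add: clinear_iff)
lift_definition plus_dual :: "'a dual \<Rightarrow> 'a dual \<Rightarrow> 'a dual" is "\<lambda>f g x. f x + g x"
  by (simp add: clinear_iff algebra_simps)
lift_definition minus_dual :: "'a dual \<Rightarrow> 'a dual \<Rightarrow> 'a dual" is "\<lambda>f g x. f x - g x"
  by (simp add: clinear_iff algebra_simps)
lift_definition uminus_dual :: "'a dual \<Rightarrow> 'a dual" is "\<lambda>f x. - f x"
  by (simp add: clinear_iff algebra_simps)
lift_definition scaleC_dual :: "complex \<Rightarrow> 'a dual \<Rightarrow> 'a dual" is "\<lambda>c f x. c * f x"
  by (simp add: clinear_iff algebra_simps)
instance by standard (transfer; simp add: fun_eq_iff algebra_simps)+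
end


section \<open>Tensor products\<close>

text \<open>The tensor product is the quotient of the free complex vector space on
  \<^typ>\<open>'a \<times> 'b\<close> by the subspace spanned by the usual bilinearity relators.\<close>

abbreviation free_pure :: "'a \<Rightarrow> 'b \<Rightarrow> ('a \<times> 'b) \<Rightarrow>\<^sub>0 complex" where
  "free_pure a b \<equiv> Poly_Mapping.single (a, b) 1"

definition tensor_relators ::
  "(('a::complex_vector \<times> 'b::complex_vector) \<Rightarrow>\<^sub>0 complex) set" where
  "tensor_relators =
     {free_pure (a + a') b - free_pure a b - free_pure a' b | a a' b. True} \<union>
     {free_pure a (b + b') - free_pure a b - free_pure a b' | a b b'. True} \<union>
     {free_pure (c *\<^sub>C a) b - c *\<^sub>C free_pure a b | c a b. True} \<union>
     {free_pure a (c *\<^sub>C b) - c *\<^sub>C free_pure a b | c a b. True}"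

definition tensor_rel ::
  "(('a::complex_vector \<times> 'b::complex_vector) \<Rightarrow>\<^sub>0 complex) \<Rightarrow> (('a \<times> 'b) \<Rightarrow>\<^sub>0 complex) \<Rightarrow> bool"
  where "tensor_rel x y \<longleftrightarrow> x - y \<in> complex_vector.span tensor_relators"

lemma equivp_tensor_rel:
  "equivp (tensor_rel :: (('a::complex_vector \<times> 'b::complex_vector) \<Rightarrow>\<^sub>0 complex) \<Rightarrow> _)"
proof (rule equivpI)
  show "reflp (tensor_rel :: (('a \<times> 'b) \<Rightarrow>\<^sub>0 complex) \<Rightarrow> _)"
    by (simp add: reflp_def tensor_rel_def complex_vector.span_zero)
  show "symp (tensor_rel :: (('a \<times> 'b) \<Rightarrow>\<^sub>0 complex) \<Rightarrow> _)"
  proof (rule sympI)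
    fix x y :: "('a \<times> 'b) \<Rightarrow>\<^sub>0 complex" assume "tensor_rel x y"
    then show "tensor_rel y x"
      unfolding tensor_rel_def using complex_vector.span_neg[of "x - y"] by simp
  qed
  show "transp (tensor_rel :: (('a \<times> 'b) \<Rightarrow>\<^sub>0 complex) \<Rightarrow> _)"
  proof (rule transpI)
    fix x y z :: "('a \<times> 'b) \<Rightarrow>\<^sub>0 complex" assume "tensor_rel x y" "tensor_rel y z"
    then show "tensor_rel x z"
      unfolding tensor_rel_def using complex_vector.span_add[of "x - y" _ "y - z"] by simp
  qed
qed

quotient_type (overloaded) ('a, 'b) tensor (infixr \<open>\<otimes>\<close> 72) =
  "('a::complex_vector \<times> 'b::complex_vector) \<Rightarrow>\<^sub>0 complex" / tensor_rel
  by (rule equivp_tensor_rel)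

instantiation tensor :: (complex_vector, complex_vector) complex_vector
begin
lift_definition zero_tensor :: "'a \<otimes> 'b" is 0 .
lift_definition plus_tensor :: "'a \<otimes> 'b \<Rightarrow> 'a \<otimes> 'b \<Rightarrow> 'a \<otimes> 'b" is "(+)"
proof -
  fix x x' y y' :: "('a \<times> 'b) \<Rightarrow>\<^sub>0 complex"
  assume "tensor_rel x x'" "tensor_rel y y'"
  then have "(x - x') + (y - y') \<in> complex_vector.span tensor_relators"
    unfolding tensor_rel_def by (rule complex_vector.span_add)
  then show "tensor_rel (x + y) (x' + y')"
    unfolding tensor_rel_def by (simp add: algebra_simps)
qed
lift_definition minus_tensor :: "'a \<otimes> 'b \<Rightarrow> 'a \<otimes> 'b \<Rightarrow> 'a \<otimes> 'b" is "(-)"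
proof -
  fix x x' y y' :: "('a \<times> 'b) \<Rightarrow>\<^sub>0 complex"
  assume "tensor_rel x x'" "tensor_rel y y'"
  then have "(x - x') - (y - y') \<in> complex_vector.span tensor_relators"
    unfolding tensor_rel_def by (rule complex_vector.span_diff)
  then show "tensor_rel (x - y) (x' - y')"
    unfolding tensor_rel_def by (simp add: algebra_simps)
qed
lift_definition uminus_tensor :: "'a \<otimes> 'b \<Rightarrow> 'a \<otimes> 'b" is uminus
proof -
  fix x y :: "('a \<times> 'b) \<Rightarrow>\<^sub>0 complex"
  assume "tensor_rel x y"
  then show "tensor_rel (- x) (- y)"
    unfolding tensor_rel_def using complex_vector.span_neg[of "x - y"] by simp
qed
lift_definition scaleC_tensor :: "complex \<Rightarrow> 'a \<otimes> 'b \<Rightarrow> 'a \<otimes> 'b" is scaleC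
proof -
  fix c and x y :: "('a \<times> 'b) \<Rightarrow>\<^sub>0 complex"
  assume "tensor_rel x y"
  then show "tensor_rel (c *\<^sub>C x) (c *\<^sub>C y)"
    unfolding tensor_rel_def using complex_vector.span_scale[of "x - y" _ c]
    by (simp add: complex_vector.scale_right_diff_distrib)
qed
instance
  by standard
    (transfer; simp add: tensor_rel_def complex_vector.span_zero algebra_simps
      scaleC_add_right scaleC_add_left scaleC_scaleC scaleC_one)+
end

lift_definition tensor_pure :: "'a::complex_vector \<Rightarrow> 'b::complex_vector \<Rightarrow> 'a \<otimes> 'b"
  (infixr \<open>\<otimes>\<close> 72) is free_pure .

lemma cbilinear_tensor_pure: "cbilinear (\<otimes>)"
  unfolding cbilinear_def clinear_iff
proof (intro conjI allI)
  fix a a' :: 'a and b b' :: 'b and c :: complex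
  have "tensor_rel (free_pure a (b + b')) (free_pure a b + free_pure a b')"
       "tensor_rel (free_pure (a + a') b) (free_pure a b + free_pure a' b)"
       "tensor_rel (free_pure a (c *\<^sub>C b)) (c *\<^sub>C free_pure a b)"
       "tensor_rel (free_pure (c *\<^sub>C a) b) (c *\<^sub>C free_pure a b)"
    unfolding tensor_rel_def diff_diff_eq[symmetric]
    by (rule complex_vector.span_base; unfold tensor_relators_def; blast)+
  then show "a \<otimes> (b + b') = a \<otimes> b + a \<otimes> b'" "(a + a') \<otimes> b = a \<otimes> b + a' \<otimes> b"
    "a \<otimes> (c *\<^sub>C b) = c *\<^sub>C (a \<otimes> b)" "(c *\<^sub>C a) \<otimes> b = c *\<^sub>C (a \<otimes> b)"
    by (simp_all add: tensor_pure.abs_eq plus_tensor.abs_eq scaleC_tensor.abs_eq tensor.abs_eq_iff)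
qed

text \<open>The linear map induced by a bilinear map; only meaningful for bilinear arguments,
  see \<open>cbilinear_imp_ex1_lift\<close> below.\<close>

definition tensor_lift ::
  "('a::complex_vector \<Rightarrow> 'b::complex_vector \<Rightarrow> 'c::complex_vector) \<Rightarrow> 'a \<otimes> 'b \<Rightarrow> 'c" where
  "tensor_lift F = (THE f. clinear f \<and> (\<forall>a b. f (a \<otimes> b) = F a b))"

lemma tensor_induct [case_names pure add]:
  fixes t :: "'a::complex_vector \<otimes> 'b::complex_vector"
  assumes pure: "\<And>a b. P (a \<otimes> b)" and add: "\<And>s t. P s \<Longrightarrow> P t \<Longrightarrow> P (s + t)"
  shows "P t"
proof -
  have single: "P (abs_tensor (Poly_Mapping.single (a, b) c))" for a :: 'a and b :: 'b and c
  proof -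
    have "(c *\<^sub>C a) \<otimes> b = c *\<^sub>C (a \<otimes> b)"
      using cbilinear_tensor_pure[where 'a='a and 'b='b] unfolding cbilinear_def clinear_iff by blast
    also have "\<dots> = abs_tensor (c *\<^sub>C free_pure a b)"
      by (simp add: tensor_pure.abs_eq scaleC_tensor.abs_eq)
    also have "c *\<^sub>C free_pure a b = Poly_Mapping.single (a, b) c"
      by (transfer) (auto simp: fun_eq_iff when_def)
    finally show ?thesis using pure by metis
  qed
  have "P (abs_tensor x)" for x :: "('a \<times> 'b) \<Rightarrow>\<^sub>0 complex"
  proof (induction x rule: Poly_Mapping.update_induct)
    case const
    show ?case using single[of 0 0 0] by simp
  next
    case (update f ab c)
    then have "Poly_Mapping.update ab c f = f + Poly_Mapping.single ab c"
      by (intro poly_mapping_eqI)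
        (auto simp: lookup_update lookup_add lookup_single in_keys_iff when_def)
    then show ?case
      using update single[of "fst ab" "snd ab" c] add
      by (simp add: plus_tensor.abs_eq[symmetric])
  qed
  then show ?thesis by (induction t rule: tensor.abs_induct)
qed

lemma cbilinear_imp_ex1_lift:
  fixes F :: "'a::complex_vector \<Rightarrow> 'b::complex_vector \<Rightarrow> 'c::complex_vector"
  assumes "cbilinear F"
  shows "\<exists>!f. clinear f \<and> (\<forall>a b. f (a \<otimes> b) = F a b)"
proof -
  define E where "E x = (\<Sum>p\<in>Poly_Mapping.keys x.
      Poly_Mapping.lookup x p *\<^sub>C F (fst p) (snd p))"
    for x :: "('a \<times> 'b) \<Rightarrow>\<^sub>0 complex"
  have E_eq: "E x = (\<Sum>p\<in>A. Poly_Mapping.lookup x p *\<^sub>C F (fst p) (snd p))"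
    if "finite A" "Poly_Mapping.keys x \<subseteq> A" for x A
    unfolding E_def
  proof (rule sum.mono_neutral_left)
    show "\<forall>p\<in>A - Poly_Mapping.keys x. Poly_Mapping.lookup x p *\<^sub>C F (fst p) (snd p) = 0"
      by (metis DiffD2 complex_vector.scale_zero_left not_in_keys_iff_lookup_eq_zero)
  qed (use that in auto)
  have E_add: "E (x + y) = E x + E y" for x y
  proof -
    let ?A = "Poly_Mapping.keys x \<union> Poly_Mapping.keys y"
    have "E (x + y) = (\<Sum>p\<in>?A. Poly_Mapping.lookup (x + y) p *\<^sub>C F (fst p) (snd p))"
      by (rule E_eq) (auto dest: subsetD[OF Poly_Mapping.keys_add])
    also have "\<dots> = (\<Sum>p\<in>?A. Poly_Mapping.lookup x p *\<^sub>C F (fst p) (snd p))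
                  + (\<Sum>p\<in>?A. Poly_Mapping.lookup y p *\<^sub>C F (fst p) (snd p))"
      by (simp add: lookup_add scaleC_add_left sum.distrib)
    also have "\<dots> = E x + E y" by (subst (1 2) E_eq[symmetric]) auto
    finally show ?thesis .
  qed
  have lookup_scaleC: "Poly_Mapping.lookup (c *\<^sub>C x) p = c * Poly_Mapping.lookup x p"
    for c x and p :: "'a \<times> 'b"
    by transfer simp
  have E_scale: "E (c *\<^sub>C x) = c *\<^sub>C E x" for c x
  proof -
    have "E (c *\<^sub>C x) = (\<Sum>p\<in>Poly_Mapping.keys x.
        Poly_Mapping.lookup (c *\<^sub>C x) p *\<^sub>C F (fst p) (snd p))"
      by (rule E_eq) (auto simp: in_keys_iff lookup_scaleC)
    then show ?thesis
      by (simp add: lookup_scaleC E_def complex_vector.scale_sum_right scaleC_scaleC)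
  qed
  have E: "clinear E" using E_add E_scale by (simp add: clinear_iff)
  have E_pure: "E (free_pure a b) = F a b" for a b
    by (subst E_eq[of "{(a, b)}"]) (auto simp: scaleC_one)
  have E_diff: "E (x - y) = E x - E y" for x y
    using E_add[of "x - y" y] by simp
  have "E r = 0" if "r \<in> tensor_relators" for r
    using that assms unfolding tensor_relators_def cbilinear_def clinear_iff
    by (auto simp: E_diff E_pure E_scale)
  then have "E r = 0" if "r \<in> complex_vector.span tensor_relators" for r
    using module_hom.eq_0_on_span[OF Vector_Spaces.linear.axioms(3)[OF E] _ that] by blast
  then have E_cong: "E x = E y" if "tensor_rel x y" for x y
    using that E_diff[of x y] by (simp add: tensor_rel_def)
  define f where "f t = E (rep_tensor t)" for t
  have f_abs: "f (abs_tensor x) = E x" for x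
    unfolding f_def
    by (rule E_cong)
      (simp add: tensor.abs_eq_iff[symmetric] Quotient3_abs_rep[OF Quotient3_tensor])
  have f_lin: "clinear f"
    unfolding clinear_iff
  proof (intro conjI allI)
    fix s t :: "'a \<otimes> 'b" and c
    show "f (s + t) = f s + f t"
      by (induction s rule: tensor.abs_induct; induction t rule: tensor.abs_induct)
        (simp add: plus_tensor.abs_eq f_abs E_add)
    show "f (c *\<^sub>C t) = c *\<^sub>C f t"
      by (induction t rule: tensor.abs_induct) (simp add: scaleC_tensor.abs_eq f_abs E_scale)
  qed
  have f_pure: "f (a \<otimes> b) = F a b" for a b
    by (simp add: tensor_pure.abs_eq f_abs E_pure)
  show ?thesis
  proof (rule ex1I[of _ f])
    show "clinear f \<and> (\<forall>a b. f (a \<otimes> b) = F a b)" using f_lin f_pure by blast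
    fix g :: "'a \<otimes> 'b \<Rightarrow> 'c" assume g: "clinear g \<and> (\<forall>a b. g (a \<otimes> b) = F a b)"
    have "g t = f t" for t
      by (induction t rule: tensor_induct) (use f_lin f_pure g in \<open>auto simp: clinear_iff\<close>)
    then show "g = f" by blast
  qed
qed

lemma
  assumes "cbilinear F"
  shows clinear_tensor_lift: "clinear (tensor_lift F)"
    and tensor_lift_pure: "tensor_lift F (a \<otimes> b) = F a b"
  using theI'[OF cbilinear_imp_ex1_lift[OF assms]] unfolding tensor_lift_def by auto

definition tensor_map ::
  "('a::complex_vector \<Rightarrow> 'c::complex_vector) \<Rightarrow> ('b::complex_vector \<Rightarrow> 'd::complex_vector)
    \<Rightarrow> 'a \<otimes> 'b \<Rightarrow> 'c \<otimes> 'd" where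
  "tensor_map f g = tensor_lift (\<lambda>a b. f a \<otimes> g b)"

definition tensor_assoc ::
  "('a::complex_vector \<otimes> 'b::complex_vector) \<otimes> 'c::complex_vector \<Rightarrow> 'a \<otimes> ('b \<otimes> 'c)" where
  "tensor_assoc = tensor_lift (\<lambda>t c. tensor_lift (\<lambda>a b. a \<otimes> (b \<otimes> c)) t)"


section \<open>Algebras and Hopf algebras\<close>

record 'a alg =
  mult :: "'a \<Rightarrow> 'a \<Rightarrow> 'a"
  one :: 'a

record (overloaded) ('a::complex_vector) bialg = "'a alg" +
  comult :: "'a \<Rightarrow> 'a \<otimes> 'a"
  counit :: "'a \<Rightarrow> complex"

definition tensor_alg ::
  "('a::complex_vector, 'x) alg_scheme \<Rightarrow> ('b::complex_vector, 'y) alg_scheme \<Rightarrow> ('a \<otimes> 'b) alg"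
  where
  "tensor_alg A B = \<lparr>
     mult = (\<lambda>t t'. tensor_lift (\<lambda>a b.
               tensor_lift (\<lambda>a' b'. mult A a a' \<otimes> mult B b b') t') t),
     one = one A \<otimes> one B \<rparr>"

definition complex_alg :: "complex alg" where
  "complex_alg = \<lparr> mult = (*), one = 1 \<rparr>"

locale unital_algebra =
  fixes A :: "('a::complex_vector, 'x) alg_scheme"
  assumes mult_bilinear: "cbilinear (mult A)"
    and mult_assoc: "mult A (mult A a b) c = mult A a (mult A b c)"
    and one_mult: "mult A (one A) a = a"
    and mult_one: "mult A a (one A) = a"

definition algebra_hom ::
  "('a::complex_vector, 'x) alg_scheme \<Rightarrow> ('b::complex_vector, 'y) alg_scheme
    \<Rightarrow> ('a \<Rightarrow> 'b) \<Rightarrow> bool" where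
  "algebra_hom A B f \<longleftrightarrow>
     clinear f \<and> (\<forall>a a'. f (mult A a a') = mult B (f a) (f a')) \<and> f (one A) = one B"

locale bialgebra = unital_algebra K
  for K :: "('k::complex_vector, 'x) bialg_scheme" +
  assumes comult_hom: "algebra_hom K (tensor_alg K K) (comult K)"
    and counit_hom: "algebra_hom K complex_alg (counit K)"
    and coassoc: "tensor_assoc (tensor_map (comult K) id (comult K x))
                    = tensor_map id (comult K) (comult K x)"
    and counit_left: "tensor_lift (\<lambda>x1 x2. counit K x1 *\<^sub>C x2) (comult K x) = x"
    and counit_right: "tensor_lift (\<lambda>x1 x2. counit K x2 *\<^sub>C x1) (comult K x) = x"

definition is_antipode ::
  "('k::complex_vector, 'x) bialg_scheme \<Rightarrow> ('k \<Rightarrow> 'k) \<Rightarrow> bool" where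
  "is_antipode K S \<longleftrightarrow> clinear S \<and>
     (\<forall>x. tensor_lift (\<lambda>x1 x2. mult K (S x1) x2) (comult K x) = counit K x *\<^sub>C one K \<and>
          tensor_lift (\<lambda>x1 x2. mult K x1 (S x2)) (comult K x) = counit K x *\<^sub>C one K)"

locale hopf_algebra = bialgebra K
  for K :: "('k::complex_vector, 'x) bialg_scheme" +
  assumes ex_antipode: "\<exists>S. is_antipode K S"

text \<open>An antipode is unique if it exists.\<close>

definition antipode :: "('k::complex_vector, 'x) bialg_scheme \<Rightarrow> 'k \<Rightarrow> 'k" where
  "antipode K = (THE S. is_antipode K S)"

text \<open>Sweedler notation: \<open>sweedler2 K x F\<close> is $F(x_{(1)}, x_{(2)})$ and \<open>sweedler3 K x F\<close> is
  $F(x_{(1)}, x_{(2)}, x_{(3)})$, for \<open>F\<close> linear in each argument.\<close>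

definition sweedler2 ::
  "('k::complex_vector, 'x) bialg_scheme \<Rightarrow> 'k \<Rightarrow> ('k \<Rightarrow> 'k \<Rightarrow> 'v::complex_vector) \<Rightarrow> 'v" where
  "sweedler2 K x F = tensor_lift F (comult K x)"

definition sweedler3 ::
  "('k::complex_vector, 'x) bialg_scheme \<Rightarrow> 'k \<Rightarrow> ('k \<Rightarrow> 'k \<Rightarrow> 'k \<Rightarrow> 'v::complex_vector) \<Rightarrow> 'v"
  where
  "sweedler3 K x F =
     tensor_lift (\<lambda>x1. tensor_lift (F x1)) (tensor_map id (comult K) (comult K x))"


section \<open>Comodule algebras and Galois objects\<close>

locale bicomodule_algebra = hopf_algebra K + A: unital_algebra A
  for K :: "('k::complex_vector, 'x) bialg_scheme"
    and A :: "('a::complex_vector, 'y) alg_scheme" +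
  fixes lcoact :: "'a \<Rightarrow> 'k \<otimes> 'a" and rcoact :: "'a \<Rightarrow> 'a \<otimes> 'k"
  assumes right_coaction_hom: "algebra_hom A (tensor_alg A K) rcoact"
    and right_coassoc: "tensor_assoc (tensor_map rcoact id (rcoact a))
                          = tensor_map id (comult K) (rcoact a)"
    and right_counit: "tensor_lift (\<lambda>a0 a1. counit K a1 *\<^sub>C a0) (rcoact a) = a"
    and left_coaction_hom: "algebra_hom A (tensor_alg K A) lcoact"
    and left_coassoc: "tensor_assoc (tensor_map (comult K) id (lcoact a))
                          = tensor_map id lcoact (lcoact a)"
    and left_counit: "tensor_lift (\<lambda>a1 a0. counit K a1 *\<^sub>C a0) (lcoact a) = a"
    and coactions_commute: "tensor_assoc (tensor_map lcoact id (rcoact a))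
                              = tensor_map id rcoact (lcoact a)"

text \<open>That the coinvariants equal $\mathbb{C}$ means that the unit map
  $c \mapsto c \cdot 1_A$ is a bijection from $\mathbb{C}$ onto them.\<close>

definition right_galois_object ::
  "('k::complex_vector, 'x) bialg_scheme \<Rightarrow> ('a::complex_vector, 'y) alg_scheme
    \<Rightarrow> ('a \<Rightarrow> 'a \<otimes> 'k) \<Rightarrow> bool" where
  "right_galois_object K A rcoact \<longleftrightarrow>
     bij_betw (\<lambda>c. c *\<^sub>C one A) UNIV {a. rcoact a = a \<otimes> one K} \<and>
     bij (tensor_lift (\<lambda>p p'. tensor_lift (\<lambda>p'0 p'1. mult A p p'0 \<otimes> p'1) (rcoact p'))
            :: 'a \<otimes> 'a \<Rightarrow> 'a \<otimes> 'k)"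

definition left_galois_object ::
  "('k::complex_vector, 'x) bialg_scheme \<Rightarrow> ('a::complex_vector, 'y) alg_scheme
    \<Rightarrow> ('a \<Rightarrow> 'k \<otimes> 'a) \<Rightarrow> bool" where
  "left_galois_object K A lcoact \<longleftrightarrow>
     bij_betw (\<lambda>c. c *\<^sub>C one A) UNIV {a. lcoact a = one K \<otimes> a} \<and>
     bij (tensor_lift (\<lambda>q q'. tensor_lift (\<lambda>q1 q0. q1 \<otimes> mult A q0 q') (lcoact q))
            :: 'a \<otimes> 'a \<Rightarrow> 'k \<otimes> 'a)"


section \<open>The dual Hopf algebra and the (anti-)Drinfeld double\<close>

text \<open>The element defining the coproduct exists uniquely because
  $H^* \otimes H^* \cong (H \otimes H)^*$ when $H$ is finite-dimensional.\<close>

definition dual_hopf :: "('h::complex_vector) bialg \<Rightarrow> 'h dual bialg" where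
  "dual_hopf H = \<lparr>
     mult = (\<lambda>\<phi> \<psi>. Abs_dual (\<lambda>h. sweedler2 H h (\<lambda>h1 h2. \<langle>\<phi>, h1\<rangle> * \<langle>\<psi>, h2\<rangle>))),
     one = Abs_dual (counit H),
     comult = (\<lambda>\<phi>. THE t. \<forall>h h'. \<langle>\<phi>, mult H h h'\<rangle> = tensor_lift (\<lambda>\<phi>1 \<phi>2. \<langle>\<phi>1, h\<rangle> * \<langle>\<phi>2, h'\<rangle>) t),
     counit = (\<lambda>\<phi>. \<langle>\<phi>, one H\<rangle>) \<rparr>"

text \<open>The multiplications of $D(H)$ and $A(H)$ have the same form, with \<open>\<alpha> = id\<close> and
  \<open>\<alpha> = S\<^sup>2\<close> respectively.\<close>

definition twisted_double_alg ::
  "('h::complex_vector) bialg \<Rightarrow> ('h \<Rightarrow> 'h) \<Rightarrow> ('h dual \<otimes> 'h) alg" where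
  "twisted_double_alg H \<alpha> = \<lparr>
     mult = (\<lambda>x x'. tensor_lift (\<lambda>\<phi> h. tensor_lift (\<lambda>\<phi>' h'.
        sweedler3 (dual_hopf H) \<phi>' (\<lambda>\<phi>'1 \<phi>'2 \<phi>'3. sweedler3 H h (\<lambda>h1 h2 h3.
          (\<langle>\<phi>'1, inv (antipode H) h3\<rangle> * \<langle>\<phi>'3, \<alpha> h1\<rangle>) *\<^sub>C
            (mult (dual_hopf H) \<phi> \<phi>'2 \<otimes> mult H h2 h')))) x') x),
     one = Abs_dual (counit H) \<otimes> one H \<rparr>"

definition anti_drinfeld_double :: "('h::complex_vector) bialg \<Rightarrow> ('h dual \<otimes> 'h) alg" where
  "anti_drinfeld_double H = twisted_double_alg H (antipode H \<circ> antipode H)"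

text \<open>The counit $\varphi \otimes h \mapsto \varphi(1)\varepsilon(h)$ is the only one compatible
  with the coproduct.\<close>

definition drinfeld_double :: "('h::complex_vector) bialg \<Rightarrow> ('h dual \<otimes> 'h) bialg" where
  "drinfeld_double H = \<lparr>
     mult = mult (twisted_double_alg H id),
     one = one (twisted_double_alg H id),
     comult = tensor_lift (\<lambda>\<phi> h.
       sweedler2 (dual_hopf H) \<phi> (\<lambda>\<phi>1 \<phi>2. sweedler2 H h (\<lambda>h1 h2. (\<phi>2 \<otimes> h1) \<otimes> (\<phi>1 \<otimes> h2)))),
     counit = tensor_lift (\<lambda>\<phi> h. \<langle>\<phi>, one H\<rangle> * counit H h) \<rparr>"

definition left_coaction ::
  "('h::complex_vector) bialg \<Rightarrow> 'h dual \<otimes> 'h \<Rightarrow> ('h dual \<otimes> 'h) \<otimes> ('h dual \<otimes> 'h)" where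
  "left_coaction H = tensor_lift (\<lambda>\<psi> k.
     sweedler2 (dual_hopf H) \<psi> (\<lambda>\<psi>1 \<psi>2. sweedler2 H k (\<lambda>k1 k2.
       (\<psi>2 \<otimes> antipode H (antipode H k1)) \<otimes> (\<psi>1 \<otimes> k2))))"

definition right_coaction ::
  "('h::complex_vector) bialg \<Rightarrow> 'h dual \<otimes> 'h \<Rightarrow> ('h dual \<otimes> 'h) \<otimes> ('h dual \<otimes> 'h)" where
  "right_coaction H = tensor_lift (\<lambda>\<phi> h.
     sweedler2 (dual_hopf H) \<phi> (\<lambda>\<phi>1 \<phi>2. sweedler2 H h (\<lambda>h1 h2.
       (\<phi>2 \<otimes> h1) \<otimes> (\<phi>1 \<otimes> h2))))"

end

(* Both products are members of the family of products on H^* (x) H obtained by inserting a Hopf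
   automorphism alpha in place of S^2; write A_alpha for the resulting algebra, so that
   D(H) = A_id and A(H) = A_{S^2}. Identify phi (x) h with the linear map x |-> phi(x) h. Then the
   coaction twisted by gamma sends X to (y, x) |-> (gamma (x) id)(Delta(X(x y))), and the middle
   factors h_(3), h_(4) cancel in the product of two such elements, so it is an algebra
   homomorphism A_{beta gamma} -> A_beta (x) A_gamma. The choices (beta, gamma) = (id, id),
   (S^2, id), (id, S^2) give the coproduct of D(H) and the two coactions of A(H), and
   (rho_gamma (x) id) rho_delta = (id (x) rho_delta) rho_{gamma delta} gives every coassociativity
   law. The Galois maps are bijective because the identity D(H) -> A(H) is a comodule map with
   convolution inverse phi (x) h |-> (eps (x) S(h)) (phi o S^{-1} (x) 1); for alpha = id the same
   formula is the antipode of D(H). *)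

theory Submission
  imports Defs
begin

section \<open>Linear maps and formal sums of tensors\<close>

text \<open>The products contain the inverse of S, while \<open>hopf_algebra\<close> supplies only
  an antipode. Bijectivity is therefore derived from finite dimension: for a functional f, the trace
  of b |-> f(b_(2)) x S^2(b_(1)) is a left integral as a function of x; some f makes it nonzero, and
  a nonzero integral forces h = 0 whenever S(h) = 0. The other obstacle is the coproduct of the
  dual, which is known only through its pairing with products in H. Reading elements of the double
  as maps from H turns the three legs of the second dual factor of a product into one evaluation
  Y(S'(h_(3)) x_(2) \<alpha>(h_(1))), and the two legs of a coaction into X(x y). The order x y
  reflects that the coproduct of D(H) is reversed on the dual; for the same reason the convolution
  inverse uses the inverse of S on the dual factor. The rule \<alpha> = \<beta>\<gamma> is forced:
  the first leg of the coaction has values \<gamma>(h_(1)), which the product of A_\<beta> then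
  feeds to \<beta>, whereas the product on the other side shows \<alpha>(h_(1)).\<close>

lemma clinearI:
  assumes "\<And>x y. f (x + y) = f x + f y" "\<And>c x. f (c *\<^sub>C x) = c *\<^sub>C f x"
  shows "clinear f"
  using assms by (simp add: clinear_iff)

lemma
  assumes "clinear f"
  shows clinear_add: "f (x + y) = f x + f y"
    and clinear_scale: "f (c *\<^sub>C x) = c *\<^sub>C f x"
  using assms by (auto simp: clinear_iff)

lemma clinear_zero: "clinear f \<Longrightarrow> f 0 = 0"
  using clinear_scale[of f 0 0] by (simp add: complex_vector.scale_zero_left)

lemma clinear_sum_list: "clinear f \<Longrightarrow> f (sum_list xs) = sum_list (map f xs)"
  by (induction xs) (auto simp: clinear_zero clinear_add)

lemma clinear_sum: "clinear f \<Longrightarrow> f (\<Sum>i\<in>I. g i) = (\<Sum>i\<in>I. f (g i))"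
  by (induction I rule: infinite_finite_induct) (auto simp: clinear_zero clinear_add)

text \<open>The rules collected here are phrased for composites, so that linearity of an iterated
  Sweedler sum in each of its variables reduces to linearity of its building blocks.\<close>

named_theorems lin

lemma clinear_ident [lin]: "clinear (\<lambda>x. x)"
  by (simp add: clinear_iff)

lemma clinear_compose: "clinear f \<Longrightarrow> clinear g \<Longrightarrow> clinear (\<lambda>x. f (g x))"
  by (simp add: clinear_iff)

lemma clinear_scaleC_const [lin]: "clinear f \<Longrightarrow> clinear (\<lambda>x. c *\<^sub>C f x)"
  by (simp add: clinear_iff scaleC_add_right scaleC_scaleC mult.commute)

lemma clinear_scaleC_left [lin]: "clinear f \<Longrightarrow> clinear (\<lambda>x. f x *\<^sub>C v)"
  by (simp add: clinear_iff scaleC_add_left scaleC_scaleC)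

lemma clinear_mult_const [lin]:
  "clinear f \<Longrightarrow> clinear (\<lambda>x. c * f x)" "clinear f \<Longrightarrow> clinear (\<lambda>x. f x * (c::complex))"
  by (simp_all add: clinear_iff algebra_simps)

lemma clinear_eval [lin]: "clinear g \<Longrightarrow> clinear (\<lambda>x. \<langle>\<phi>, g x\<rangle>)"
  using eval[of \<phi>] by (simp add: clinear_iff)

lemma clinear_eval_left [lin]: "clinear g \<Longrightarrow> clinear (\<lambda>x. \<langle>g x, v\<rangle>)"
  by (simp add: clinear_iff plus_dual.rep_eq scaleC_dual.rep_eq)

lemma clinear_sum_fun [lin]: "(\<And>i. clinear (f i)) \<Longrightarrow> clinear (\<lambda>x. \<Sum>i\<in>I. f i x)"
  by (simp add: clinear_iff sum.distrib complex_vector.scale_sum_right)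

lemma cbilinearI [lin]:
  "(\<And>a. clinear (F a)) \<Longrightarrow> (\<And>b. clinear (\<lambda>a. F a b)) \<Longrightarrow> cbilinear F"
  by (simp add: cbilinear_def)

lemma cbilinear_right: "cbilinear F \<Longrightarrow> clinear g \<Longrightarrow> clinear (\<lambda>x. F a (g x))"
  using clinear_compose[of "F a" g] unfolding cbilinear_def by blast

lemma cbilinear_left: "cbilinear F \<Longrightarrow> clinear g \<Longrightarrow> clinear (\<lambda>x. F (g x) b)"
  using clinear_compose[of "\<lambda>a. F a b" g] unfolding cbilinear_def by blast

lemmas clinear_pure [lin] =
  cbilinear_right[OF cbilinear_tensor_pure] cbilinear_left[OF cbilinear_tensor_pure]

text \<open>Sweedler sums: a tensor is written as a finite sum of pure tensors, chosen once and for all.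
  Unlike \<^const>\<open>tensor_lift\<close>, the sum commutes with sums and linear maps
  without any bilinearity hypothesis on the summand.\<close>

definition tensor_terms :: "'a::complex_vector \<otimes> 'b::complex_vector \<Rightarrow> ('a \<times> 'b) list" where
  "tensor_terms t = (SOME l. t = (\<Sum>(a, b)\<leftarrow>l. a \<otimes> b))"

definition tsum :: "'a::complex_vector \<otimes> 'b::complex_vector \<Rightarrow> ('a \<Rightarrow> 'b \<Rightarrow> 'c::complex_vector) \<Rightarrow> 'c" where
  "tsum t F = (\<Sum>(a, b)\<leftarrow>tensor_terms t. F a b)"

lemma tsum_pure_eq: "tsum t (\<otimes>) = t"
proof -
  have "\<exists>l. t = (\<Sum>(a, b)\<leftarrow>l. a \<otimes> b)"
  proof (induction t rule: tensor_induct)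
    case (pure a b)
    show ?case by (rule exI[of _ "[(a, b)]"]) simp
  next
    case (add s t)
    then obtain l m where "s = (\<Sum>(a, b)\<leftarrow>l. a \<otimes> b)" "t = (\<Sum>(a, b)\<leftarrow>m. a \<otimes> b)" by blast
    then show ?case by (intro exI[of _ "l @ m"]) simp
  qed
  then show ?thesis unfolding tsum_def tensor_terms_def by (rule someI2_ex) simp
qed

lemma clinear_tsum:
  assumes "clinear f"
  shows "f (tsum t F) = tsum t (\<lambda>a b. f (F a b))"
  unfolding tsum_def clinear_sum_list[OF assms] by (simp add: o_def case_prod_unfold)

text \<open>Apply the linear map \<open>tensor_lift F\<close> to the chosen decomposition of
  \<open>t\<close> into pure tensors. For bilinear \<open>F\<close> this makes the sum independent
  of that choice.\<close>

lemma tsum_eq_lift: "cbilinear F \<Longrightarrow> tensor_lift F t = tsum t F"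
  using clinear_tsum[OF clinear_tensor_lift, of F t "(\<otimes>)"] by (simp add: tsum_pure_eq tensor_lift_pure)

lemma tsum_sum_list: "tsum t (\<lambda>a b. sum_list (map (\<lambda>i. F i a b) xs)) = (\<Sum>i\<leftarrow>xs. tsum t (F i))"
  unfolding tsum_def by (induction xs) (simp_all add: sum_list_addf case_prod_unfold)

lemma tsum_swap:
  "tsum s (\<lambda>a b. tsum t (\<lambda>c d. F a b c d)) = tsum t (\<lambda>c d. tsum s (\<lambda>a b. F a b c d))"
  by (subst (2) tsum_def, subst (2) tsum_def)
    (simp add: case_prod_unfold tsum_sum_list)

lemma tsum_add: "tsum t (\<lambda>a b. F a b + G a b) = tsum t F + tsum t G"
  by (simp add: tsum_def sum_list_addf case_prod_unfold)

lemma tsum_zero [simp]: "tsum t (\<lambda>a b. 0) = 0"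
  by (simp add: tsum_def case_prod_unfold)

lemma tsum_scale: "tsum t (\<lambda>a b. c *\<^sub>C F a b) = c *\<^sub>C tsum t F"
  by (rule clinear_tsum[symmetric]) (intro lin)

lemma tsum_sum: "tsum t (\<lambda>a b. \<Sum>i\<in>I. F i a b) = (\<Sum>i\<in>I. tsum t (F i))"
  by (induction I rule: infinite_finite_induct) (auto simp: tsum_add)

lemma clinear_tsum_fun [lin]:
  assumes "\<And>a b. clinear (\<lambda>x. F x a b)"
  shows "clinear (\<lambda>x. tsum t (F x))"
proof (rule clinearI)
  show "tsum t (F (x + y)) = tsum t (F x) + tsum t (F y)" for x y
    unfolding tsum_add[symmetric] clinear_add[OF assms, symmetric] ..
  show "tsum t (F (c *\<^sub>C x)) = c *\<^sub>C tsum t (F x)" for c x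
    unfolding tsum_scale[symmetric] clinear_scale[OF assms, symmetric] ..
qed

lemma clinear_tsum_arg:
  assumes "\<And>a. clinear (F a)" "\<And>b. clinear (\<lambda>a. F a b)"
  shows "clinear (\<lambda>t. tsum t F)"
proof -
  have F: "cbilinear F" using assms by (rule cbilinearI)
  have "tensor_lift F = (\<lambda>t. tsum t F)" by (simp add: fun_eq_iff tsum_eq_lift[OF F])
  then show ?thesis using clinear_tensor_lift[OF F] by simp
qed

lemma clinear_tsum_left [lin]:
  assumes "clinear g" "\<And>a. clinear (F a)" "\<And>b. clinear (\<lambda>a. F a b)"
  shows "clinear (\<lambda>x. tsum (g x) F)"
  using clinear_compose[OF clinear_tsum_arg assms(1)] assms(2,3) by blast

lemma tsum_pure:
  assumes "\<And>a. clinear (F a)" "\<And>b. clinear (\<lambda>a. F a b)"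
  shows "tsum (a \<otimes> b) F = F a b"
  using tensor_lift_pure[OF cbilinearI, of F] assms by (simp add: tsum_eq_lift[OF cbilinearI])

lemma tsum_tsum:
  assumes "\<And>a. clinear (F a)" "\<And>b. clinear (\<lambda>a. F a b)"
  shows "tsum (tsum t G) F = tsum t (\<lambda>a b. tsum (G a b) F)"
  by (rule clinear_tsum[of "\<lambda>t. tsum t F"]) (intro lin assms)

lemma tensor_map_tsum:
  assumes "clinear f" "clinear g"
  shows "tensor_map f g t = tsum t (\<lambda>a b. f a \<otimes> g b)"
  unfolding tensor_map_def by (intro tsum_eq_lift lin assms)

lemma clinear_tensor_map [lin]:
  assumes "clinear f" "clinear g" "clinear h"
  shows "clinear (\<lambda>x. tensor_map f g (h x))"
  unfolding tensor_map_tsum[OF assms(1,2)]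
  using clinear_compose[OF assms(1)] clinear_compose[OF assms(2)] by (intro lin assms)

lemma tensor_map_pure:
  assumes "clinear f" "clinear g"
  shows "tensor_map f g (a \<otimes> b) = f a \<otimes> g b"
  unfolding tensor_map_def by (intro tensor_lift_pure lin) (intro clinear_compose[OF assms(1)] clinear_compose[OF assms(2)] assms lin)+

lemma tensor_map_comp:
  assumes "clinear f" "clinear g" "clinear f'" "clinear g'"
  shows "tensor_map f g (tensor_map f' g' t) = tensor_map (\<lambda>x. f (f' x)) (\<lambda>x. g (g' x)) t"
  by (induction t rule: tensor_induct)
    (simp_all add: tensor_map_pure assms clinear_compose clinear_add[OF clinear_tensor_map[OF _ _ lin(1)]])

lemma tensor_assoc_eq:
  "tensor_assoc t = tsum t (\<lambda>u c. tsum u (\<lambda>a b. a \<otimes> (b \<otimes> c)))"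
proof -
  have *: "tensor_lift (\<lambda>a b. a \<otimes> (b \<otimes> c)) u = tsum u (\<lambda>a b. a \<otimes> (b \<otimes> c))"
    for u :: "'a \<otimes> 'b" and c :: 'c
    by (intro tsum_eq_lift lin)
  show ?thesis unfolding tensor_assoc_def * by (intro tsum_eq_lift lin)
qed

section \<open>Sweedler calculus\<close>

abbreviation (in unital_algebra) times (infixl \<open>\<cdot>\<close> 70) where "x \<cdot> y \<equiv> mult A x y"

context unital_algebra
begin

lemmas clinear_times_right [lin] = cbilinear_right[OF mult_bilinear]
lemmas clinear_times_left [lin] = cbilinear_left[OF mult_bilinear]

lemma times_tsum: "a \<cdot> tsum t F = tsum t (\<lambda>x y. a \<cdot> F x y)"
  and tsum_times: "tsum t F \<cdot> a = tsum t (\<lambda>x y. F x y \<cdot> a)"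
  by (rule clinear_tsum, intro lin)+

lemma times_scaleC: "a \<cdot> (c *\<^sub>C b) = c *\<^sub>C (a \<cdot> b)"
  and scaleC_times: "(c *\<^sub>C a) \<cdot> b = c *\<^sub>C (a \<cdot> b)"
  by (rule clinear_scale, intro lin)+

end

lemma scaleC_tsum: "c *\<^sub>C tsum t F = tsum t (\<lambda>x y. c *\<^sub>C F x y)"
  by (simp add: tsum_scale)

lemma tsum_scaleC: "tsum t F *\<^sub>C v = tsum t (\<lambda>x y. F x y *\<^sub>C v)"
  by (rule clinear_tsum, intro lin)

lemma mult_tsum: "(c::complex) * tsum t F = tsum t (\<lambda>x y. c * F x y)"
  and tsum_mult: "tsum t F * c = tsum t (\<lambda>x y. F x y * c)"
  by (rule clinear_tsum, intro lin)+

lemma eval_tsum: "\<langle>\<phi>, tsum t F\<rangle> = tsum t (\<lambda>x y. \<langle>\<phi>, F x y\<rangle>)"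
  and eval_scaleC: "\<langle>\<phi>, c *\<^sub>C v\<rangle> = c * \<langle>\<phi>, v\<rangle>"
  and eval_sum: "\<langle>\<phi>, \<Sum>i\<in>I. f i\<rangle> = (\<Sum>i\<in>I. \<langle>\<phi>, f i\<rangle>)"
  using clinear_eval[OF clinear_ident, of \<phi>]
  by (simp_all add: clinear_tsum clinear_scale clinear_sum)

lemma tensor_tsum: "v \<otimes> tsum t F = tsum t (\<lambda>x y. v \<otimes> F x y)"
  and tsum_tensor: "tsum t F \<otimes> w = tsum t (\<lambda>x y. F x y \<otimes> w)"
  by (rule clinear_tsum, intro lin)+

lemma tensor_scaleC: "v \<otimes> (c *\<^sub>C w) = c *\<^sub>C (v \<otimes> w)"
  and scaleC_tensor: "(c *\<^sub>C v) \<otimes> w = c *\<^sub>C (v \<otimes> w)"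
  by (rule clinear_scale, intro lin)+

lemma tensor_map_tsum_arg:
  assumes "clinear f" "clinear g"
  shows "tensor_map f g (tsum t F) = tsum t (\<lambda>x y. tensor_map f g (F x y))"
  by (rule clinear_tsum) (intro lin assms)

abbreviation (in bialgebra) sw :: "'k \<Rightarrow> ('k \<Rightarrow> 'k \<Rightarrow> 'v::complex_vector) \<Rightarrow> 'v" where
  "sw x F \<equiv> tsum (comult K x) F"
abbreviation (in bialgebra) htimes (infixl \<open>\<cdot>\<close> 70) where "x \<cdot> y \<equiv> mult K x y"
abbreviation (in bialgebra) hunit (\<open>\<one>\<close>) where "\<one> \<equiv> one K"
abbreviation (in bialgebra) hcounit (\<open>\<epsilon>\<close>) where "\<epsilon> \<equiv> counit K"

lemma sweedler2_eq: "cbilinear F \<Longrightarrow> sweedler2 K x F = tsum (comult K x) F"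
  unfolding sweedler2_def by (rule tsum_eq_lift)

lemma tensor_alg_mult:
  assumes "cbilinear (mult A)" "cbilinear (mult B)"
  shows "mult (tensor_alg A B) s t =
    tsum s (\<lambda>a b. tsum t (\<lambda>a' b'. mult A a a' \<otimes> mult B b b'))"
proof -
  note [lin] = cbilinear_right[OF assms(1)] cbilinear_left[OF assms(1)]
    cbilinear_right[OF assms(2)] cbilinear_left[OF assms(2)]
  have *: "tensor_lift (\<lambda>a' b'. mult A a a' \<otimes> mult B b b') t =
      tsum t (\<lambda>a' b'. mult A a a' \<otimes> mult B b b')" for a b
    by (intro tsum_eq_lift lin)
  show ?thesis unfolding tensor_alg_def alg.simps * by (intro tsum_eq_lift lin)
qed

lemma tensor_alg_one: "one (tensor_alg A B) = one A \<otimes> one B"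
  by (simp add: tensor_alg_def)

context bialgebra
begin

lemma clinear_comult: "clinear (comult K)" and clinear_counit: "clinear \<epsilon>"
  using comult_hom counit_hom by (auto simp: algebra_hom_def)

lemmas clinear_comult_fun [lin] = clinear_compose[OF clinear_comult]
lemmas clinear_counit_fun [lin] = clinear_compose[OF clinear_counit]

lemma counit_times [simp]: "\<epsilon> (x \<cdot> y) = \<epsilon> x * \<epsilon> y"
  and counit_one [simp]: "\<epsilon> \<one> = 1"
  using counit_hom by (auto simp: algebra_hom_def complex_alg_def)

lemma counit_scaleC: "\<epsilon> (c *\<^sub>C x) = c * \<epsilon> x"
  using clinear_scale[OF clinear_counit] by simp

lemma counit_tsum: "\<epsilon> (tsum t F) = tsum t (\<lambda>x y. \<epsilon> (F x y))"
  by (rule clinear_tsum[OF clinear_counit])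

lemma comult_times:
  "comult K (x \<cdot> y) = sw x (\<lambda>x1 x2. sw y (\<lambda>y1 y2. (x1 \<cdot> y1) \<otimes> (x2 \<cdot> y2)))"
  using comult_hom unfolding algebra_hom_def by (simp add: tensor_alg_mult mult_bilinear)

lemma comult_one: "comult K \<one> = \<one> \<otimes> \<one>"
  using comult_hom unfolding algebra_hom_def by (simp add: tensor_alg_one)

lemma sw_times:
  assumes "\<And>a. clinear (F a)" "\<And>b. clinear (\<lambda>a. F a b)"
  shows "sw (x \<cdot> y) F = sw x (\<lambda>x1 x2. sw y (\<lambda>y1 y2. F (x1 \<cdot> y1) (x2 \<cdot> y2)))"
  unfolding comult_times using assms by (simp add: tsum_tsum tsum_pure)

lemma sw_one:
  assumes "\<And>a. clinear (F a)" "\<And>b. clinear (\<lambda>a. F a b)"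
  shows "sw \<one> F = F \<one> \<one>"
  unfolding comult_one using assms by (rule tsum_pure)

lemma sw_counit_left: "clinear F \<Longrightarrow> sw x (\<lambda>a b. \<epsilon> a *\<^sub>C F b) = F x"
  using clinear_tsum[of F "comult K x" "\<lambda>a b. \<epsilon> a *\<^sub>C b"] counit_left[of x]
  by (simp add: tsum_eq_lift[OF cbilinearI] lin clinear_scale)

lemma sw_counit_right: "clinear F \<Longrightarrow> sw x (\<lambda>a b. \<epsilon> b *\<^sub>C F a) = F x"
  using clinear_tsum[of F "comult K x" "\<lambda>a b. \<epsilon> b *\<^sub>C a"] counit_right[of x]
  by (simp add: tsum_eq_lift[OF cbilinearI] lin clinear_scale)

text \<open>Coassociativity tested against a trilinear map. The right-nested side serves as the
  normal form of iterated coproducts throughout.\<close>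

lemma sw_assoc:
  assumes "\<And>a b. clinear (\<lambda>c. F a b c)" "\<And>a c. clinear (\<lambda>b. F a b c)" "\<And>b c. clinear (\<lambda>a. F a b c)"
  shows "sw x (\<lambda>a b. sw a (\<lambda>c d. F c d b)) = sw x (\<lambda>a b. sw b (\<lambda>c d. F a c d))"
proof -
  have "tsum (tensor_map id (comult K) (comult K x)) (\<lambda>a t. tsum t (F a)) =
    tsum (tensor_assoc (tensor_map (comult K) id (comult K x))) (\<lambda>a t. tsum t (F a))"
    by (simp only: coassoc)
  then show ?thesis
    using clinear_comult assms
    by (simp add: tensor_map_tsum lin tsum_tsum tsum_pure tensor_assoc_eq id_def)
qed

end

text \<open>Two-sided inverses in the convolution algebra are unique: S(x_(1)) x_(2) T(x_(3))
  reduces to T(x) or to S(x), depending on which pair is cancelled first.\<close>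

lemma (in hopf_algebra) antipode_unique:
  assumes "is_antipode K S" "is_antipode K T"
  shows "S = T"
proof
  fix x
  have S: "clinear S" "clinear T" using assms by (auto simp: is_antipode_def)
  note [lin] = S[THEN clinear_compose]
  have l: "sw x (\<lambda>a b. S a \<cdot> b) = \<epsilon> x *\<^sub>C \<one>" for x
    using assms(1) unfolding is_antipode_def by (simp add: tsum_eq_lift[OF cbilinearI] lin)
  have r: "sw x (\<lambda>a b. a \<cdot> T b) = \<epsilon> x *\<^sub>C \<one>" for x
    using assms(2) unfolding is_antipode_def by (simp add: tsum_eq_lift[OF cbilinearI] lin)
  have "T x = sw x (\<lambda>a b. sw a (\<lambda>c d. S c \<cdot> d) \<cdot> T b)"
    by (simp add: l scaleC_times one_mult sw_counit_left S)
  also have "\<dots> = sw x (\<lambda>a b. S a \<cdot> sw b (\<lambda>c d. c \<cdot> T d))"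
    unfolding times_tsum tsum_times mult_assoc by (rule sw_assoc; intro lin)
  also have "\<dots> = S x"
    by (simp add: r times_scaleC mult_one sw_counit_right S)
  finally show "S x = T x" ..
qed

section \<open>The antipode reverses products and coproducts\<close>

context hopf_algebra
begin

definition S :: "'k \<Rightarrow> 'k" where "S = antipode K"

lemma is_antipode_S: "is_antipode K S"
proof -
  have "\<exists>!S. is_antipode K S" using ex_antipode antipode_unique by blast
  then show ?thesis unfolding S_def antipode_def by (rule theI')
qed

lemma clinear_S: "clinear S"
  using is_antipode_S by (simp add: is_antipode_def)

lemmas clinear_S_fun [lin] = clinear_compose[OF clinear_S]

lemma S_scaleC: "S (c *\<^sub>C x) = c *\<^sub>C S x"
  by (rule clinear_scale[OF clinear_S])

lemma antipode_left: "sw x (\<lambda>a b. S a \<cdot> b) = \<epsilon> x *\<^sub>C \<one>"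
  and antipode_right: "sw x (\<lambda>a b. a \<cdot> S b) = \<epsilon> x *\<^sub>C \<one>"
  using is_antipode_S unfolding is_antipode_def
  by (simp_all add: tsum_eq_lift[OF cbilinearI] lin)

text \<open>Allows an adjacent pair S(x_(1)) x_(2) to be cancelled inside an arbitrary linear
  context \<open>G\<close>.\<close>

lemma sw_antipode_left:
  assumes "\<And>a b. F a b = G (S a \<cdot> b)" "clinear G"
  shows "sw x F = \<epsilon> x *\<^sub>C G \<one>"
  using clinear_tsum[OF assms(2), of "comult K x" "\<lambda>a b. S a \<cdot> b"]
  unfolding antipode_left clinear_scale[OF assms(2)] assms(1)[symmetric] ..

lemma sw_antipode_right:
  assumes "\<And>a b. F a b = G (a \<cdot> S b)" "clinear G"
  shows "sw x F = \<epsilon> x *\<^sub>C G \<one>"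
  using clinear_tsum[OF assms(2), of "comult K x" "\<lambda>a b. a \<cdot> S b"]
  unfolding antipode_right clinear_scale[OF assms(2)] assms(1)[symmetric] ..

lemma S_one [simp]: "S \<one> = \<one>"
  using antipode_left[of \<one>] by (simp add: sw_one lin mult_one scaleC_one)

lemma counit_S [simp]: "\<epsilon> (S x) = \<epsilon> x"
proof -
  have "\<epsilon> (S x) = sw x (\<lambda>a b. \<epsilon> b *\<^sub>C \<epsilon> (S a))"
    by (rule sw_counit_right[symmetric]) (intro lin)
  also have "\<dots> = \<epsilon> (sw x (\<lambda>a b. S a \<cdot> b))"
    by (simp add: counit_tsum mult.commute)
  finally show ?thesis by (simp add: antipode_left counit_scaleC)
qed

text \<open>Both sides are convolution inverses of the multiplication map on pairs (x, y). The
  auxiliary term is S(x_(1) y_(1)) x_(2) y_(2) S(y_(3)) S(x_(3)); cancelling on the right gives one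
  side, cancelling on the left the other.\<close>

lemma S_times: "S (x \<cdot> y) = S y \<cdot> S x"
proof -
  let ?E = "sw x (\<lambda>x1 r. sw r (\<lambda>x2 x3. sw y (\<lambda>y1 s. sw s (\<lambda>y2 y3.
     S (x1 \<cdot> y1) \<cdot> (x2 \<cdot> (y2 \<cdot> (S y3 \<cdot> S x3)))))))"
  have "?E = sw x (\<lambda>x1 r. sw r (\<lambda>x2 x3. sw y (\<lambda>y1 s.
     S (x1 \<cdot> y1) \<cdot> (x2 \<cdot> (sw s (\<lambda>y2 y3. y2 \<cdot> S y3) \<cdot> S x3)))))"
    by (simp add: times_tsum tsum_times mult_assoc)
  also have "\<dots> = sw x (\<lambda>x1 r. sw r (\<lambda>x2 x3. S (x1 \<cdot> y) \<cdot> (x2 \<cdot> S x3)))"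
    by (simp add: antipode_right scaleC_times times_scaleC one_mult sw_counit_right lin)
  also have "\<dots> = sw x (\<lambda>x1 r. S (x1 \<cdot> y) \<cdot> sw r (\<lambda>x2 x3. x2 \<cdot> S x3))"
    by (simp add: times_tsum)
  also have "\<dots> = S (x \<cdot> y)"
    by (simp add: antipode_right times_scaleC mult_one sw_counit_right lin)
  finally have 1: "?E = S (x \<cdot> y)" .
  have "?E = sw x (\<lambda>r x3. sw r (\<lambda>x1 x2. sw y (\<lambda>s y3. sw s (\<lambda>y1 y2.
     S (x1 \<cdot> y1) \<cdot> (x2 \<cdot> (y2 \<cdot> (S y3 \<cdot> S x3)))))))"
    by (simp add: sw_assoc lin)
  also have "\<dots> = sw x (\<lambda>r x3. sw y (\<lambda>s y3. sw r (\<lambda>x1 x2. sw s (\<lambda>y1 y2.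
     S (x1 \<cdot> y1) \<cdot> (x2 \<cdot> y2))) \<cdot> (S y3 \<cdot> S x3)))"
    by (simp add: tsum_times mult_assoc) (subst tsum_swap, rule refl)
  also have "\<dots> = sw x (\<lambda>r x3. sw y (\<lambda>s y3. sw (r \<cdot> s) (\<lambda>a b. S a \<cdot> b) \<cdot> (S y3 \<cdot> S x3)))"
    by (simp add: sw_times lin)
  also have "\<dots> = sw x (\<lambda>r x3. \<epsilon> r *\<^sub>C sw y (\<lambda>s y3. \<epsilon> s *\<^sub>C (S y3 \<cdot> S x3)))"
    by (simp add: antipode_left scaleC_times one_mult scaleC_tsum)
  also have "\<dots> = S y \<cdot> S x"
    by (simp add: sw_counit_left lin)
  finally show ?thesis using 1 by simp
qed

text \<open>Dual to the product rule: both sides are convolution inverses of the coproduct, here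
  tested against a bilinear \<open>F\<close>. The auxiliary term multiplies the coproduct of
  S(x_(1)) by x_(2) S(x_(5)) in the first leg and by x_(3) S(x_(4)) in the second.\<close>

lemma sw_S:
  assumes [lin]: "\<And>a. clinear (F a)" "\<And>b. clinear (\<lambda>a. F a b)"
  shows "sw (S x) F = sw x (\<lambda>a b. F (S b) (S a))"
proof -
  note [lin] = assms[THEN clinear_compose]
  let ?E = "sw x (\<lambda>x1 r. sw (S x1) (\<lambda>a b. sw r (\<lambda>x2 r. sw r (\<lambda>x3 r. sw r (\<lambda>x4 x5.
     F (a \<cdot> (x2 \<cdot> S x5)) (b \<cdot> (x3 \<cdot> S x4)))))))"
  have e: "sw r (\<lambda>x3 x4. F (a \<cdot> (x2 \<cdot> S y)) (b \<cdot> (x3 \<cdot> S x4))) =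
    \<epsilon> r *\<^sub>C F (a \<cdot> (x2 \<cdot> S y)) b" for r x2 a b y
    by (subst sw_antipode_right[where G="\<lambda>z. F (a \<cdot> (x2 \<cdot> S y)) (b \<cdot> z)"])
        (simp_all add: lin mult_one)
  have c: "sw r (\<lambda>x3 r. sw r (\<lambda>x4 x5. F (a \<cdot> (x2 \<cdot> S x5)) (b \<cdot> (x3 \<cdot> S x4)))) =
    F (a \<cdot> (x2 \<cdot> S r)) b" for r x2 a b
  proof -
    have "sw r (\<lambda>x3 r. sw r (\<lambda>x4 x5. F (a \<cdot> (x2 \<cdot> S x5)) (b \<cdot> (x3 \<cdot> S x4)))) =
       sw r (\<lambda>r x5. sw r (\<lambda>x3 x4. F (a \<cdot> (x2 \<cdot> S x5)) (b \<cdot> (x3 \<cdot> S x4))))"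
      by (simp add: sw_assoc lin)
    also have "\<dots> = sw r (\<lambda>r x5. \<epsilon> r *\<^sub>C F (a \<cdot> (x2 \<cdot> S x5)) b)"
      by (simp add: e)
    also have "\<dots> = F (a \<cdot> (x2 \<cdot> S r)) b"
      by (rule sw_counit_left) (intro lin)
    finally show ?thesis .
  qed
  have d: "sw r (\<lambda>x2 r. F (a \<cdot> (x2 \<cdot> S r)) b) = \<epsilon> r *\<^sub>C F a b" for r a b
    by (subst sw_antipode_right[where G="\<lambda>z. F (a \<cdot> z) b"]) (simp_all add: lin mult_one)
  have f: "sw r (\<lambda>x1 x2. sw (S x1 \<cdot> x2) (\<lambda>a b. sw r' (\<lambda>x4 x5. F (a \<cdot> S x5) (b \<cdot> S x4)))) =
    \<epsilon> r *\<^sub>C sw r' (\<lambda>x4 x5. F (S x5) (S x4))" for r r'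
    by (subst sw_antipode_left[where G="\<lambda>z. sw z (\<lambda>a b. sw r' (\<lambda>x4 x5. F (a \<cdot> S x5) (b \<cdot> S x4)))"])
      (simp_all add: sw_one lin one_mult)
  have "?E = sw x (\<lambda>x1 r. \<epsilon> r *\<^sub>C sw (S x1) (\<lambda>a b. F a b))"
    by (simp add: c d tsum_scale)
  also have "\<dots> = sw (S x) F"
    by (simp add: sw_counit_right lin)
  finally have 1: "?E = sw (S x) F" .
  have "?E = sw x (\<lambda>x1 r. sw r (\<lambda>x2 r. sw (S x1) (\<lambda>a b. sw x2 (\<lambda>x2 x3. sw r (\<lambda>x4 x5.
     F (a \<cdot> (x2 \<cdot> S x5)) (b \<cdot> (x3 \<cdot> S x4)))))))"
    by (subst (2) tsum_swap) (simp add: sw_assoc lin)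
  also have "\<dots> = sw x (\<lambda>r r'. sw r (\<lambda>x1 x2. sw (S x1) (\<lambda>a b. sw x2 (\<lambda>x2 x3. sw r' (\<lambda>x4 x5.
     F (a \<cdot> (x2 \<cdot> S x5)) (b \<cdot> (x3 \<cdot> S x4)))))))"
    by (simp add: sw_assoc lin)
  also have "\<dots> = sw x (\<lambda>r r'. sw r (\<lambda>x1 x2. sw (S x1 \<cdot> x2) (\<lambda>a b. sw r' (\<lambda>x4 x5.
     F (a \<cdot> S x5) (b \<cdot> S x4)))))"
    by (simp add: sw_times lin mult_assoc)
  also have "\<dots> = sw x (\<lambda>r r'. \<epsilon> r *\<^sub>C sw r' (\<lambda>x4 x5. F (S x5) (S x4)))"
    by (simp add: f)
  also have "\<dots> = sw x (\<lambda>a b. F (S b) (S a))"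
    by (simp add: sw_counit_left lin)
  finally show ?thesis using 1 by simp
qed

end

section \<open>Bijectivity of the antipode in finite dimension\<close>

lemma dual_eqI: "(\<And>x. \<langle>\<phi>, x\<rangle> = \<langle>\<psi>, x\<rangle>) \<Longrightarrow> \<phi> = \<psi>"
  by (metis eval_inject ext)

lemma eval_Abs_dual: "clinear f \<Longrightarrow> \<langle>Abs_dual f, x\<rangle> = f x"
  by (simp add: Abs_dual_inverse)

lemma eval_plus [simp]: "\<langle>\<phi> + \<psi>, x\<rangle> = \<langle>\<phi>, x\<rangle> + \<langle>\<psi>, x\<rangle>"
  and eval_zero [simp]: "\<langle>0, x\<rangle> = 0"
  and eval_scale [simp]: "\<langle>c *\<^sub>C \<phi>, x\<rangle> = c * \<langle>\<phi>, x\<rangle>"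
  by (simp_all add: plus_dual.rep_eq zero_dual.rep_eq scaleC_dual.rep_eq)

lemma eval_sum_left: "\<langle>\<Sum>i\<in>I. f i, x\<rangle> = (\<Sum>i\<in>I. \<langle>f i, x\<rangle>)"
  by (induction I rule: infinite_finite_induct) auto

text \<open>Coordinate functionals are indexed by the basis vectors themselves. The expansion
  identity is the form in which a basis is used later: it is inserted into linear contexts, and
  traces are sums over \<open>B\<close>.\<close>

definition dual_basis :: "'a::complex_vector set \<Rightarrow> ('a \<Rightarrow> 'a dual) \<Rightarrow> bool" where
  "dual_basis B c \<longleftrightarrow> finite B \<and> (\<forall>v. (\<Sum>b\<in>B. \<langle>c b, v\<rangle> *\<^sub>C b) = v)"

lemma ex_dual_basis:
  assumes "finite_dimensional_vector_space scaleC (B :: 'a::complex_vector set)"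
  obtains c where "dual_basis B c"
proof -
  interpret finite_dimensional_vector_space scaleC B by (rule assms)
  define c where "c b = Abs_dual (\<lambda>v. complex_vector.representation B v b)" for b
  have lin: "clinear (\<lambda>v. complex_vector.representation B v b)" for b
    using independent_Basis span_Basis
    by (intro clinearI) (simp_all add: complex_vector.representation_add complex_vector.representation_scale)
  have "dual_basis B c"
    unfolding dual_basis_def c_def eval_Abs_dual[OF lin]
    using independent_Basis span_Basis finite_Basis
    by (auto intro!: complex_vector.sum_representation_eq)
  then show ?thesis by (rule that)
qed

lemma dual_basis_expand: "dual_basis B c \<Longrightarrow> (\<Sum>b\<in>B. \<langle>c b, v\<rangle> *\<^sub>C b) = v"
  by (auto simp: dual_basis_def)

lemma dual_basis_expand_fun:
  assumes "dual_basis B c" "clinear F"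
  shows "(\<Sum>b\<in>B. \<langle>c b, v\<rangle> *\<^sub>C F b) = F v"
  using clinear_sum[OF assms(2), of "\<lambda>b. \<langle>c b, v\<rangle> *\<^sub>C b" B]
  by (simp add: dual_basis_expand[OF assms(1)] clinear_scale[OF assms(2)])

lemma dual_basis_expand_dual:
  assumes "dual_basis B c"
  shows "(\<Sum>b\<in>B. \<langle>\<phi>, b\<rangle> *\<^sub>C c b) = \<phi>"
proof (rule dual_eqI)
  fix v
  have "\<langle>\<phi>, v\<rangle> = (\<Sum>b\<in>B. \<langle>c b, v\<rangle> *\<^sub>C \<langle>\<phi>, b\<rangle>)"
    by (rule dual_basis_expand_fun[OF assms, symmetric]) (intro lin)
  then show "\<langle>\<Sum>b\<in>B. \<langle>\<phi>, b\<rangle> *\<^sub>C c b, v\<rangle> = \<langle>\<phi>, v\<rangle>"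
    by (simp add: eval_sum_left mult.commute)
qed

lemma vanishing_functionals:
  fixes v :: "'a::complex_vector" and B :: "'a set"
  assumes "dual_basis B c" "\<And>\<phi>. \<langle>\<phi>, v\<rangle> = 0"
  shows "v = 0"
  using dual_basis_expand[OF assms(1), of v] by (simp add: assms(2))

locale fd_hopf_algebra = hopf_algebra K
  for K :: "('k::complex_vector, 'x) bialg_scheme" +
  fixes B :: "'k set" and c :: "'k \<Rightarrow> 'k dual"
  assumes finite_dim: "finite_dimensional_vector_space scaleC B"
    and dual_basis: "dual_basis B c"
begin

lemmas expand = dual_basis_expand_fun[OF dual_basis]

text \<open>The trace of \<open>b \<mapsto> f(b\<^sub>2) x S\<^sup>2(b\<^sub>1)\<close> is an invariant integral without any
  assumption on \<open>S\<close>; a nonzero integral then forces \<open>S\<close> to be injective.\<close>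

definition twisted_mult :: "'k dual \<Rightarrow> 'k \<Rightarrow> 'k \<Rightarrow> 'k" where
  "twisted_mult f x b = sw b (\<lambda>b1 b2. \<langle>f, b2\<rangle> *\<^sub>C (x \<cdot> S (S b1)))"

definition integral :: "'k dual \<Rightarrow> 'k \<Rightarrow> complex" where
  "integral f x = (\<Sum>b\<in>B. \<langle>c b, twisted_mult f x b\<rangle>)"

lemma clinear_twisted_mult [lin]:
  "clinear g \<Longrightarrow> clinear (\<lambda>y. twisted_mult f x (g y))"
  "clinear g \<Longrightarrow> clinear (\<lambda>y. twisted_mult f (g y) b)"
  unfolding twisted_mult_def by (intro lin; assumption)+

lemma clinear_integral [lin]: "clinear g \<Longrightarrow> clinear (\<lambda>y. integral f (g y))"
  unfolding integral_def by (intro lin)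

text \<open>This is where S^2 in \<open>twisted_mult\<close> pays off. S^2 preserves coproducts, so
  the first leg on the right is x_(1) S^2(b_(2)) S(b_(1)) = x_(1) S(b_(1) S(b_(2))), and the factors
  from b cancel.\<close>

lemma twisted_mult_comult:
  assumes [lin]: "\<And>a. clinear (G a)" "\<And>b. clinear (\<lambda>a. G a b)"
  shows "sw x (\<lambda>x1 x2. G x1 (twisted_mult f x2 b)) =
    sw b (\<lambda>b1 b2. sw (twisted_mult f x b2) (\<lambda>n1 n2. G (n1 \<cdot> S b1) n2))"
proof -
  note [lin] = assms[THEN clinear_compose]
  have "sw b (\<lambda>b1 b2. sw (twisted_mult f x b2) (\<lambda>n1 n2. G (n1 \<cdot> S b1) n2)) =
    sw b (\<lambda>b1 b2. sw b2 (\<lambda>b2 b3. \<langle>f, b3\<rangle> *\<^sub>C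
      sw (x \<cdot> S (S b2)) (\<lambda>n1 n2. G (n1 \<cdot> S b1) n2)))"
    unfolding twisted_mult_def
    by (simp add: clinear_tsum[of "\<lambda>y. sw y _"] clinear_scale[of "\<lambda>y. sw y _"] lin)
  also have "\<dots> = sw b (\<lambda>b1 b2. sw b2 (\<lambda>b2 b3. sw x (\<lambda>x1 x2. sw b2 (\<lambda>p q.
      \<langle>f, b3\<rangle> *\<^sub>C G (x1 \<cdot> S (b1 \<cdot> S p)) (x2 \<cdot> S (S q))))))"
    by (simp add: sw_times sw_S lin mult_assoc S_times scaleC_tsum)
  also have "\<dots> = sw x (\<lambda>x1 x2. sw b (\<lambda>b1 b2. sw b2 (\<lambda>b2 b3. sw b2 (\<lambda>p q.
      \<langle>f, b3\<rangle> *\<^sub>C G (x1 \<cdot> S (b1 \<cdot> S p)) (x2 \<cdot> S (S q))))))"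
    by (subst tsum_swap, subst (2) tsum_swap) (rule refl)
  also have "\<dots> = sw x (\<lambda>x1 x2. sw b (\<lambda>r r'. sw r (\<lambda>b1 p. sw r' (\<lambda>q b3.
      \<langle>f, b3\<rangle> *\<^sub>C G (x1 \<cdot> S (b1 \<cdot> S p)) (x2 \<cdot> S (S q))))))"
    by (simp add: sw_assoc lin)
  also have "\<dots> = sw x (\<lambda>x1 x2. sw b (\<lambda>r r'. \<epsilon> r *\<^sub>C sw r' (\<lambda>q b3.
      \<langle>f, b3\<rangle> *\<^sub>C G x1 (x2 \<cdot> S (S q)))))"
  proof -
    have "sw r (\<lambda>b1 p. sw r' (\<lambda>q b3. \<langle>f, b3\<rangle> *\<^sub>C G (x1 \<cdot> S (b1 \<cdot> S p)) (x2 \<cdot> S (S q)))) =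
      \<epsilon> r *\<^sub>C sw r' (\<lambda>q b3. \<langle>f, b3\<rangle> *\<^sub>C G x1 (x2 \<cdot> S (S q)))" for r r' x1 x2
      by (subst sw_antipode_right[where G = "\<lambda>z. sw r' (\<lambda>q b3. \<langle>f, b3\<rangle> *\<^sub>C G (x1 \<cdot> S z) (x2 \<cdot> S (S q)))"])
        (simp_all add: lin mult_one)
    then show ?thesis by simp
  qed
  also have "\<dots> = sw x (\<lambda>x1 x2. G x1 (twisted_mult f x2 b))"
    unfolding twisted_mult_def
    by (simp add: sw_counit_left lin clinear_tsum[of "G _"] clinear_scale[of "G _"])
  finally show ?thesis ..
qed

text \<open>A form of tr(PQ) = tr(QP) with an extra output \<open>G\<close>: expanding N(b_(2)) in
  the basis and then summing over the original index moves the coproduct of N(b_(2)) from after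
  \<open>N\<close> to before it.\<close>

lemma trace_cyclic:
  assumes [lin]: "clinear N" "\<And>a. clinear (G a)" "\<And>b. clinear (\<lambda>a. G a b)"
  shows "(\<Sum>b\<in>B. sw b (\<lambda>b1 b2. sw (N b2) (\<lambda>n1 n2. \<langle>c b, n2\<rangle> *\<^sub>C G n1 b1))) =
    (\<Sum>b\<in>B. sw b (\<lambda>b1 b2. sw b2 (\<lambda>b2 b3. \<langle>c b, N b3\<rangle> *\<^sub>C G b1 b2)))"
proof -
  note [lin] = assms[THEN clinear_compose]
  have "(\<Sum>b\<in>B. sw b (\<lambda>b1 b2. sw (N b2) (\<lambda>n1 n2. \<langle>c b, n2\<rangle> *\<^sub>C G n1 b1))) =
    (\<Sum>b\<in>B. sw b (\<lambda>b1 b2. \<Sum>d\<in>B. \<langle>c d, N b2\<rangle> *\<^sub>C sw d (\<lambda>n1 n2. \<langle>c b, n2\<rangle> *\<^sub>C G n1 b1)))"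
    by (subst expand) (auto intro!: lin)
  also have "\<dots> = (\<Sum>d\<in>B. \<Sum>b\<in>B. sw d (\<lambda>n1 n2. sw b (\<lambda>b1 b2. \<langle>c b, n2\<rangle> *\<^sub>C \<langle>c d, N b2\<rangle> *\<^sub>C G n1 b1)))"
    by (simp only: tsum_sum, subst sum.swap, intro sum.cong refl, simp add: scaleC_tsum, subst tsum_swap)
      (simp add: mult.commute)
  also have "\<dots> = (\<Sum>d\<in>B. sw d (\<lambda>n1 n2. \<Sum>b\<in>B. \<langle>c b, n2\<rangle> *\<^sub>C sw b (\<lambda>b1 b2. \<langle>c d, N b2\<rangle> *\<^sub>C G n1 b1)))"
    by (simp add: tsum_sum scaleC_tsum)
  also have "\<dots> = (\<Sum>d\<in>B. sw d (\<lambda>n1 n2. sw n2 (\<lambda>b1 b2. \<langle>c d, N b2\<rangle> *\<^sub>C G n1 b1)))"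
    by (subst expand) (auto intro!: lin)
  finally show ?thesis .
qed

text \<open>The previous two lemmas turn x_(1) into N(b_(2))_(1) S(b_(1)) under the trace and then
  into b_(1) S(b_(2)), which is a counit.\<close>

lemma integral_invariant: "sw x (\<lambda>x1 x2. integral f x2 *\<^sub>C x1) = integral f x *\<^sub>C \<one>"
proof -
  have "sw x (\<lambda>x1 x2. integral f x2 *\<^sub>C x1) =
    (\<Sum>b\<in>B. sw x (\<lambda>x1 x2. \<langle>c b, twisted_mult f x2 b\<rangle> *\<^sub>C x1))"
    unfolding integral_def by (simp add: complex_vector.scale_sum_left tsum_sum)
  also have "\<dots> = (\<Sum>b\<in>B. sw b (\<lambda>b1 b2. sw (twisted_mult f x b2) (\<lambda>n1 n2. \<langle>c b, n2\<rangle> *\<^sub>C (n1 \<cdot> S b1))))"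
    by (subst twisted_mult_comult) (auto intro!: lin)
  also have "\<dots> = (\<Sum>b\<in>B. sw b (\<lambda>b1 b2. sw b2 (\<lambda>b2 b3. \<langle>c b, twisted_mult f x b3\<rangle> *\<^sub>C (b1 \<cdot> S b2))))"
    by (rule trace_cyclic; intro lin)
  also have "\<dots> = (\<Sum>b\<in>B. sw b (\<lambda>r b3. sw r (\<lambda>b1 b2. \<langle>c b, twisted_mult f x b3\<rangle> *\<^sub>C (b1 \<cdot> S b2))))"
    by (simp add: sw_assoc lin)
  also have "\<dots> = (\<Sum>b\<in>B. sw b (\<lambda>r b3. \<epsilon> r *\<^sub>C \<langle>c b, twisted_mult f x b3\<rangle> *\<^sub>C \<one>))"
    by (simp add: tsum_scale antipode_right mult.commute)
  also have "\<dots> = integral f x *\<^sub>C \<one>"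
    by (subst sw_counit_left) (auto intro!: lin simp: integral_def complex_vector.scale_sum_left)
  finally show ?thesis .
qed

text \<open>If every integral vanished, every vector y would be zero: insert S(b_(2)) S^2(b_(1)) =
  S(S(b_(1)) b_(2)) into the expansion of y in the basis and recognise traces that vanish. This
  contradicts \<epsilon>(1) = 1.\<close>

lemma ex_integral_nonzero: "\<exists>f x. integral f x \<noteq> 0"
proof (rule ccontr)
  assume "\<not> ?thesis"
  then have 0: "integral f x = 0" for f x by blast
  \<comment> \<open>The vector representing f |-> \<open>integral f x\<close>, so that vanishing of
    all integrals means \<open>Z x = 0\<close>.\<close>
  define Z where "Z x = (\<Sum>b\<in>B. sw b (\<lambda>b1 b2. \<langle>c b, x \<cdot> S (S b1)\<rangle> *\<^sub>C b2))" for x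
  have "\<langle>f, Z x\<rangle> = integral f x" for f x
    unfolding Z_def integral_def twisted_mult_def
    by (simp add: eval_sum eval_tsum eval_scaleC mult.commute)
  then have Z: "Z x = 0" for x
    using vanishing_functionals[OF dual_basis] 0 by simp
  have "y = 0" for y :: 'k
  proof -
    \<comment> \<open>Writing S(b_(2)) as the sum of \<open>c d\<close> (S b_(2)) times d separates
      the vector d, which joins y, from the coefficient, which is absorbed in \<open>P d\<close>.
      What remains of the sum over b is \<open>P d\<close> applied to Z(y d).\<close>
    define P where "P d r = sw r (\<lambda>b2 b3. \<langle>c d, S b2\<rangle> *\<^sub>C b3)" for d r
    have P: "clinear (P d)" for d unfolding P_def by (intro lin)
    have "y = (\<Sum>b\<in>B. \<langle>c b, y\<rangle> *\<^sub>C b)"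
      by (rule dual_basis_expand[OF dual_basis, symmetric])
    also have "\<dots> = (\<Sum>b\<in>B. sw b (\<lambda>r b3. \<epsilon> r *\<^sub>C \<langle>c b, y\<rangle> *\<^sub>C b3))"
      by (subst sw_counit_left) (auto intro!: lin)
    also have "\<dots> = (\<Sum>b\<in>B. sw b (\<lambda>r b3. sw r (\<lambda>b1 b2. \<langle>c b, y \<cdot> (S b2 \<cdot> S (S b1))\<rangle> *\<^sub>C b3)))"
    proof -
      have e: "sw r (\<lambda>b1 b2. \<langle>c b, y \<cdot> (S b2 \<cdot> S (S b1))\<rangle> *\<^sub>C b3) = \<epsilon> r *\<^sub>C \<langle>c b, y\<rangle> *\<^sub>C b3" for b r b3
        by (subst sw_antipode_left[where G="\<lambda>z. \<langle>c b, y \<cdot> S z\<rangle> *\<^sub>C b3"])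
          (simp_all add: lin mult_one S_times)
      show ?thesis unfolding e ..
    qed
    also have "\<dots> = (\<Sum>b\<in>B. sw b (\<lambda>b1 r. sw r (\<lambda>b2 b3. \<langle>c b, y \<cdot> (S b2 \<cdot> S (S b1))\<rangle> *\<^sub>C b3)))"
      by (simp add: sw_assoc lin)
    also have "\<dots> = (\<Sum>b\<in>B. sw b (\<lambda>b1 r. sw r (\<lambda>b2 b3. \<Sum>d\<in>B.
       \<langle>c d, S b2\<rangle> *\<^sub>C \<langle>c b, y \<cdot> (d \<cdot> S (S b1))\<rangle> *\<^sub>C b3)))"
      by (subst expand) (auto intro!: lin)
    also have "\<dots> = (\<Sum>d\<in>B. \<Sum>b\<in>B. sw b (\<lambda>b1 r. \<langle>c b, (y \<cdot> d) \<cdot> S (S b1)\<rangle> *\<^sub>C P d r))"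
      unfolding P_def by (subst sum.swap) (simp add: tsum_sum scaleC_tsum mult.commute mult_assoc)
    also have "\<dots> = (\<Sum>d\<in>B. P d (Z (y \<cdot> d)))"
      unfolding Z_def by (simp add: clinear_sum[OF P] clinear_tsum[OF P] clinear_scale[OF P])
    also have "\<dots> = 0" by (simp add: Z clinear_zero[OF P])
    finally show ?thesis .
  qed
  then have "\<one> = 0" .
  then show False using counit_one clinear_zero[OF clinear_counit] by simp
qed

text \<open>Injectivity is proved by showing that a nonzero integral annihilates the kernel of S;
  surjectivity is then a matter of dimension.\<close>

lemma bij_S: "bij S"
proof -
  obtain f x0 where nz: "integral f x0 \<noteq> 0" using ex_integral_nonzero by blast
  have "h = 0" if h: "S h = 0" for h
  proof -
    have e: "sw r (\<lambda>q h2. integral f y *\<^sub>C (x1 \<cdot> S q \<cdot> h2)) = \<epsilon> r *\<^sub>C integral f y *\<^sub>C x1" for r y x1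
      by (subst sw_antipode_left[where G="\<lambda>z. integral f y *\<^sub>C (x1 \<cdot> z)"])
        (simp_all add: lin mult_one mult_assoc)
    \<comment> \<open>Use invariance at w = x S(h_(1)). As S reverses coproducts, w_(1) ends in
      S(h_(2)), which cancels against h_(3). This leaves x_(1) weighted by the integral at x_(2)
      S(h), which is zero.\<close>
    have Z: "sw h (\<lambda>h1 h2. integral f (x \<cdot> S h1) *\<^sub>C h2) = 0" for x
    proof -
      have "sw h (\<lambda>h1 h2. integral f (x \<cdot> S h1) *\<^sub>C h2) =
         sw h (\<lambda>h1 h2. sw (x \<cdot> S h1) (\<lambda>w1 w2. integral f w2 *\<^sub>C w1) \<cdot> h2)"
        by (simp add: integral_invariant scaleC_times one_mult)
      also have "\<dots> = sw h (\<lambda>h1 h2. sw x (\<lambda>x1 x2. sw h1 (\<lambda>p q. integral f (x2 \<cdot> S p) *\<^sub>C (x1 \<cdot> S q \<cdot> h2))))"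
        by (simp add: sw_times sw_S lin tsum_times scaleC_times)
      also have "\<dots> = sw x (\<lambda>x1 x2. sw h (\<lambda>p r. sw r (\<lambda>q h2. integral f (x2 \<cdot> S p) *\<^sub>C (x1 \<cdot> S q \<cdot> h2))))"
        by (subst tsum_swap) (simp add: sw_assoc lin)
      also have "\<dots> = sw x (\<lambda>x1 x2. integral f (x2 \<cdot> S h) *\<^sub>C x1)"
        by (simp only: e) (subst sw_counit_right, auto intro!: lin)
      also have "\<dots> = 0"
        by (simp add: h clinear_zero[of "integral f"] clinear_zero[of "(\<cdot>) _"] lin)
      finally show ?thesis .
    qed
    \<comment> \<open>The factor S^2(h_(2)) S(h_(1)) = S(h_(1) S(h_(2))) is inserted next to
      \<open>x0\<close>. Expanding S^2(h_(2)) in the basis leaves, for each d, the map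
      \<open>P d\<close> applied to the sum in \<open>Z\<close> taken at x0 d.\<close>
    define P where "P d r = sw r (\<lambda>h2 h3. \<langle>c d, S (S h2)\<rangle> *\<^sub>C h3)" for d r
    have P: "clinear (P d)" for d unfolding P_def by (intro lin)
    have "integral f x0 *\<^sub>C h = sw h (\<lambda>r h3. \<epsilon> r *\<^sub>C integral f x0 *\<^sub>C h3)"
      by (subst sw_counit_left) (auto intro!: lin)
    also have "\<dots> = sw h (\<lambda>r h3. sw r (\<lambda>h1 h2. integral f (x0 \<cdot> (S (S h2) \<cdot> S h1)) *\<^sub>C h3))"
    proof -
      have e: "sw r (\<lambda>h1 h2. integral f (x0 \<cdot> (S (S h2) \<cdot> S h1)) *\<^sub>C h3) = \<epsilon> r *\<^sub>C integral f x0 *\<^sub>C h3" for r h3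
        by (subst sw_antipode_right[where G="\<lambda>z. integral f (x0 \<cdot> S z) *\<^sub>C h3"])
          (simp_all add: lin mult_one S_times)
      show ?thesis unfolding e ..
    qed
    also have "\<dots> = sw h (\<lambda>h1 r. sw r (\<lambda>h2 h3. integral f (x0 \<cdot> (S (S h2) \<cdot> S h1)) *\<^sub>C h3))"
      by (simp add: sw_assoc lin)
    also have "\<dots> = sw h (\<lambda>h1 r. sw r (\<lambda>h2 h3. \<Sum>d\<in>B. \<langle>c d, S (S h2)\<rangle> *\<^sub>C integral f (x0 \<cdot> (d \<cdot> S h1)) *\<^sub>C h3))"
      by (subst expand) (auto intro!: lin)
    also have "\<dots> = (\<Sum>d\<in>B. P d (sw h (\<lambda>h1 r. integral f ((x0 \<cdot> d) \<cdot> S h1) *\<^sub>C r)))"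
      unfolding clinear_tsum[OF P] clinear_scale[OF P] unfolding P_def
      by (simp add: tsum_sum scaleC_tsum mult.commute mult_assoc)
    also have "\<dots> = 0" by (simp add: Z clinear_zero[OF P])
    finally show ?thesis using nz by simp
  qed
  then have inj: "inj S"
    using module_hom.inj_iff_eq_0[OF Vector_Spaces.linear.axioms(3)[OF clinear_S]] by blast
  have "surj S"
    using finite_dimensional_vector_space.linear_inj_imp_surj[OF finite_dim clinear_S inj] .
  with inj show ?thesis by (simp add: bij_def)
qed

section \<open>Identities for the inverse antipode\<close>

definition S' :: "'k \<Rightarrow> 'k" where "S' = inv S"

lemma S_S' [simp]: "S (S' x) = x" and S'_S [simp]: "S' (S x) = x"
  using bij_S unfolding S'_def by (simp_all add: bij_is_surj surj_f_inv_f bij_is_inj)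

lemma clinear_S': "clinear S'"
proof (rule clinearI)
  show "S' (x + y) = S' x + S' y" for x y
    using S'_S[of "S' x + S' y"] by (simp add: clinear_add[OF clinear_S] del: S'_S)
  show "S' (a *\<^sub>C x) = a *\<^sub>C S' x" for a x
    using S'_S[of "a *\<^sub>C S' x"] by (simp add: clinear_scale[OF clinear_S] del: S'_S)
qed

lemmas clinear_S'_fun [lin] = clinear_compose[OF clinear_S']

lemma S'_times: "S' (x \<cdot> y) = S' y \<cdot> S' x"
  using S'_S[of "S' y \<cdot> S' x"] by (simp add: S_times del: S'_S)

lemma S'_one [simp]: "S' \<one> = \<one>"
  using S'_S[of \<one>] by (simp del: S'_S)

lemma counit_S' [simp]: "\<epsilon> (S' x) = \<epsilon> x"
  using counit_S[of "S' x"] by (simp del: counit_S)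

lemma sw_S':
  assumes [lin]: "\<And>a. clinear (F a)" "\<And>b. clinear (\<lambda>a. F a b)"
  shows "sw (S' x) F = sw x (\<lambda>a b. F (S' b) (S' a))"
proof -
  note [lin] = assms[THEN clinear_compose]
  have "sw (S (S' x)) (\<lambda>a b. F (S' b) (S' a)) = sw (S' x) F"
    by (subst sw_S) (auto intro!: lin)
  then show ?thesis by simp
qed

text \<open>Apply \<open>S'\<close> to S(a) b: the result is S'(b) a. Thus \<open>S'\<close> acts as
  antipode for the opposite coproduct, with the legs cancelled in reversed order.\<close>

lemma sw_S'_left:
  assumes "\<And>a b. F a b = G (S' b \<cdot> a)" "clinear G"
  shows "sw x F = \<epsilon> x *\<^sub>C G \<one>"
proof -
  note [lin] = assms(2)[THEN clinear_compose]
  have "sw x (\<lambda>a b. G (S' (S a \<cdot> b))) = \<epsilon> x *\<^sub>C G \<one>"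
    by (subst sw_antipode_left[where G="\<lambda>z. G (S' z)"]) (auto intro!: lin)
  then show ?thesis by (simp add: S'_times flip: assms(1))
qed

lemma sw_S'_right:
  assumes "\<And>a b. F a b = G (b \<cdot> S' a)" "clinear G"
  shows "sw x F = \<epsilon> x *\<^sub>C G \<one>"
proof -
  note [lin] = assms(2)[THEN clinear_compose]
  have "sw x (\<lambda>a b. G (S' (a \<cdot> S b))) = \<epsilon> x *\<^sub>C G \<one>"
    by (subst sw_antipode_right[where G="\<lambda>z. G (S' z)"]) (auto intro!: lin)
  then show ?thesis by (simp add: S'_times flip: assms(1))
qed

end

section \<open>The double as a space of linear endomorphisms\<close>

text \<open>A family of linear maps from which a vector can be rebuilt by a finite sum of linear
  maps. This explicit form of joint injectivity passes to tensor products at once, by tensoring the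
  reconstruction maps.\<close>

definition separating :: "('i \<Rightarrow> 'v::complex_vector \<Rightarrow> 'w::complex_vector) \<Rightarrow> bool" where
  "separating P \<longleftrightarrow> (\<forall>i. clinear (P i)) \<and>
    (\<exists>I R. (\<forall>i. clinear (R i)) \<and> (\<forall>v. (\<Sum>i\<in>I. R i (P i v)) = v))"

lemma separating_eqI:
  assumes "separating P" "\<And>i. P i v = P i w"
  shows "v = w"
proof -
  obtain I R where "\<And>v. (\<Sum>i\<in>I. R i (P i v)) = v"
    using assms(1) unfolding separating_def by blast
  moreover have "(\<Sum>i\<in>I. R i (P i v)) = (\<Sum>i\<in>I. R i (P i w))" by (simp only: assms(2))
  ultimately show ?thesis by simp
qed

lemma tensor_sum: "v \<otimes> (\<Sum>i\<in>I. f i) = (\<Sum>i\<in>I. v \<otimes> f i)"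
  and sum_tensor: "(\<Sum>i\<in>I. f i) \<otimes> w = (\<Sum>i\<in>I. f i \<otimes> w)"
  by (rule clinear_sum, intro lin)+

lemma separating_tensor:
  assumes "separating P" "separating Q"
  shows "separating (\<lambda>(i, j). tensor_map (P i) (Q j))"
proof -
  obtain I R where R: "\<And>i. clinear (P i)" "\<And>i. clinear (R i)" "\<And>v. (\<Sum>i\<in>I. R i (P i v)) = v"
    using assms(1) unfolding separating_def by blast
  obtain J S where S: "\<And>j. clinear (Q j)" "\<And>j. clinear (S j)" "\<And>v. (\<Sum>j\<in>J. S j (Q j v)) = v"
    using assms(2) unfolding separating_def by blast
  have "(\<Sum>p\<in>I \<times> J. (case p of (i, j) \<Rightarrow> tensor_map (R i) (S j))
      ((case p of (i, j) \<Rightarrow> tensor_map (P i) (Q j)) t)) = t" for t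
  proof (induction t rule: tensor_induct)
    case (pure a b)
    have "(\<Sum>p\<in>I \<times> J. (case p of (i, j) \<Rightarrow> tensor_map (R i) (S j))
      ((case p of (i, j) \<Rightarrow> tensor_map (P i) (Q j)) (a \<otimes> b))) =
      (\<Sum>i\<in>I. \<Sum>j\<in>J. R i (P i a) \<otimes> S j (Q j b))"
      by (simp add: sum.cartesian_product tensor_map_pure R S case_prod_unfold)
    also have "\<dots> = a \<otimes> b"
      by (simp add: R S flip: tensor_sum sum_tensor)
    finally show ?case .
  next
    case (add s t)
    have c: "clinear (\<lambda>x. tensor_map (R i) (S j) (tensor_map (P i) (Q j) x))" for i j
      by (intro lin R S)
    have "(\<Sum>p\<in>I \<times> J. (case p of (i, j) \<Rightarrow> tensor_map (R i) (S j))
      ((case p of (i, j) \<Rightarrow> tensor_map (P i) (Q j)) (s + t))) =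
     (\<Sum>p\<in>I \<times> J. (case p of (i, j) \<Rightarrow> tensor_map (R i) (S j))
      ((case p of (i, j) \<Rightarrow> tensor_map (P i) (Q j)) s)) +
     (\<Sum>p\<in>I \<times> J. (case p of (i, j) \<Rightarrow> tensor_map (R i) (S j))
      ((case p of (i, j) \<Rightarrow> tensor_map (P i) (Q j)) t))"
      unfolding sum.distrib[symmetric] using clinear_add[OF c]
      by (intro sum.cong refl) (auto split: prod.splits)
    then show ?case by (simp add: add)
  qed
  moreover have "clinear (case p of (i, j) \<Rightarrow> tensor_map (P i) (Q j))"
    "clinear (case p of (i, j) \<Rightarrow> tensor_map (R i) (S j))" for p
    using clinear_tensor_map[OF R(1) S(1) clinear_ident] clinear_tensor_map[OF R(2) S(2) clinear_ident]
    by (auto split: prod.splits)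
  ultimately show ?thesis unfolding separating_def by blast
qed

lemma sweedler3_eq:
  assumes "clinear (comult K)"
    and [lin]: "\<And>a b. clinear (\<lambda>c. F a b c)" "\<And>a c. clinear (\<lambda>b. F a b c)" "\<And>b c. clinear (\<lambda>a. F a b c)"
  shows "sweedler3 K x F = tsum (comult K x) (\<lambda>a r. tsum (comult K r) (F a))"
proof -
  note [lin] = assms(1)[THEN clinear_compose]
  have "tensor_lift (\<lambda>a. tensor_lift (F a)) t = tsum t (\<lambda>a t. tsum t (F a))" for t
  proof -
    have *: "tensor_lift (F a) = (\<lambda>t. tsum t (F a))" for a
      by (rule ext, rule tsum_eq_lift) (intro lin)
    show ?thesis unfolding * by (intro tsum_eq_lift lin)
  qed
  then show ?thesis unfolding sweedler3_def
    by (simp add: tensor_map_tsum assms(1) lin tsum_tsum tsum_pure id_def)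
qed

locale fd_hopf = fd_hopf_algebra K B c
  for K :: "('k::complex_vector) bialg" and B c
begin

section \<open>Product and coproduct of the dual\<close>

abbreviation dual_times (infixl \<open>\<star>\<close> 70) where "\<phi> \<star> \<psi> \<equiv> mult (dual_hopf K) \<phi> \<psi>"
abbreviation dual_sw :: "'k dual \<Rightarrow> ('k dual \<Rightarrow> 'k dual \<Rightarrow> 'v::complex_vector) \<Rightarrow> 'v" where
  "dual_sw \<phi> F \<equiv> tsum (comult (dual_hopf K) \<phi>) F"

lemma eval_dual_times: "\<langle>\<phi> \<star> \<psi>, x\<rangle> = sw x (\<lambda>a b. \<langle>\<phi>, a\<rangle> * \<langle>\<psi>, b\<rangle>)"
proof -
  have "(\<lambda>h. sweedler2 K h (\<lambda>a b. \<langle>\<phi>, a\<rangle> * \<langle>\<psi>, b\<rangle>)) = (\<lambda>h. sw h (\<lambda>a b. \<langle>\<phi>, a\<rangle> * \<langle>\<psi>, b\<rangle>))"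
    by (rule ext, rule sweedler2_eq) (intro lin)
  moreover have "clinear (\<lambda>h. sw h (\<lambda>a b. \<langle>\<phi>, a\<rangle> * \<langle>\<psi>, b\<rangle>))" by (intro lin)
  ultimately show ?thesis by (simp add: dual_hopf_def eval_Abs_dual)
qed

lemma cbilinear_dual_times: "cbilinear (mult (dual_hopf K))"
  by (intro cbilinearI clinearI dual_eqI)
    (simp_all add: eval_dual_times algebra_simps tsum_add mult_tsum)

lemmas [lin] = cbilinear_right[OF cbilinear_dual_times] cbilinear_left[OF cbilinear_dual_times]

text \<open>Pairing with H in both legs identifies the tensor square of the dual with bilinear forms
  on H. Any solution, expanded in the dual basis, has the coefficients \<phi>(b d), which settles
  both existence and uniqueness and makes the defining description of the coproduct
  meaningful.\<close>

lemma ex1_dual_comult: "\<exists>!t. \<forall>h h'. \<langle>\<phi>, h \<cdot> h'\<rangle> = tensor_lift (\<lambda>\<phi>1 \<phi>2. \<langle>\<phi>1, h\<rangle> * \<langle>\<phi>2, h'\<rangle>) t"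
proof (rule ex_ex1I)
  have e: "tensor_lift (\<lambda>\<phi>1 \<phi>2. \<langle>\<phi>1, h\<rangle> * \<langle>\<phi>2, h'\<rangle>) t = tsum t (\<lambda>\<phi>1 \<phi>2. \<langle>\<phi>1, h\<rangle> * \<langle>\<phi>2, h'\<rangle>)"
    for h h' and t :: "'k dual \<otimes> 'k dual"
    by (intro tsum_eq_lift lin)
  define t where "t = (\<Sum>b\<in>B. \<Sum>d\<in>B. \<langle>\<phi>, b \<cdot> d\<rangle> *\<^sub>C (c b \<otimes> c d))"
  have "\<langle>\<phi>, h \<cdot> h'\<rangle> = tsum t (\<lambda>\<phi>1 \<phi>2. \<langle>\<phi>1, h\<rangle> * \<langle>\<phi>2, h'\<rangle>)" for h h'
  proof -
    have "tsum t (\<lambda>\<phi>1 \<phi>2. \<langle>\<phi>1, h\<rangle> * \<langle>\<phi>2, h'\<rangle>) = (\<Sum>b\<in>B. \<Sum>d\<in>B. \<langle>\<phi>, b \<cdot> d\<rangle> *\<^sub>C (\<langle>c b, h\<rangle> * \<langle>c d, h'\<rangle>))"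
      unfolding t_def
      by (simp add: clinear_sum[of "\<lambda>t. tsum t _"] clinear_scale[of "\<lambda>t. tsum t _"] lin tsum_pure)
    also have "\<dots> = (\<Sum>b\<in>B. \<langle>c b, h\<rangle> *\<^sub>C (\<Sum>d\<in>B. \<langle>c d, h'\<rangle> *\<^sub>C \<langle>\<phi>, b \<cdot> d\<rangle>))"
      by (simp add: sum_distrib_left mult_ac)
    also have "\<dots> = \<langle>\<phi>, h \<cdot> h'\<rangle>"
      by (subst expand, intro lin, subst expand, intro lin, rule refl)
    finally show ?thesis ..
  qed
  then show "\<exists>t. \<forall>h h'. \<langle>\<phi>, h \<cdot> h'\<rangle> = tensor_lift (\<lambda>\<phi>1 \<phi>2. \<langle>\<phi>1, h\<rangle> * \<langle>\<phi>2, h'\<rangle>) t"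
    unfolding e by blast
  fix s t assume s: "\<forall>h h'. \<langle>\<phi>, h \<cdot> h'\<rangle> = tensor_lift (\<lambda>\<phi>1 \<phi>2. \<langle>\<phi>1, h\<rangle> * \<langle>\<phi>2, h'\<rangle>) s"
    and t: "\<forall>h h'. \<langle>\<phi>, h \<cdot> h'\<rangle> = tensor_lift (\<lambda>\<phi>1 \<phi>2. \<langle>\<phi>1, h\<rangle> * \<langle>\<phi>2, h'\<rangle>) t"
  have "t = (\<Sum>b\<in>B. \<Sum>d\<in>B. \<langle>\<phi>, b \<cdot> d\<rangle> *\<^sub>C (c b \<otimes> c d))"
    if t: "\<forall>h h'. \<langle>\<phi>, h \<cdot> h'\<rangle> = tensor_lift (\<lambda>\<phi>1 \<phi>2. \<langle>\<phi>1, h\<rangle> * \<langle>\<phi>2, h'\<rangle>) t" for t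
  proof -
    have "t = tsum t (\<lambda>\<phi>1 \<phi>2. (\<Sum>b\<in>B. \<langle>\<phi>1, b\<rangle> *\<^sub>C c b) \<otimes> (\<Sum>d\<in>B. \<langle>\<phi>2, d\<rangle> *\<^sub>C c d))"
      by (simp add: dual_basis_expand_dual[OF dual_basis] tsum_pure_eq)
    also have "\<dots> = tsum t (\<lambda>\<phi>1 \<phi>2. \<Sum>b\<in>B. \<Sum>d\<in>B. (\<langle>\<phi>1, b\<rangle> * \<langle>\<phi>2, d\<rangle>) *\<^sub>C (c b \<otimes> c d))"
      by (simp add: tensor_sum sum_tensor tensor_scaleC scaleC_tensor complex_vector.scale_sum_right mult.commute,
          subst sum.swap, rule refl)
    also have "\<dots> = (\<Sum>b\<in>B. \<Sum>d\<in>B. \<langle>\<phi>, b \<cdot> d\<rangle> *\<^sub>C (c b \<otimes> c d))"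
      by (simp add: tsum_sum t e tsum_scaleC)
    finally show ?thesis .
  qed
  from this[OF s] this[OF t] show "s = t" by simp
qed

lemma dual_sw_eval: "dual_sw \<phi> (\<lambda>\<phi>1 \<phi>2. \<langle>\<phi>1, h\<rangle> * \<langle>\<phi>2, h'\<rangle>) = \<langle>\<phi>, h \<cdot> h'\<rangle>"
proof -
  have "\<langle>\<phi>, h \<cdot> h'\<rangle> = tensor_lift (\<lambda>\<phi>1 \<phi>2. \<langle>\<phi>1, h\<rangle> * \<langle>\<phi>2, h'\<rangle>) (comult (dual_hopf K) \<phi>)"
    using theI'[OF ex1_dual_comult, of \<phi>] unfolding dual_hopf_def bialg.simps by blast
  then show ?thesis by (simp add: tsum_eq_lift lin)
qed

lemma dual_comult_eqI:
  assumes "\<And>h h'. \<langle>\<phi>, h \<cdot> h'\<rangle> = tsum t (\<lambda>\<phi>1 \<phi>2. \<langle>\<phi>1, h\<rangle> * \<langle>\<phi>2, h'\<rangle>)"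
  shows "comult (dual_hopf K) \<phi> = t"
  using the1_equality[OF ex1_dual_comult, of \<phi> t] assms by (simp add: dual_hopf_def tsum_eq_lift lin)

lemma clinear_dual_comult: "clinear (comult (dual_hopf K))"
  by (intro clinearI dual_comult_eqI)
    (simp_all add: clinear_add[of "\<lambda>t. tsum t _"] clinear_scale[of "\<lambda>t. tsum t _"] lin dual_sw_eval)

lemmas [lin] = clinear_compose[OF clinear_dual_comult]

text \<open>An element \<open>\<phi> \<otimes> h\<close> of the double is identified with the linear map \<open>x \<mapsto> \<langle>\<phi>, x\<rangle> h\<close>;
  this removes the coproduct of the dual from the product and the coactions.\<close>

definition hat :: "'k \<Rightarrow> 'k dual \<otimes> 'k \<Rightarrow> 'k" where
  "hat x X = tsum X (\<lambda>\<phi> h. \<langle>\<phi>, x\<rangle> *\<^sub>C h)"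

lemma clinear_hat [lin]:
  "clinear g \<Longrightarrow> clinear (\<lambda>z. hat (g z) X)" "clinear f \<Longrightarrow> clinear (\<lambda>z. hat x (f z))"
  unfolding hat_def by (intro lin; assumption)+

lemma hat_pure [simp]: "hat x (\<phi> \<otimes> h) = \<langle>\<phi>, x\<rangle> *\<^sub>C h"
  unfolding hat_def by (subst tsum_pure) (auto intro!: lin)

lemma separating_hat: "separating hat"
  unfolding separating_def
proof (intro conjI exI[of _ B] exI[of _ "\<lambda>b h. c b \<otimes> h"] allI)
  fix X
  have "(\<Sum>b\<in>B. c b \<otimes> hat b X) = tsum X (\<lambda>\<phi> h. (\<Sum>b\<in>B. \<langle>\<phi>, b\<rangle> *\<^sub>C c b) \<otimes> h)"
    unfolding hat_def
    by (simp add: sum_tensor lin tensor_tsum tensor_scaleC scaleC_tensor tsum_sum)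
  then show "(\<Sum>b\<in>B. c b \<otimes> hat b X) = X"
    by (simp add: dual_basis_expand_dual[OF dual_basis] tsum_pure_eq)
qed (intro lin)+

lemma hat_eqI: "(\<And>x. hat x X = hat x Y) \<Longrightarrow> X = Y"
  by (rule separating_eqI[OF separating_hat])

abbreviation "hat2 y x \<equiv> tensor_map (hat y) (hat x)"
abbreviation "hat3 z y x \<equiv> tensor_map (hat z) (hat2 y x)"

lemma hat2_eqI: "(\<And>x y. hat2 y x s = hat2 y x t) \<Longrightarrow> s = t"
  using separating_eqI[OF separating_tensor[OF separating_hat separating_hat]] by auto

lemma hat3_eqI: "(\<And>x y z. hat3 z y x s = hat3 z y x t) \<Longrightarrow> s = t"
  using separating_eqI[OF separating_tensor[OF separating_hat
    separating_tensor[OF separating_hat separating_hat]]] by auto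

lemma clinear_hat': "clinear (hat x)" and clinear_hat2: "clinear (hat2 y x)"
  by (intro lin)+

lemma hat_tsum: "hat x (tsum t F) = tsum t (\<lambda>a b. hat x (F a b))"
  and hat_scaleC: "hat x (a *\<^sub>C X) = a *\<^sub>C hat x X"
  by (simp_all add: clinear_tsum clinear_scale clinear_hat')

lemma tsum_hat:
  assumes [lin]: "\<And>a. clinear (M a)" "\<And>b. clinear (\<lambda>a. M a b)"
  shows "tsum t (\<lambda>X Y. M (hat y X) (hat x Y)) = tsum (hat2 y x t) M"
  by (simp add: tensor_map_tsum clinear_hat' tsum_tsum tsum_pure lin)

section \<open>Products and coactions evaluated at points of H\<close>

definition double_mult :: "('k \<Rightarrow> 'k) \<Rightarrow> 'k dual \<otimes> 'k \<Rightarrow> 'k dual \<otimes> 'k \<Rightarrow> 'k dual \<otimes> 'k" where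
  "double_mult \<alpha> = mult (twisted_double_alg K \<alpha>)"

lemma S'_eq: "inv (antipode K) = S'"
  by (simp add: S'_def S_def)

lemma
  assumes "clinear \<alpha>"
  shows double_mult_eq: "double_mult \<alpha> X Y = tsum X (\<lambda>\<phi> h. tsum Y (\<lambda>\<psi> k.
     dual_sw \<psi> (\<lambda>\<psi>1 r. dual_sw r (\<lambda>\<psi>2 \<psi>3. sw h (\<lambda>h1 r. sw r (\<lambda>h2 h3.
       (\<langle>\<psi>1, S' h3\<rangle> * \<langle>\<psi>3, \<alpha> h1\<rangle>) *\<^sub>C ((\<phi> \<star> \<psi>2) \<otimes> (h2 \<cdot> k))))))))"
    and cbilinear_double_mult: "cbilinear (double_mult \<alpha>)"
proof -
  note [lin] = assms[THEN clinear_compose]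
  show e: "double_mult \<alpha> X Y = tsum X (\<lambda>\<phi> h. tsum Y (\<lambda>\<psi> k.
     dual_sw \<psi> (\<lambda>\<psi>1 r. dual_sw r (\<lambda>\<psi>2 \<psi>3. sw h (\<lambda>h1 r. sw r (\<lambda>h2 h3.
       (\<langle>\<psi>1, S' h3\<rangle> * \<langle>\<psi>3, \<alpha> h1\<rangle>) *\<^sub>C ((\<phi> \<star> \<psi>2) \<otimes> (h2 \<cdot> k))))))))" for X Y
    unfolding double_mult_def twisted_double_alg_def S'_eq alg.simps
    by (simp add: sweedler3_eq clinear_comult clinear_dual_comult tsum_eq_lift lin)
  show "cbilinear (double_mult \<alpha>)"
    by (rule cbilinearI; unfold e; intro lin)
qed

text \<open>With h = X(x_(1)), the three legs of a dual factor \<psi> of Y are paired with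
  S'(h_(3)), x_(2) and \<alpha>(h_(1)), so they recombine into the value of \<psi> at the product of
  these three elements.\<close>

lemma hat_double_mult:
  assumes "clinear \<alpha>"
  shows "hat x (double_mult \<alpha> X Y) = sw x (\<lambda>x1 x2. sw (hat x1 X) (\<lambda>h1 r. sw r (\<lambda>h2 h3.
     h2 \<cdot> hat (S' h3 \<cdot> (x2 \<cdot> \<alpha> h1)) Y)))"
proof -
  note [lin] = assms[THEN clinear_compose]
  have dual_sw3: "dual_sw \<psi> (\<lambda>\<psi>1 r. dual_sw r (\<lambda>\<psi>2 \<psi>3.
      (\<langle>\<psi>1, v1\<rangle> * \<langle>\<psi>3, v3\<rangle>) *\<^sub>C (u * \<langle>\<psi>2, v2\<rangle>) *\<^sub>C w)) = (u * \<langle>\<psi>, v1 \<cdot> (v2 \<cdot> v3)\<rangle>) *\<^sub>C w"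
    for \<psi> v1 v2 v3 u and w :: 'k
  proof -
    have e: "(\<langle>\<psi>1, v1\<rangle> * \<langle>\<psi>3, v3\<rangle>) *\<^sub>C (u * \<langle>\<psi>2, v2\<rangle>) *\<^sub>C w =
      (u * (\<langle>\<psi>1, v1\<rangle> * (\<langle>\<psi>2, v2\<rangle> * \<langle>\<psi>3, v3\<rangle>))) *\<^sub>C w" for \<psi>1 \<psi>2 \<psi>3 :: "'k dual"
      by (simp add: mult_ac)
    show ?thesis
      unfolding e by (simp only: tsum_scaleC[symmetric] mult_tsum[symmetric] dual_sw_eval)
  qed
  have dual_sw_swap: "dual_sw \<psi> (\<lambda>\<psi>1 \<psi>2. sw h (F \<psi>1 \<psi>2)) = sw h (\<lambda>a b. dual_sw \<psi> (\<lambda>\<psi>1 \<psi>2. F \<psi>1 \<psi>2 a b))"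
    for \<psi> h and F :: "'k dual \<Rightarrow> 'k dual \<Rightarrow> 'k \<Rightarrow> 'k \<Rightarrow> 'k"
    by (rule tsum_swap)
  have "hat x (double_mult \<alpha> X Y) = tsum X (\<lambda>\<phi> h. tsum Y (\<lambda>\<psi> k.
     sw h (\<lambda>h1 r. sw r (\<lambda>h2 h3. sw x (\<lambda>x1 x2. (\<langle>\<phi>, x1\<rangle> * \<langle>\<psi>, S' h3 \<cdot> (x2 \<cdot> \<alpha> h1)\<rangle>) *\<^sub>C (h2 \<cdot> k))))))"
    unfolding double_mult_eq[OF assms] hat_tsum hat_scaleC hat_pure eval_dual_times tsum_scaleC scaleC_tsum
      dual_sw_swap dual_sw3 ..
  also have "\<dots> = sw x (\<lambda>x1 x2. tsum X (\<lambda>\<phi> h. tsum Y (\<lambda>\<psi> k.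
     sw h (\<lambda>h1 r. sw r (\<lambda>h2 h3. (\<langle>\<phi>, x1\<rangle> * \<langle>\<psi>, S' h3 \<cdot> (x2 \<cdot> \<alpha> h1)\<rangle>) *\<^sub>C (h2 \<cdot> k))))))"
    by (simp only: tsum_swap[where t="comult K x"])
  also have "\<dots> = sw x (\<lambda>x1 x2. tsum X (\<lambda>\<phi> h. \<langle>\<phi>, x1\<rangle> *\<^sub>C sw h (\<lambda>h1 r. sw r (\<lambda>h2 h3.
     h2 \<cdot> hat (S' h3 \<cdot> (x2 \<cdot> \<alpha> h1)) Y))))"
    unfolding hat_def times_tsum scaleC_tsum times_scaleC complex_vector.scale_scale
    by (simp only: tsum_swap[where t=Y])
  also have "\<dots> = sw x (\<lambda>x1 x2. sw (hat x1 X) (\<lambda>h1 r. sw r (\<lambda>h2 h3.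
     h2 \<cdot> hat (S' h3 \<cdot> (x2 \<cdot> \<alpha> h1)) Y)))"
  proof -
    have s: "clinear (\<lambda>z. sw z (\<lambda>h1 r. sw r (\<lambda>h2 h3. h2 \<cdot> hat (S' h3 \<cdot> (x2 \<cdot> \<alpha> h1)) Y)))" for x2
      by (intro lin)
    have "tsum X (\<lambda>\<phi> h. \<langle>\<phi>, x1\<rangle> *\<^sub>C sw h (\<lambda>h1 r. sw r (\<lambda>h2 h3. h2 \<cdot> hat (S' h3 \<cdot> (x2 \<cdot> \<alpha> h1)) Y)))
       = sw (hat x1 X) (\<lambda>h1 r. sw r (\<lambda>h2 h3. h2 \<cdot> hat (S' h3 \<cdot> (x2 \<cdot> \<alpha> h1)) Y))" for x1 x2
      unfolding hat_def[of x1] clinear_tsum[OF s] clinear_scale[OF s] ..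
    then show ?thesis by (simp only:)
  qed
  finally show ?thesis .
qed

definition coact :: "('k \<Rightarrow> 'k) \<Rightarrow> 'k dual \<otimes> 'k \<Rightarrow> ('k dual \<otimes> 'k) \<otimes> ('k dual \<otimes> 'k)" where
  "coact \<gamma> X = tsum X (\<lambda>\<phi> h. dual_sw \<phi> (\<lambda>\<phi>1 \<phi>2. sw h (\<lambda>h1 h2. (\<phi>2 \<otimes> \<gamma> h1) \<otimes> (\<phi>1 \<otimes> h2))))"

lemma clinear_coact:
  assumes "clinear \<gamma>"
  shows "clinear (coact \<gamma>)"
proof -
  note [lin] = assms[THEN clinear_compose]
  show ?thesis unfolding coact_def by (intro lin)
qed

text \<open>The first leg carries \<phi>_(2) and is evaluated at y, the second carries \<phi>_(1)
  and is evaluated at x; together they give \<phi>(x y).\<close>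

lemma hat2_coact:
  assumes "clinear \<gamma>"
  shows "hat2 y x (coact \<gamma> X) = sw (hat (x \<cdot> y) X) (\<lambda>h1 h2. \<gamma> h1 \<otimes> h2)"
proof -
  note [lin] = assms[THEN clinear_compose]
  have dual_swap: "dual_sw \<phi> (\<lambda>\<phi>1 \<phi>2. sw h (\<lambda>h1 h2. (\<phi>2 \<otimes> \<gamma> h1) \<otimes> (\<phi>1 \<otimes> h2))) =
    sw h (\<lambda>h1 h2. dual_sw \<phi> (\<lambda>\<phi>1 \<phi>2. (\<phi>2 \<otimes> \<gamma> h1) \<otimes> (\<phi>1 \<otimes> h2)))" for \<phi> h
    by (rule tsum_swap)
  have "hat2 y x (coact \<gamma> X) = tsum X (\<lambda>\<phi> h. sw h (\<lambda>h1 h2. dual_sw \<phi> (\<lambda>\<phi>1 \<phi>2.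
     (\<langle>\<phi>1, x\<rangle> * \<langle>\<phi>2, y\<rangle>) *\<^sub>C (\<gamma> h1 \<otimes> h2))))"
    unfolding coact_def
    unfolding dual_swap
    by (simp add: tensor_map_tsum_arg tensor_map_pure clinear_hat' tensor_scaleC scaleC_tensor mult.commute)
  also have "\<dots> = tsum X (\<lambda>\<phi> h. \<langle>\<phi>, x \<cdot> y\<rangle> *\<^sub>C sw h (\<lambda>h1 h2. \<gamma> h1 \<otimes> h2))"
    by (simp only: tsum_scaleC[symmetric] dual_sw_eval tsum_scale)
  also have "\<dots> = sw (hat (x \<cdot> y) X) (\<lambda>h1 h2. \<gamma> h1 \<otimes> h2)"
  proof -
    have s: "clinear (\<lambda>z. sw z (\<lambda>h1 h2. \<gamma> h1 \<otimes> h2))" by (intro lin)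
    show ?thesis unfolding hat_def clinear_tsum[OF s] clinear_scale[OF s] ..
  qed
  finally show ?thesis .
qed

subsection \<open>Products and coactions twisted by automorphisms\<close>

text \<open>Compatibility with \<open>S'\<close> is included because \<gamma>(k) S'(\<gamma>(h))
  must become \<gamma>(k S'(h)) before the middle legs of a product of coactions can cancel.\<close>

definition hopf_auto :: "('k \<Rightarrow> 'k) \<Rightarrow> bool" where
  "hopf_auto \<gamma> \<longleftrightarrow> clinear \<gamma> \<and> (\<forall>x y. \<gamma> (x \<cdot> y) = \<gamma> x \<cdot> \<gamma> y) \<and> \<gamma> \<one> = \<one> \<and>
    (\<forall>x. comult K (\<gamma> x) = sw x (\<lambda>a b. \<gamma> a \<otimes> \<gamma> b)) \<and> (\<forall>x. \<epsilon> (\<gamma> x) = \<epsilon> x) \<and>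
    (\<forall>x. S' (\<gamma> x) = \<gamma> (S' x))"

lemma hopf_auto_id: "hopf_auto id"
  unfolding hopf_auto_def by (simp add: tsum_pure_eq id_def clinear_ident)

text \<open>S reverses both products and coproducts, and applying it twice undoes the two
  reversals.\<close>

lemma hopf_auto_S2: "hopf_auto (S \<circ> S)"
proof -
  have "comult K (S (S x)) = sw x (\<lambda>a b. S (S a) \<otimes> S (S b))" for x
  proof -
    have "comult K (S (S x)) = sw (S (S x)) (\<otimes>)" by (simp add: tsum_pure_eq)
    also have "\<dots> = sw x (\<lambda>a b. S (S a) \<otimes> S (S b))"
      by (simp add: sw_S lin)
    finally show ?thesis .
  qed
  then show ?thesis unfolding hopf_auto_def by (simp add: S_times lin o_def)
qed

lemma
  assumes "hopf_auto \<gamma>"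
  shows auto_clinear: "clinear \<gamma>" and auto_times: "\<gamma> (x \<cdot> y) = \<gamma> x \<cdot> \<gamma> y"
    and auto_one: "\<gamma> \<one> = \<one>" and auto_counit: "\<epsilon> (\<gamma> x) = \<epsilon> x"
    and auto_S': "S' (\<gamma> x) = \<gamma> (S' x)"
  using assms by (auto simp: hopf_auto_def)

lemma sw_auto:
  assumes "hopf_auto \<gamma>" and [lin]: "\<And>a. clinear (F a)" "\<And>b. clinear (\<lambda>a. F a b)"
  shows "sw (\<gamma> x) F = sw x (\<lambda>a b. F (\<gamma> a) (\<gamma> b))"
proof -
  have "comult K (\<gamma> x) = sw x (\<lambda>a b. \<gamma> a \<otimes> \<gamma> b)" using assms(1) by (auto simp: hopf_auto_def)
  then show ?thesis by (simp add: tsum_tsum tsum_pure lin)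
qed

lemma sw_tsum:
  assumes "\<And>a. clinear (F a)" "\<And>b. clinear (\<lambda>a. F a b)"
  shows "sw (tsum t G) F = tsum t (\<lambda>a b. sw (G a b) F)"
  by (rule clinear_tsum[of "\<lambda>z. sw z F"]) (intro lin assms)

lemma sw_times3:
  assumes "\<And>a b. clinear (\<lambda>c. M a b c)" "\<And>a c. clinear (\<lambda>b. M a b c)" "\<And>b c. clinear (\<lambda>a. M a b c)"
  shows "sw (h \<cdot> k) (\<lambda>g1 r. sw r (\<lambda>g2 g3. M g1 g2 g3)) =
    sw h (\<lambda>a a'. sw a' (\<lambda>a2 a3. sw k (\<lambda>b b'. sw b' (\<lambda>b2 b3. M (a \<cdot> b) (a2 \<cdot> b2) (a3 \<cdot> b3)))))"
proof -
  note [lin] = assms[THEN clinear_compose]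
  have "sw (h \<cdot> k) (\<lambda>g1 r. sw r (\<lambda>g2 g3. M g1 g2 g3)) =
    sw h (\<lambda>a a'. sw k (\<lambda>b b'. sw a' (\<lambda>a2 a3. sw b' (\<lambda>b2 b3. M (a \<cdot> b) (a2 \<cdot> b2) (a3 \<cdot> b3)))))"
    using assms by (simp add: sw_times lin)
  also have "\<dots> = sw h (\<lambda>a a'. sw a' (\<lambda>a2 a3. sw k (\<lambda>b b'. sw b' (\<lambda>b2 b3. M (a \<cdot> b) (a2 \<cdot> b2) (a3 \<cdot> b3)))))"
    by (subst (2) tsum_swap, rule refl)
  finally show ?thesis .
qed

text \<open>Computes the coproduct of the argument at which \<open>hat_double_mult\<close> evaluates
  its second factor, as associativity requires. The legs e, e' of v appear exchanged because
  \<open>S'\<close> reverses coproducts.\<close>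

lemma sw_conjugate:
  assumes "hopf_auto \<alpha>" and [lin]: "\<And>a. clinear (N a)" "\<And>b. clinear (\<lambda>a. N a b)"
  shows "sw (S' v \<cdot> (u \<cdot> \<alpha> h)) N = sw u (\<lambda>q q'. sw h (\<lambda>f f'. sw v (\<lambda>e e'.
    N (S' e' \<cdot> (q \<cdot> \<alpha> f)) (S' e \<cdot> (q' \<cdot> \<alpha> f')))))"
proof -
  note [lin] = assms(2,3)[THEN clinear_compose] auto_clinear[OF assms(1), THEN clinear_compose]
  have "sw (S' v \<cdot> (u \<cdot> \<alpha> h)) N = sw v (\<lambda>e e'. sw u (\<lambda>q q'. sw h (\<lambda>f f'.
    N (S' e' \<cdot> (q \<cdot> \<alpha> f)) (S' e \<cdot> (q' \<cdot> \<alpha> f')))))"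
    by (simp add: sw_times sw_S' sw_auto[OF assms(1)] lin)
  also have "\<dots> = sw u (\<lambda>q q'. sw h (\<lambda>f f'. sw v (\<lambda>e e'.
    N (S' e' \<cdot> (q \<cdot> \<alpha> f)) (S' e \<cdot> (q' \<cdot> \<alpha> f')))))"
    by (simp only: tsum_swap[where s="comult K v"])
  finally show ?thesis .
qed

lemma sw_assoc_outer:
  assumes "\<And>a b d. clinear (\<lambda>e. G a b d e)" "\<And>a b e. clinear (\<lambda>d. G a b d e)"
    "\<And>a d e. clinear (\<lambda>b. G a b d e)" "\<And>b d e. clinear (\<lambda>a. G a b d e)"
  shows "sw g (\<lambda>h1 r. sw r (\<lambda>h2 h3. sw h1 (\<lambda>f f'. G f f' h2 h3))) =
    sw g (\<lambda>f r. sw r (\<lambda>f' r. sw r (\<lambda>h2 h3. G f f' h2 h3)))"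
proof -
  note [lin] = assms[THEN clinear_compose]
  have "sw g (\<lambda>h1 r. sw r (\<lambda>h2 h3. sw h1 (\<lambda>f f'. G f f' h2 h3))) =
    sw g (\<lambda>h1 r. sw h1 (\<lambda>f f'. sw r (\<lambda>h2 h3. G f f' h2 h3)))"
    by (subst (2) tsum_swap, rule refl)
  then show ?thesis using assms by (simp add: sw_assoc lin)
qed

text \<open>Both bracketings are brought to one expression in the values of X, Y and Z. The left one
  needs the triple coproduct of a product, the right one the coproduct of a conjugated
  argument.\<close>

lemma double_mult_assoc:
  assumes \<alpha>: "hopf_auto \<alpha>"
  shows "double_mult \<alpha> (double_mult \<alpha> X Y) Z = double_mult \<alpha> X (double_mult \<alpha> Y Z)"
proof (rule hat_eqI)
  fix x
  note [lin] = auto_clinear[OF \<alpha>, THEN clinear_compose]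
  note hm = hat_double_mult[OF auto_clinear[OF \<alpha>]]
  \<comment> \<open>The common form: X is evaluated at p and Y at a conjugate of q. Five legs of
    X(p) are used: the outer two conjugate q, the next two help conjugate \<open>x2\<close> in the
    argument of Z, and the middle leg is multiplied into the result.\<close>
  define E where "E p q x2 = sw (hat p X) (\<lambda>h1 r. sw r (\<lambda>h1' r. sw r (\<lambda>h2 r. sw r (\<lambda>h3 h3'.
    sw (hat (S' h3' \<cdot> (q \<cdot> \<alpha> h1)) Y) (\<lambda>b r. sw r (\<lambda>b2 b3.
      h2 \<cdot> (b2 \<cdot> hat (S' b3 \<cdot> (S' h3 \<cdot> (x2 \<cdot> (\<alpha> h1' \<cdot> \<alpha> b)))) Z)))))))" for p q x2
  have [lin]: "clinear g \<Longrightarrow> clinear (\<lambda>p. E (g p) q x2)" "clinear g \<Longrightarrow> clinear (\<lambda>p. E x2 (g p) q)"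
    "clinear g \<Longrightarrow> clinear (\<lambda>p. E q x2 (g p))" for g q x2
    unfolding E_def by (intro lin; assumption)+
  have "hat x (double_mult \<alpha> (double_mult \<alpha> X Y) Z) = sw x (\<lambda>x1 x2. sw x1 (\<lambda>p q.
     sw (hat p X) (\<lambda>h1 r. sw r (\<lambda>h2 h3. sw h2 (\<lambda>a a'. sw a' (\<lambda>a2 a3.
     sw (hat (S' h3 \<cdot> (q \<cdot> \<alpha> h1)) Y) (\<lambda>b b'. sw b' (\<lambda>b2 b3.
       (a2 \<cdot> b2) \<cdot> hat (S' (a3 \<cdot> b3) \<cdot> (x2 \<cdot> \<alpha> (a \<cdot> b))) Z))))))))"
    by (simp add: hm sw_tsum sw_times3 lin)
  also have "\<dots> = sw x (\<lambda>p r. sw r (\<lambda>q x2. E p q x2))"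
    unfolding E_def by (simp add: sw_assoc lin auto_times[OF \<alpha>] S'_times mult_assoc)
  finally have L: "hat x (double_mult \<alpha> (double_mult \<alpha> X Y) Z) = sw x (\<lambda>p r. sw r (\<lambda>q x2. E p q x2))" .
  have "sw (hat p X) (\<lambda>h1 r. sw r (\<lambda>h2 h3. h2 \<cdot> hat (S' h3 \<cdot> (x' \<cdot> \<alpha> h1)) (double_mult \<alpha> Y Z))) =
    sw x' (\<lambda>q x2. E p q x2)" for p x'
  proof -
    have "sw (hat p X) (\<lambda>h1 r. sw r (\<lambda>h2 h3. h2 \<cdot> hat (S' h3 \<cdot> (x' \<cdot> \<alpha> h1)) (double_mult \<alpha> Y Z))) =
      sw (hat p X) (\<lambda>h1 r. sw r (\<lambda>h2 h3. sw x' (\<lambda>q x2. sw h1 (\<lambda>f f'. sw h3 (\<lambda>e e'.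
        sw (hat (S' e' \<cdot> (q \<cdot> \<alpha> f)) Y) (\<lambda>b r. sw r (\<lambda>b2 b3.
         h2 \<cdot> (b2 \<cdot> hat (S' b3 \<cdot> ((S' e \<cdot> (x2 \<cdot> \<alpha> f')) \<cdot> \<alpha> b)) Z))))))))"
      by (simp add: hm sw_conjugate[OF \<alpha>] lin times_tsum)
    also have "\<dots> = sw x' (\<lambda>q x2. sw (hat p X) (\<lambda>h1 r. sw r (\<lambda>h2 h3. sw h1 (\<lambda>f f'. sw h3 (\<lambda>e e'.
        sw (hat (S' e' \<cdot> (q \<cdot> \<alpha> f)) Y) (\<lambda>b r. sw r (\<lambda>b2 b3.
         h2 \<cdot> (b2 \<cdot> hat (S' b3 \<cdot> ((S' e \<cdot> (x2 \<cdot> \<alpha> f')) \<cdot> \<alpha> b)) Z))))))))"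
      by (simp only: tsum_swap[where t="comult K x'"])
    also have "\<dots> = sw x' (\<lambda>q x2. E p q x2)"
      unfolding E_def by (simp add: sw_assoc_outer lin mult_assoc)
    finally show ?thesis .
  qed
  then have "hat x (double_mult \<alpha> X (double_mult \<alpha> Y Z)) = sw x (\<lambda>p x'. sw x' (\<lambda>q x2. E p q x2))"
    by (simp add: hm[of x])
  with L show "hat x (double_mult \<alpha> (double_mult \<alpha> X Y) Z) = hat x (double_mult \<alpha> X (double_mult \<alpha> Y Z))"
    by simp
qed

definition double_one :: "'k dual \<otimes> 'k" where "double_one = Abs_dual \<epsilon> \<otimes> \<one>"

lemma hat_double_one: "hat x double_one = \<epsilon> x *\<^sub>C \<one>"
  by (simp add: double_one_def eval_Abs_dual clinear_counit)

lemma sw_scaleC_arg: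
  assumes "\<And>a. clinear (F a)" "\<And>b. clinear (\<lambda>a. F a b)"
  shows "sw (z *\<^sub>C x) F = z *\<^sub>C sw x F"
  by (rule clinear_scale[of "\<lambda>z. sw z F"]) (intro lin assms)

lemma double_one_mult:
  assumes \<alpha>: "hopf_auto \<alpha>"
  shows "double_mult \<alpha> double_one X = X" "double_mult \<alpha> X double_one = X"
proof -
  note [lin] = auto_clinear[OF \<alpha>, THEN clinear_compose]
  note hm = hat_double_mult[OF auto_clinear[OF \<alpha>]]
  show "double_mult \<alpha> double_one X = X"
  proof (rule hat_eqI)
    fix x
    show "hat x (double_mult \<alpha> double_one X) = hat x X"
      by (simp add: hm hat_double_one sw_scaleC_arg sw_one lin auto_one[OF \<alpha>] one_mult mult_one sw_counit_left)
  qed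
  show "double_mult \<alpha> X double_one = X"
  proof (rule hat_eqI)
    fix x
    have e: "h2 \<cdot> hat (S' h3 \<cdot> (x2 \<cdot> \<alpha> h1)) double_one = \<epsilon> h1 *\<^sub>C \<epsilon> h3 *\<^sub>C \<epsilon> x2 *\<^sub>C h2" for h1 h2 h3 x2
      by (simp add: hat_double_one auto_counit[OF \<alpha>] times_scaleC mult_one mult_ac)
    show "hat x (double_mult \<alpha> X double_one) = hat x X"
      unfolding hm e
      by (simp add: tsum_scale sw_counit_left sw_counit_right lin del: complex_vector.scale_scale)
  qed
qed

lemma unital_algebra_double:
  assumes "hopf_auto \<alpha>"
  shows "unital_algebra (twisted_double_alg K \<alpha>)"
  using cbilinear_double_mult[OF auto_clinear[OF assms]] double_mult_assoc[OF assms] double_one_mult[OF assms]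
  unfolding double_mult_def double_one_def
  by unfold_locales (simp_all add: twisted_double_alg_def)

lemma clinear_double_mult [lin]:
  assumes "hopf_auto \<alpha>" "clinear f"
  shows "clinear (\<lambda>x. double_mult \<alpha> (f x) Y)" "clinear (\<lambda>x. double_mult \<alpha> X (f x))"
  using cbilinear_left[OF cbilinear_double_mult[OF auto_clinear[OF assms(1)]] assms(2)]
    cbilinear_right[OF cbilinear_double_mult[OF auto_clinear[OF assms(1)]] assms(2)] .

section \<open>The coaction as an algebra map, and its coassociativity\<close>

text \<open>Eliminates a Sweedler sum over a coaction whenever the two legs enter only through their
  values: what remains is the coproduct of the single value X(x y).\<close>

lemma tsum_hat_coact:
  assumes \<gamma>: "clinear \<gamma>" and [lin]: "\<And>a. clinear (M a)" "\<And>b. clinear (\<lambda>a. M a b)"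
  shows "tsum (coact \<gamma> X) (\<lambda>X' X''. M (hat y X') (hat x X'')) = sw (hat (x \<cdot> y) X) (\<lambda>h h'. M (\<gamma> h) h')"
  unfolding tsum_hat[OF assms(2,3)] hat2_coact[OF \<gamma>]
  by (simp add: tsum_tsum tsum_pure lin)

lemma coact_one:
  assumes "hopf_auto \<gamma>"
  shows "coact \<gamma> double_one = double_one \<otimes> double_one"
proof (rule hat2_eqI)
  fix x y
  note [lin] = auto_clinear[OF assms, THEN clinear_compose]
  show "hat2 y x (coact \<gamma> double_one) = hat2 y x (double_one \<otimes> double_one)"
    by (simp add: hat2_coact auto_clinear[OF assms] hat_double_one tensor_map_pure clinear_hat' sw_scaleC_arg
      sw_one lin auto_one[OF assms] tensor_scaleC scaleC_tensor)
qed

text \<open>The six legs of g are h1, h2, h3, k1, k2, k3 in this order, so h3 and k1 are adjacent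
  and k1 S'(h3) is a counit by \<open>sw_S'_right\<close>.\<close>

lemma sw_collapse:
  assumes "\<And>a b d e. clinear (\<lambda>f. F a b d e f)" "\<And>a b d f. clinear (\<lambda>e. F a b d e f)"
   "\<And>a b e f. clinear (\<lambda>d. F a b d e f)" "\<And>a d e f. clinear (\<lambda>b. F a b d e f)"
   "\<And>b d e f. clinear (\<lambda>a. F a b d e f)"
  shows "sw g (\<lambda>h h'. sw h (\<lambda>h1 r. sw r (\<lambda>h2 h3. sw h' (\<lambda>k1 r'. sw r' (\<lambda>k2 k3.
      F h1 h2 (k1 \<cdot> S' h3) k2 k3))))) =
    sw g (\<lambda>h1 r. sw r (\<lambda>h2 r. sw r (\<lambda>k2 k3. F h1 h2 \<one> k2 k3)))"
proof -
  note [lin] = assms[THEN clinear_compose]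
  have e: "sw u (\<lambda>h3 r. sw r (\<lambda>k1 r'. sw r' (\<lambda>k2 k3. F h1 h2 (k1 \<cdot> S' h3) k2 k3))) =
     sw u (\<lambda>k2 k3. F h1 h2 \<one> k2 k3)" for u h1 h2
  proof -
    have "sw v (\<lambda>h3 k1. sw w (\<lambda>k2 k3. F h1 h2 (k1 \<cdot> S' h3) k2 k3)) = \<epsilon> v *\<^sub>C sw w (\<lambda>k2 k3. F h1 h2 \<one> k2 k3)" for v w
      by (subst sw_S'_right[where G="\<lambda>z. sw w (\<lambda>k2 k3. F h1 h2 z k2 k3)"]) (auto intro!: lin)
    then have "sw u (\<lambda>v w. sw v (\<lambda>h3 k1. sw w (\<lambda>k2 k3. F h1 h2 (k1 \<cdot> S' h3) k2 k3))) = sw u (\<lambda>k2 k3. F h1 h2 \<one> k2 k3)"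
      by (simp add: sw_counit_left lin)
    then show ?thesis using assms by (simp add: sw_assoc lin)
  qed
  show ?thesis by (simp add: sw_assoc lin e)
qed

lemma coact_mult:
  assumes \<alpha>: "hopf_auto \<alpha>" and \<beta>: "hopf_auto \<beta>" and \<gamma>: "hopf_auto \<gamma>" and eq: "\<And>x. \<alpha> x = \<beta> (\<gamma> x)"
  shows "coact \<gamma> (double_mult \<alpha> X Y) =
    mult (tensor_alg (twisted_double_alg K \<beta>) (twisted_double_alg K \<gamma>)) (coact \<gamma> X) (coact \<gamma> Y)"
proof (rule hat2_eqI)
  fix x y
  note lins = auto_clinear[OF \<alpha>] auto_clinear[OF \<beta>] auto_clinear[OF \<gamma>]
  note [lin] = lins[THEN clinear_compose]
  note hm = lins[THEN hat_double_mult]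
  \<comment> \<open>The common value of both sides at (y, x). The legs h1, h2, k2, k3 of X(x_(1)
    y_(1)) are the four that survive the cancellation on the product side.\<close>
  define E where "E = sw x (\<lambda>x1 x2. sw y (\<lambda>y1 y2. sw (hat (x1 \<cdot> y1) X) (\<lambda>h1 r. sw r (\<lambda>h2 r. sw r (\<lambda>k2 k3.
    sw (hat (S' k3 \<cdot> (x2 \<cdot> (y2 \<cdot> \<alpha> h1))) Y) (\<lambda>b b'. (\<gamma> h2 \<cdot> \<gamma> b) \<otimes> (k2 \<cdot> b')))))))"
  have L: "hat2 y x (coact \<gamma> (double_mult \<alpha> X Y)) = E"
    unfolding E_def
    by (simp add: hat2_coact lins hm sw_tsum sw_times lin auto_times[OF \<gamma>] sw_assoc mult_assoc)
  have "hat2 y x (mult (tensor_alg (twisted_double_alg K \<beta>) (twisted_double_alg K \<gamma>)) (coact \<gamma> X) (coact \<gamma> Y)) =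
    tsum (coact \<gamma> X) (\<lambda>X' X''. tsum (coact \<gamma> Y) (\<lambda>Y' Y''. hat y (double_mult \<beta> X' Y') \<otimes> hat x (double_mult \<gamma> X'' Y'')))"
    using cbilinear_double_mult[OF lins(2)] cbilinear_double_mult[OF lins(3)]
    unfolding double_mult_def
    by (simp add: tensor_alg_mult tensor_map_tsum_arg tensor_map_pure clinear_hat')
  also have "\<dots> = tsum (coact \<gamma> X) (\<lambda>X' X''. tsum (coact \<gamma> Y) (\<lambda>Y' Y''.
    sw y (\<lambda>y1 y2. sw (hat y1 X') (\<lambda>h1 r. sw r (\<lambda>h2 h3.
    sw x (\<lambda>x1 x2. sw (hat x1 X'') (\<lambda>k1 r. sw r (\<lambda>k2 k3.
     (h2 \<cdot> hat (S' h3 \<cdot> (y2 \<cdot> \<beta> h1)) Y') \<otimes> (k2 \<cdot> hat (S' k3 \<cdot> (x2 \<cdot> \<gamma> k1)) Y'')))))))))"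
    unfolding hm tsum_tensor unfolding tensor_tsum ..
  also have "\<dots> = tsum (coact \<gamma> X) (\<lambda>X' X''.
    sw y (\<lambda>y1 y2. sw (hat y1 X') (\<lambda>h1 r. sw r (\<lambda>h2 h3.
    sw x (\<lambda>x1 x2. sw (hat x1 X'') (\<lambda>k1 r. sw r (\<lambda>k2 k3.
     tsum (coact \<gamma> Y) (\<lambda>Y' Y''.
     (h2 \<cdot> hat (S' h3 \<cdot> (y2 \<cdot> \<beta> h1)) Y') \<otimes> (k2 \<cdot> hat (S' k3 \<cdot> (x2 \<cdot> \<gamma> k1)) Y'')))))))))"
    by (simp only: tsum_swap[where s="coact \<gamma> Y"])
  also have "\<dots> = tsum (coact \<gamma> X) (\<lambda>X' X''.
    sw y (\<lambda>y1 y2. sw (hat y1 X') (\<lambda>h1 r. sw r (\<lambda>h2 h3.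
    sw x (\<lambda>x1 x2. sw (hat x1 X'') (\<lambda>k1 r. sw r (\<lambda>k2 k3.
     sw (hat ((S' k3 \<cdot> (x2 \<cdot> \<gamma> k1)) \<cdot> (S' h3 \<cdot> (y2 \<cdot> \<beta> h1))) Y) (\<lambda>b b'. (h2 \<cdot> \<gamma> b) \<otimes> (k2 \<cdot> b')))))))))"
  proof -
    have "tsum (coact \<gamma> Y) (\<lambda>Y' Y''. (h2 \<cdot> hat u Y') \<otimes> (k2 \<cdot> hat v Y'')) =
      sw (hat (v \<cdot> u) Y) (\<lambda>b b'. (h2 \<cdot> \<gamma> b) \<otimes> (k2 \<cdot> b'))" for h2 k2 u v
      by (rule tsum_hat_coact[where M="\<lambda>p q. (h2 \<cdot> p) \<otimes> (k2 \<cdot> q)"]) (intro lin lins)+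
    then show ?thesis by (simp only:)
  qed
  also have "\<dots> = sw x (\<lambda>x1 x2. sw y (\<lambda>y1 y2. tsum (coact \<gamma> X) (\<lambda>X' X''.
    sw (hat y1 X') (\<lambda>h1 r. sw r (\<lambda>h2 h3. sw (hat x1 X'') (\<lambda>k1 r. sw r (\<lambda>k2 k3.
     sw (hat ((S' k3 \<cdot> (x2 \<cdot> \<gamma> k1)) \<cdot> (S' h3 \<cdot> (y2 \<cdot> \<beta> h1))) Y) (\<lambda>b b'. (h2 \<cdot> \<gamma> b) \<otimes> (k2 \<cdot> b')))))))))"
    by (simp only: tsum_swap[where s="coact \<gamma> X"], simp only: tsum_swap[where t="comult K x"])
  also have "\<dots> = sw x (\<lambda>x1 x2. sw y (\<lambda>y1 y2. sw (hat (x1 \<cdot> y1) X) (\<lambda>h h'.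
    sw (\<gamma> h) (\<lambda>h1 r. sw r (\<lambda>h2 h3. sw h' (\<lambda>k1 r. sw r (\<lambda>k2 k3.
     sw (hat ((S' k3 \<cdot> (x2 \<cdot> \<gamma> k1)) \<cdot> (S' h3 \<cdot> (y2 \<cdot> \<beta> h1))) Y) (\<lambda>b b'. (h2 \<cdot> \<gamma> b) \<otimes> (k2 \<cdot> b')))))))))"
    by (subst tsum_hat_coact[OF lins(3)]) (intro lin refl)+
  \<comment> \<open>The value of Y is now taken at a product containing \<gamma>(k1)
    S'(\<gamma>(h3)), which is \<gamma>(k1 S'(h3)), and \<beta>(\<gamma>(h1)), which is \<alpha>(h1)
    by \<open>eq\<close>.\<close>
  also have "\<dots> = sw x (\<lambda>x1 x2. sw y (\<lambda>y1 y2. sw (hat (x1 \<cdot> y1) X) (\<lambda>h h'.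
    sw h (\<lambda>h1 r. sw r (\<lambda>h2 h3. sw h' (\<lambda>k1 r. sw r (\<lambda>k2 k3.
     sw (hat (S' k3 \<cdot> (x2 \<cdot> (\<gamma> (k1 \<cdot> S' h3) \<cdot> (y2 \<cdot> \<alpha> h1)))) Y) (\<lambda>b b'. (\<gamma> h2 \<cdot> \<gamma> b) \<otimes> (k2 \<cdot> b')))))))))"
    by (simp add: sw_auto[OF \<gamma>] lin auto_S'[OF \<gamma>] auto_times[OF \<gamma>] mult_assoc eq)
  also have "\<dots> = E"
    unfolding E_def by (subst sw_collapse) (auto intro!: lin simp: auto_one[OF \<gamma>] one_mult)
  finally show "hat2 y x (coact \<gamma> (double_mult \<alpha> X Y)) = hat2 y x (mult (tensor_alg (twisted_double_alg K \<beta>) (twisted_double_alg K \<gamma>)) (coact \<gamma> X) (coact \<gamma> Y))"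
    using L by simp
qed

lemma coact_hom:
  assumes "hopf_auto \<alpha>" "hopf_auto \<beta>" "hopf_auto \<gamma>" "\<And>x. \<alpha> x = \<beta> (\<gamma> x)"
  shows "algebra_hom (twisted_double_alg K \<alpha>)
    (tensor_alg (twisted_double_alg K \<beta>) (twisted_double_alg K \<gamma>)) (coact \<gamma>)"
  using coact_mult[OF assms] coact_one[OF assms(3)] clinear_coact[OF auto_clinear[OF assms(3)]]
  unfolding algebra_hom_def double_mult_def double_one_def
  by (simp add: tensor_alg_one) (simp add: twisted_double_alg_def)

text \<open>At (z, y, x) both sides equal \<gamma>(\<delta>(h_(1))) \<otimes> \<delta>(h_(2))
  \<otimes> h_(3) with h = X(x y z). Since \<delta> respects coproducts, it can be applied before or
  after splitting the first leg.\<close>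

lemma coact_coassoc:
  assumes \<gamma>: "hopf_auto \<gamma>" and \<delta>: "hopf_auto \<delta>" and \<phi>: "hopf_auto \<phi>" and eq: "\<And>x. \<phi> x = \<gamma> (\<delta> x)"
  shows "tensor_assoc (tensor_map (coact \<gamma>) id (coact \<delta> X)) = tensor_map id (coact \<delta>) (coact \<phi> X)"
proof (rule hat3_eqI)
  fix x y z
  note lins = auto_clinear[OF \<gamma>] auto_clinear[OF \<delta>] auto_clinear[OF \<phi>]
  note colins = lins[THEN clinear_coact]
  note [lin] = lins[THEN clinear_compose] colins[THEN clinear_compose]
  have "hat3 z y x (tensor_assoc (tensor_map (coact \<gamma>) id (coact \<delta> X))) =
    tsum (coact \<delta> X) (\<lambda>U W. tsum (coact \<gamma> U) (\<lambda>P Q. hat z P \<otimes> (hat y Q \<otimes> hat x W)))"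
    by (simp add: tensor_assoc_eq tensor_map_tsum[OF colins(1)] lin id_def tsum_tsum tsum_pure
      tensor_map_tsum_arg clinear_hat' clinear_hat2 tensor_map_pure)
  also have "\<dots> = tsum (coact \<delta> X) (\<lambda>U W. sw (hat (y \<cdot> z) U) (\<lambda>u v. \<gamma> u \<otimes> (v \<otimes> hat x W)))"
    by (subst tsum_hat_coact[OF lins(1)]) (intro lin refl)+
  also have "\<dots> = sw (hat (x \<cdot> (y \<cdot> z)) X) (\<lambda>h h'. sw h (\<lambda>u v. \<phi> u \<otimes> (\<delta> v \<otimes> h')))"
    by (subst tsum_hat_coact[OF lins(2)]) (auto intro!: lin simp: sw_auto[OF \<delta>] lin eq)
  finally have L: "hat3 z y x (tensor_assoc (tensor_map (coact \<gamma>) id (coact \<delta> X))) =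
    sw (hat (x \<cdot> (y \<cdot> z)) X) (\<lambda>h h'. sw h (\<lambda>u v. \<phi> u \<otimes> (\<delta> v \<otimes> h')))" .
  have "hat3 z y x (tensor_map id (coact \<delta>) (coact \<phi> X)) =
    tsum (coact \<phi> X) (\<lambda>U W. hat z U \<otimes> hat2 y x (coact \<delta> W))"
    by (simp add: tensor_map_tsum[OF _ colins(2)] lin id_def tensor_map_tsum_arg clinear_hat' clinear_hat2 tensor_map_pure)
  also have "\<dots> = tsum (coact \<phi> X) (\<lambda>U W. hat z U \<otimes> sw (hat (x \<cdot> y) W) (\<lambda>u v. \<delta> u \<otimes> v))"
    by (simp add: hat2_coact lins)
  also have "\<dots> = sw (hat (x \<cdot> y \<cdot> z) X) (\<lambda>h h'. \<phi> h \<otimes> sw h' (\<lambda>u v. \<delta> u \<otimes> v))"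
    by (subst tsum_hat_coact[OF lins(3)]) (intro lin refl)+
  also have "\<dots> = sw (hat (x \<cdot> (y \<cdot> z)) X) (\<lambda>h h'. sw h (\<lambda>u v. \<phi> u \<otimes> (\<delta> v \<otimes> h')))"
    by (simp add: sw_assoc lin mult_assoc tensor_tsum)
  finally show "hat3 z y x (tensor_assoc (tensor_map (coact \<gamma>) id (coact \<delta> X))) = hat3 z y x (tensor_map id (coact \<delta>) (coact \<phi> X))"
    using L by simp
qed

end

section \<open>Galois objects\<close>

text \<open>\<open>A\<close> and \<open>K\<close> share their underlying space, and \<open>T\<close>
  is the convolution inverse of the identity viewed as a map from \<open>K\<close> to
  \<open>A\<close>. The inverse of the canonical map is p \<otimes> d |-> p T(d_(1)) \<otimes>
  d_(2), with the product taken in \<open>A\<close>.\<close>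

lemma bij_right_galois_map:
  fixes K :: "('k::complex_vector, 'x) bialg_scheme" and A :: "('k, 'y) alg_scheme"
  assumes "bialgebra K" "unital_algebra A" and T: "clinear T"
    and inv_left: "\<And>x. tsum (comult K x) (\<lambda>a b. mult A (T a) b) = counit K x *\<^sub>C one A"
    and inv_right: "\<And>x. tsum (comult K x) (\<lambda>a b. mult A a (T b)) = counit K x *\<^sub>C one A"
  shows "bij (tensor_lift (\<lambda>p p'. tensor_lift (\<lambda>a b. mult A p a \<otimes> b) (comult K p'))
    :: 'k \<otimes> 'k \<Rightarrow> 'k \<otimes> 'k)"
proof -
  interpret bialgebra K by fact
  interpret A: unital_algebra A by fact
  note [lin] = T[THEN clinear_compose]
  define f where "f t = tsum t (\<lambda>p p'. sw p' (\<lambda>a b. mult A p a \<otimes> b))" for t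
  define g where "g t = tsum t (\<lambda>a d. sw d (\<lambda>u v. mult A a (T u) \<otimes> v))" for t
  have f: "clinear f" and g: "clinear g" unfolding f_def g_def by (intro lin)+
  have f_pure: "f (p \<otimes> p') = sw p' (\<lambda>a b. mult A p a \<otimes> b)" for p p'
    unfolding f_def by (rule tsum_pure) (intro lin)+
  have g_pure: "g (p \<otimes> p') = sw p' (\<lambda>a b. mult A p (T a) \<otimes> b)" for p p'
    unfolding g_def by (rule tsum_pure) (intro lin)+
  have gf: "g (f (p \<otimes> p')) = p \<otimes> p'" for p p'
  proof -
    have "g (f (p \<otimes> p')) = sw p' (\<lambda>a b. sw b (\<lambda>u v. mult A p (mult A a (T u)) \<otimes> v))"
      by (simp add: f_pure clinear_tsum[OF g] g_pure A.mult_assoc)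
    also have "\<dots> = sw p' (\<lambda>r v. mult A p (sw r (\<lambda>a u. mult A a (T u))) \<otimes> v)"
      by (simp add: A.times_tsum tsum_tensor sw_assoc lin)
    also have "\<dots> = p \<otimes> p'"
      by (simp add: inv_right A.times_scaleC A.mult_one scaleC_tensor sw_counit_left lin)
    finally show ?thesis .
  qed
  have fg: "f (g (p \<otimes> p')) = p \<otimes> p'" for p p'
  proof -
    have "f (g (p \<otimes> p')) = sw p' (\<lambda>a b. sw b (\<lambda>u v. mult A p (mult A (T a) u) \<otimes> v))"
      by (simp add: g_pure clinear_tsum[OF f] f_pure A.mult_assoc)
    also have "\<dots> = sw p' (\<lambda>r v. mult A p (sw r (\<lambda>a u. mult A (T a) u)) \<otimes> v)"
      by (simp add: A.times_tsum tsum_tensor sw_assoc lin)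
    also have "\<dots> = p \<otimes> p'"
      by (simp add: inv_left A.times_scaleC A.mult_one scaleC_tensor sw_counit_left lin)
    finally show ?thesis .
  qed
  have "g (f t) = t" "f (g t) = t" for t
    by (induction t rule: tensor_induct) (simp_all add: gf fg clinear_add[OF f] clinear_add[OF g])
  then have "bij f" by (intro o_bij[of g]) auto
  moreover have "tensor_lift (\<lambda>p p'. tensor_lift (\<lambda>a b. mult A p a \<otimes> b) (comult K p')) = f"
    unfolding f_def by (rule ext) (simp add: tsum_eq_lift lin)
  ultimately show ?thesis by simp
qed

text \<open>The mirror image: the inverse is q \<otimes> q' |-> q_(1) \<otimes> T(q_(2)) q'.\<close>

lemma bij_left_galois_map:
  fixes K :: "('k::complex_vector, 'x) bialg_scheme" and A :: "('k, 'y) alg_scheme"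
  assumes "bialgebra K" "unital_algebra A" and T: "clinear T"
    and inv_left: "\<And>x. tsum (comult K x) (\<lambda>a b. mult A (T a) b) = counit K x *\<^sub>C one A"
    and inv_right: "\<And>x. tsum (comult K x) (\<lambda>a b. mult A a (T b)) = counit K x *\<^sub>C one A"
  shows "bij (tensor_lift (\<lambda>q q'. tensor_lift (\<lambda>a b. a \<otimes> mult A b q') (comult K q))
    :: 'k \<otimes> 'k \<Rightarrow> 'k \<otimes> 'k)"
proof -
  interpret bialgebra K by fact
  interpret A: unital_algebra A by fact
  note [lin] = T[THEN clinear_compose]
  define f where "f t = tsum t (\<lambda>q q'. sw q (\<lambda>a b. a \<otimes> mult A b q'))" for t
  define g where "g t = tsum t (\<lambda>q q'. sw q (\<lambda>a b. a \<otimes> mult A (T b) q'))" for t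
  have f: "clinear f" and g: "clinear g" unfolding f_def g_def by (intro lin)+
  have f_pure: "f (q \<otimes> q') = sw q (\<lambda>a b. a \<otimes> mult A b q')" for q q'
    unfolding f_def by (rule tsum_pure) (intro lin)+
  have g_pure: "g (q \<otimes> q') = sw q (\<lambda>a b. a \<otimes> mult A (T b) q')" for q q'
    unfolding g_def by (rule tsum_pure) (intro lin)+
  have gf: "g (f (q \<otimes> q')) = q \<otimes> q'" for q q'
  proof -
    have "g (f (q \<otimes> q')) = sw q (\<lambda>a b. sw a (\<lambda>u v. u \<otimes> mult A (mult A (T v) b) q'))"
      by (simp add: f_pure clinear_tsum[OF g] g_pure A.mult_assoc)
    also have "\<dots> = sw q (\<lambda>u r. u \<otimes> mult A (sw r (\<lambda>v b. mult A (T v) b)) q')"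
      by (simp add: A.tsum_times tensor_tsum sw_assoc lin)
    also have "\<dots> = q \<otimes> q'"
      by (simp add: inv_left A.scaleC_times A.one_mult tensor_scaleC sw_counit_right lin)
    finally show ?thesis .
  qed
  have fg: "f (g (q \<otimes> q')) = q \<otimes> q'" for q q'
  proof -
    have "f (g (q \<otimes> q')) = sw q (\<lambda>a b. sw a (\<lambda>u v. u \<otimes> mult A (mult A v (T b)) q'))"
      by (simp add: g_pure clinear_tsum[OF f] f_pure A.mult_assoc)
    also have "\<dots> = sw q (\<lambda>u r. u \<otimes> mult A (sw r (\<lambda>v b. mult A v (T b))) q')"
      by (simp add: A.tsum_times tensor_tsum sw_assoc lin)
    also have "\<dots> = q \<otimes> q'"
      by (simp add: inv_right A.scaleC_times A.one_mult tensor_scaleC sw_counit_right lin)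
    finally show ?thesis .
  qed
  have "g (f t) = t" "f (g t) = t" for t
    by (induction t rule: tensor_induct) (simp_all add: gf fg clinear_add[OF f] clinear_add[OF g])
  then have "bij f" by (intro o_bij[of g]) auto
  moreover have "tensor_lift (\<lambda>q q'. tensor_lift (\<lambda>a b. a \<otimes> mult A b q') (comult K q)) = f"
    unfolding f_def by (rule ext) (simp add: tsum_eq_lift lin)
  ultimately show ?thesis by simp
qed

context fd_hopf
begin

section \<open>The Drinfeld double as a bialgebra\<close>

lemma coact_eq_lift:
  assumes "clinear \<gamma>"
  shows "tensor_lift (\<lambda>\<phi> h. sweedler2 (dual_hopf K) \<phi> (\<lambda>\<phi>1 \<phi>2. sweedler2 K h (\<lambda>h1 h2.
    (\<phi>2 \<otimes> \<gamma> h1) \<otimes> (\<phi>1 \<otimes> h2)))) = coact \<gamma>"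
proof
  fix X
  note [lin] = assms[THEN clinear_compose]
  show "tensor_lift (\<lambda>\<phi> h. sweedler2 (dual_hopf K) \<phi> (\<lambda>\<phi>1 \<phi>2. sweedler2 K h (\<lambda>h1 h2.
    (\<phi>2 \<otimes> \<gamma> h1) \<otimes> (\<phi>1 \<otimes> h2)))) X = coact \<gamma> X"
    unfolding coact_def by (simp add: sweedler2_def tsum_eq_lift lin)
qed

lemma right_coaction_eq: "right_coaction K = coact id"
  unfolding right_coaction_def using coact_eq_lift[of id] by (simp add: id_def clinear_ident)

lemma left_coaction_eq: "left_coaction K = coact (S \<circ> S)"
  unfolding left_coaction_def using coact_eq_lift[of "S \<circ> S"] auto_clinear[OF hopf_auto_S2]
  by (simp add: S_def)

lemma double_simps:
  shows "mult (drinfeld_double K) = double_mult id" "one (drinfeld_double K) = double_one"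
    "comult (drinfeld_double K) = coact id" "counit (drinfeld_double K) X = \<epsilon> (hat \<one> X)"
    "mult (anti_drinfeld_double K) = double_mult (S \<circ> S)" "one (anti_drinfeld_double K) = double_one"
    "mult (twisted_double_alg K \<alpha>) = double_mult \<alpha>" "one (twisted_double_alg K \<alpha>) = double_one"
proof -
  show "comult (drinfeld_double K) = coact id"
    using coact_eq_lift[of id] by (simp add: drinfeld_double_def id_def clinear_ident)
  have "counit (drinfeld_double K) X = tsum X (\<lambda>\<phi> h. \<langle>\<phi>, \<one>\<rangle> * \<epsilon> h)"
    unfolding drinfeld_double_def bialg.simps by (rule tsum_eq_lift) (intro lin)
  then show "counit (drinfeld_double K) X = \<epsilon> (hat \<one> X)"
    unfolding hat_def by (simp add: counit_tsum counit_scaleC)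
qed (simp_all add: drinfeld_double_def anti_drinfeld_double_def double_mult_def twisted_double_alg_def double_one_def S_def)

lemma tensor_alg_double:
  "tensor_alg (drinfeld_double K) A = tensor_alg (twisted_double_alg K id) A"
  "tensor_alg A (drinfeld_double K) = tensor_alg A (twisted_double_alg K id)"
  by (simp_all add: tensor_alg_def double_simps)

text \<open>The surviving leg is the one that carries the twist, so only the untwisted coaction
  returns X here.\<close>

lemma coact_counit_right: "tsum (coact id X) (\<lambda>U W. \<epsilon> (hat \<one> W) *\<^sub>C U) = X"
proof (rule hat_eqI)
  fix y
  have "tsum (coact id X) (\<lambda>U W. \<epsilon> (hat \<one> W) *\<^sub>C hat y U) = sw (hat (\<one> \<cdot> y) X) (\<lambda>h h'. \<epsilon> h' *\<^sub>C id h)"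
    by (rule tsum_hat_coact[where M="\<lambda>p q. \<epsilon> q *\<^sub>C p"]) (auto intro!: lin simp: id_def)
  then show "hat y (tsum (coact id X) (\<lambda>U W. \<epsilon> (hat \<one> W) *\<^sub>C U)) = hat y X"
    by (simp add: hat_tsum hat_scaleC one_mult sw_counit_right lin)
qed

text \<open>Here the counit is applied to the twisted leg, and \<epsilon> is invariant under
  \<gamma>.\<close>

lemma coact_counit_left:
  assumes \<gamma>: "hopf_auto \<gamma>"
  shows "tsum (coact \<gamma> X) (\<lambda>U W. \<epsilon> (hat \<one> U) *\<^sub>C W) = X"
proof (rule hat_eqI)
  fix x
  have "tsum (coact \<gamma> X) (\<lambda>U W. \<epsilon> (hat \<one> U) *\<^sub>C hat x W) = sw (hat (x \<cdot> \<one>) X) (\<lambda>h h'. \<epsilon> (\<gamma> h) *\<^sub>C h')"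
    by (rule tsum_hat_coact[where M="\<lambda>p q. \<epsilon> p *\<^sub>C q"]) (auto intro!: lin auto_clinear[OF \<gamma>])
  then show "hat x (tsum (coact \<gamma> X) (\<lambda>U W. \<epsilon> (hat \<one> U) *\<^sub>C W)) = hat x X"
    by (simp add: hat_tsum hat_scaleC mult_one auto_counit[OF \<gamma>] sw_counit_left lin)
qed

text \<open>At the unit with \<alpha> = id, applying the counit to the middle leg leaves the value
  of Y at S'(h_(2)) h_(1), and this argument collapses to a multiple of the unit.\<close>

lemma counit_double_mult: "\<epsilon> (hat \<one> (double_mult id X Y)) = \<epsilon> (hat \<one> X) * \<epsilon> (hat \<one> Y)"
proof -
  have "\<epsilon> (hat \<one> (double_mult id X Y)) =
    sw (hat \<one> X) (\<lambda>h1 r. sw r (\<lambda>h2 h3. \<epsilon> h2 *\<^sub>C \<epsilon> (hat (S' h3 \<cdot> h1) Y)))"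
    by (simp add: hat_double_mult id_def clinear_ident sw_one lin one_mult counit_tsum)
  also have "\<dots> = sw (hat \<one> X) (\<lambda>h1 h3. \<epsilon> (hat (S' h3 \<cdot> h1) Y))"
    by (simp only: sw_counit_left lin)
  also have "\<dots> = \<epsilon> (hat \<one> X) *\<^sub>C \<epsilon> (hat \<one> Y)"
    by (rule sw_S'_left[where G="\<lambda>z. \<epsilon> (hat z Y)"]) (auto intro!: lin)
  finally show ?thesis by simp
qed

lemma bialgebra_double: "bialgebra (drinfeld_double K)"
proof -
  interpret D: unital_algebra "twisted_double_alg K id"
    by (rule unital_algebra_double[OF hopf_auto_id])
  show ?thesis
  proof unfold_locales
    show "cbilinear (mult (drinfeld_double K))"
      using D.mult_bilinear by (simp add: double_simps)
    show "mult (drinfeld_double K) (mult (drinfeld_double K) a b) c =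
        mult (drinfeld_double K) a (mult (drinfeld_double K) b c)" for a b c
      using D.mult_assoc by (simp add: double_simps)
    show "mult (drinfeld_double K) (one (drinfeld_double K)) a = a"
      "mult (drinfeld_double K) a (one (drinfeld_double K)) = a" for a
      using D.one_mult D.mult_one by (simp_all add: double_simps)
    show "algebra_hom (drinfeld_double K) (tensor_alg (drinfeld_double K) (drinfeld_double K)) (comult (drinfeld_double K))"
      using coact_hom[OF hopf_auto_id hopf_auto_id hopf_auto_id]
      by (simp add: algebra_hom_def double_simps tensor_alg_double)
    show "algebra_hom (drinfeld_double K) complex_alg (counit (drinfeld_double K))"
      unfolding algebra_hom_def complex_alg_def
      by (auto simp: double_simps counit_double_mult hat_double_one counit_scaleC intro!: clinearI
         simp: clinear_add[OF clinear_hat'] clinear_add[OF clinear_counit] hat_scaleC)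
    fix X
    show "tensor_assoc (tensor_map (comult (drinfeld_double K)) id (comult (drinfeld_double K) X)) =
       tensor_map id (comult (drinfeld_double K)) (comult (drinfeld_double K) X)"
      unfolding double_simps by (rule coact_coassoc) (auto intro: hopf_auto_id)
    show "tensor_lift (\<lambda>x1 x2. counit (drinfeld_double K) x1 *\<^sub>C x2) (comult (drinfeld_double K) X) = X"
      using coact_counit_left[OF hopf_auto_id] by (simp add: double_simps tsum_eq_lift lin)
    show "tensor_lift (\<lambda>x1 x2. counit (drinfeld_double K) x2 *\<^sub>C x1) (comult (drinfeld_double K) X) = X"
      using coact_counit_right by (simp add: double_simps tsum_eq_lift lin)
  qed
qed

text \<open>In the double, \<open>\<phi> \<otimes> h\<close> is the product of \<open>\<phi>\<close> and \<open>h\<close>; the convolution inverse of the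
  identity is obtained by inverting and reversing the two factors.\<close>

definition incl :: "'k \<Rightarrow> 'k dual \<otimes> 'k" where "incl h = Abs_dual \<epsilon> \<otimes> h"
definition incl_dual :: "'k dual \<Rightarrow> 'k dual \<otimes> 'k" where "incl_dual \<phi> = \<phi> \<otimes> \<one>"

lemma hat_incl: "hat x (incl h) = \<epsilon> x *\<^sub>C h" and hat_incl_dual: "hat x (incl_dual \<phi>) = \<langle>\<phi>, x\<rangle> *\<^sub>C \<one>"
  by (simp_all add: incl_def incl_dual_def eval_Abs_dual clinear_counit)

lemma clinear_incl: "clinear incl" and clinear_incl_dual: "clinear incl_dual"
  unfolding incl_def incl_dual_def by (intro lin)+

lemma incl_one: "incl \<one> = double_one" and incl_dual_counit: "incl_dual (Abs_dual \<epsilon>) = double_one"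
  by (simp_all add: incl_def incl_dual_def double_one_def)

text \<open>In each of these products one conjugation is trivial: either the first factor has values
  that are multiples of the unit, or the second factor depends on its argument only through
  \<epsilon>. Hence the results are the same for every \<alpha>.\<close>

lemma
  assumes \<alpha>: "hopf_auto \<alpha>"
  shows incl_mult: "double_mult \<alpha> (incl g) (incl h) = incl (g \<cdot> h)"
    and incl_dual_mult: "double_mult \<alpha> (incl_dual \<phi>) (incl_dual \<psi>) = incl_dual (\<phi> \<star> \<psi>)"
    and incl_dual_incl: "double_mult \<alpha> (incl_dual \<phi>) (incl h) = \<phi> \<otimes> h"
proof -
  note [lin] = auto_clinear[OF \<alpha>, THEN clinear_compose]
  note hm = hat_double_mult[OF auto_clinear[OF \<alpha>]]
  show "double_mult \<alpha> (incl g) (incl h) = incl (g \<cdot> h)"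
  proof (rule hat_eqI)
    fix x
    have e: "h2 \<cdot> hat (S' h3 \<cdot> (x2 \<cdot> \<alpha> h1)) (incl h) = \<epsilon> h1 *\<^sub>C \<epsilon> h3 *\<^sub>C \<epsilon> x2 *\<^sub>C (h2 \<cdot> h)" for h1 h2 h3 x2
      by (simp add: hat_incl auto_counit[OF \<alpha>] times_scaleC mult_ac)
    show "hat x (double_mult \<alpha> (incl g) (incl h)) = hat x (incl (g \<cdot> h))"
      unfolding hm e unfolding hat_incl
      by (simp add: scaleC_times sw_scaleC_arg tsum_scale sw_counit_left sw_counit_right lin del: complex_vector.scale_scale)
  qed
  show "double_mult \<alpha> (incl_dual \<phi>) (incl_dual \<psi>) = incl_dual (\<phi> \<star> \<psi>)"
    by (rule hat_eqI) (simp add: hm hat_incl_dual sw_scaleC_arg sw_one lin auto_one[OF \<alpha>] one_mult mult_one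
        eval_dual_times tsum_scaleC)
  show "double_mult \<alpha> (incl_dual \<phi>) (incl h) = \<phi> \<otimes> h"
  proof (rule hat_eqI)
    fix x
    have "hat x (double_mult \<alpha> (incl_dual \<phi>) (incl h)) = sw x (\<lambda>a b. \<epsilon> b *\<^sub>C \<langle>\<phi>, a\<rangle> *\<^sub>C h)"
      by (simp add: hm hat_incl_dual hat_incl sw_scaleC_arg sw_one lin auto_one[OF \<alpha>] one_mult mult_one mult.commute)
    also have "\<dots> = hat x (\<phi> \<otimes> h)"
      unfolding hat_pure by (rule sw_counit_right) (intro lin)
    finally show "hat x (double_mult \<alpha> (incl_dual \<phi>) (incl h)) = hat x (\<phi> \<otimes> h)" .
  qed
qed

text \<open>The inverse of the antipode of the dual. It is the antipode for the reversed coproduct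
  with which the dual sits inside the double, as the next two identities with \<phi>_(2) before
  \<phi>_(1) express.\<close>

definition dual_S' :: "'k dual \<Rightarrow> 'k dual" where "dual_S' \<phi> = Abs_dual (\<lambda>x. \<langle>\<phi>, S' x\<rangle>)"

lemma eval_dual_S': "\<langle>dual_S' \<phi>, x\<rangle> = \<langle>\<phi>, S' x\<rangle>"
  unfolding dual_S'_def by (intro eval_Abs_dual lin)

lemma clinear_dual_S': "clinear dual_S'"
  by (intro clinearI dual_eqI) (simp_all add: eval_dual_S')

lemma eval_tsum_left: "\<langle>tsum t F, x\<rangle> = tsum t (\<lambda>a b. \<langle>F a b, x\<rangle>)"
  by (rule clinear_tsum, intro lin)

lemma eval_counit: "\<langle>Abs_dual \<epsilon>, x\<rangle> = \<epsilon> x"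
  by (rule eval_Abs_dual[OF clinear_counit])

lemma dual_S'_right: "dual_sw \<phi> (\<lambda>\<phi>1 \<phi>2. \<phi>2 \<star> dual_S' \<phi>1) = \<langle>\<phi>, \<one>\<rangle> *\<^sub>C Abs_dual \<epsilon>"
proof (rule dual_eqI)
  fix x
  have "\<langle>dual_sw \<phi> (\<lambda>\<phi>1 \<phi>2. \<phi>2 \<star> dual_S' \<phi>1), x\<rangle> = sw x (\<lambda>a b. dual_sw \<phi> (\<lambda>\<phi>1 \<phi>2. \<langle>\<phi>1, S' b\<rangle> * \<langle>\<phi>2, a\<rangle>))"
    unfolding eval_tsum_left eval_dual_times eval_dual_S' by (subst tsum_swap) (simp add: mult.commute)
  also have "\<dots> = \<epsilon> x *\<^sub>C \<langle>\<phi>, \<one>\<rangle>"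
    unfolding dual_sw_eval by (rule sw_S'_left) (auto intro!: lin)
  finally show "\<langle>dual_sw \<phi> (\<lambda>\<phi>1 \<phi>2. \<phi>2 \<star> dual_S' \<phi>1), x\<rangle> = \<langle>\<langle>\<phi>, \<one>\<rangle> *\<^sub>C Abs_dual \<epsilon>, x\<rangle>"
    by (simp add: eval_counit mult.commute)
qed

lemma dual_S'_left: "dual_sw \<phi> (\<lambda>\<phi>1 \<phi>2. dual_S' \<phi>2 \<star> \<phi>1) = \<langle>\<phi>, \<one>\<rangle> *\<^sub>C Abs_dual \<epsilon>"
proof (rule dual_eqI)
  fix x
  have "\<langle>dual_sw \<phi> (\<lambda>\<phi>1 \<phi>2. dual_S' \<phi>2 \<star> \<phi>1), x\<rangle> = sw x (\<lambda>a b. dual_sw \<phi> (\<lambda>\<phi>1 \<phi>2. \<langle>\<phi>1, b\<rangle> * \<langle>\<phi>2, S' a\<rangle>))"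
    unfolding eval_tsum_left eval_dual_times eval_dual_S' by (subst tsum_swap) (simp add: mult.commute)
  also have "\<dots> = \<epsilon> x *\<^sub>C \<langle>\<phi>, \<one>\<rangle>"
    unfolding dual_sw_eval by (rule sw_S'_right) (auto intro!: lin)
  finally show "\<langle>dual_sw \<phi> (\<lambda>\<phi>1 \<phi>2. dual_S' \<phi>2 \<star> \<phi>1), x\<rangle> = \<langle>\<langle>\<phi>, \<one>\<rangle> *\<^sub>C Abs_dual \<epsilon>, x\<rangle>"
    by (simp add: eval_counit mult.commute)
qed

definition conv_inv :: "('k \<Rightarrow> 'k) \<Rightarrow> 'k dual \<otimes> 'k \<Rightarrow> 'k dual \<otimes> 'k" where
  "conv_inv \<alpha> X = tsum X (\<lambda>\<phi> h. double_mult \<alpha> (incl (S h)) (incl_dual (dual_S' \<phi>)))"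

lemma counit_hat_one: "\<epsilon> (hat \<one> X) = tsum X (\<lambda>\<phi> h. \<langle>\<phi>, \<one>\<rangle> * \<epsilon> h)"
  unfolding hat_def by (simp add: counit_tsum counit_scaleC)

text \<open>Cancellation proceeds from the inside out. In U T(W) the factors h_(1) S(h_(2)) meet
  first and the dual factors afterwards; in T(U) W the dual factors meet first. Every product
  evaluated on the way is of a kind independent of \<alpha>, so one formula serves both
  doubles.\<close>

lemma
  assumes \<alpha>: "hopf_auto \<alpha>"
  shows clinear_conv_inv: "clinear (conv_inv \<alpha>)"
    and conv_inv_right: "tsum (coact id X) (\<lambda>U W. double_mult \<alpha> U (conv_inv \<alpha> W)) = \<epsilon> (hat \<one> X) *\<^sub>C double_one"
    and conv_inv_left: "tsum (coact id X) (\<lambda>U W. double_mult \<alpha> (conv_inv \<alpha> U) W) = \<epsilon> (hat \<one> X) *\<^sub>C double_one"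
proof -
  note bil = cbilinear_double_mult[OF auto_clinear[OF \<alpha>]]
  note [lin] = cbilinear_left[OF bil] cbilinear_right[OF bil] clinear_incl[THEN clinear_compose]
    clinear_incl_dual[THEN clinear_compose] clinear_dual_S'[THEN clinear_compose]
  show c: "clinear (conv_inv \<alpha>)" unfolding conv_inv_def by (intro lin)
  note [lin] = c[THEN clinear_compose]
  have pure: "conv_inv \<alpha> (\<phi> \<otimes> h) = double_mult \<alpha> (incl (S h)) (incl_dual (dual_S' \<phi>))" for \<phi> h
    unfolding conv_inv_def by (rule tsum_pure) (intro lin)+
  have tl: "double_mult \<alpha> (tsum t F) Y = tsum t (\<lambda>a b. double_mult \<alpha> (F a b) Y)"
    and tr: "double_mult \<alpha> Y (tsum t F) = tsum t (\<lambda>a b. double_mult \<alpha> Y (F a b))"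
    for t Y and F :: "'c::complex_vector \<Rightarrow> 'd::complex_vector \<Rightarrow> 'k dual \<otimes> 'k"
    by (rule clinear_tsum, intro lin)+
  have sl: "double_mult \<alpha> (a *\<^sub>C X) Y = a *\<^sub>C double_mult \<alpha> X Y"
    and sr: "double_mult \<alpha> X (a *\<^sub>C Y) = a *\<^sub>C double_mult \<alpha> X Y" for a X Y
    by (rule clinear_scale, intro lin)+
  note assoc = double_mult_assoc[OF \<alpha>]
  have "dual_sw \<phi> (\<lambda>\<phi>1 \<phi>2. sw h (\<lambda>h1 h2. double_mult \<alpha> (\<phi>2 \<otimes> h1) (conv_inv \<alpha> (\<phi>1 \<otimes> h2)))) = (\<langle>\<phi>, \<one>\<rangle> * \<epsilon> h) *\<^sub>C double_one"
    for \<phi> h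
  proof -
    have "double_mult \<alpha> (\<phi>2 \<otimes> h1) (conv_inv \<alpha> (\<phi>1 \<otimes> h2)) = double_mult \<alpha> (incl_dual \<phi>2)
       (double_mult \<alpha> (incl (h1 \<cdot> S h2)) (incl_dual (dual_S' \<phi>1)))" for \<phi>1 \<phi>2 h1 h2
      unfolding pure unfolding incl_dual_incl[OF \<alpha>, symmetric] incl_mult[OF \<alpha>, symmetric] assoc ..
    moreover have "sw h (\<lambda>h1 h2. double_mult \<alpha> (incl_dual \<phi>2)
       (double_mult \<alpha> (incl (h1 \<cdot> S h2)) (incl_dual (dual_S' \<phi>1)))) = \<epsilon> h *\<^sub>C incl_dual (\<phi>2 \<star> dual_S' \<phi>1)" for \<phi>1 \<phi>2
      by (subst sw_antipode_right[where G="\<lambda>z. double_mult \<alpha> (incl_dual \<phi>2)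
       (double_mult \<alpha> (incl z) (incl_dual (dual_S' \<phi>1)))"])
       (auto intro!: lin simp: incl_one double_one_mult[OF \<alpha>] incl_dual_mult[OF \<alpha>])
    ultimately have "dual_sw \<phi> (\<lambda>\<phi>1 \<phi>2. sw h (\<lambda>h1 h2. double_mult \<alpha> (\<phi>2 \<otimes> h1) (conv_inv \<alpha> (\<phi>1 \<otimes> h2)))) =
       \<epsilon> h *\<^sub>C incl_dual (dual_sw \<phi> (\<lambda>\<phi>1 \<phi>2. \<phi>2 \<star> dual_S' \<phi>1))"
      by (simp add: clinear_tsum[OF clinear_incl_dual] tsum_scale)
    then show ?thesis
      by (simp add: dual_S'_right clinear_scale[OF clinear_incl_dual] incl_dual_counit mult.commute)
  qed
  then show "tsum (coact id X) (\<lambda>U W. double_mult \<alpha> U (conv_inv \<alpha> W)) = \<epsilon> (hat \<one> X) *\<^sub>C double_one"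
    unfolding coact_def counit_hat_one by (simp add: tsum_tsum tsum_pure lin tsum_scaleC)
  have "dual_sw \<phi> (\<lambda>\<phi>1 \<phi>2. sw h (\<lambda>h1 h2. double_mult \<alpha> (conv_inv \<alpha> (\<phi>2 \<otimes> h1)) (\<phi>1 \<otimes> h2))) = (\<langle>\<phi>, \<one>\<rangle> * \<epsilon> h) *\<^sub>C double_one"
    for \<phi> h
  proof -
    have "double_mult \<alpha> (conv_inv \<alpha> (\<phi>2 \<otimes> h1)) (\<phi>1 \<otimes> h2) = double_mult \<alpha> (incl (S h1))
       (double_mult \<alpha> (incl_dual (dual_S' \<phi>2 \<star> \<phi>1)) (incl h2))" for \<phi>1 \<phi>2 h1 h2
      unfolding pure incl_dual_incl[OF \<alpha>, of \<phi>1, symmetric] incl_dual_mult[OF \<alpha>, symmetric] assoc ..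
    then have "dual_sw \<phi> (\<lambda>\<phi>1 \<phi>2. sw h (\<lambda>h1 h2. double_mult \<alpha> (conv_inv \<alpha> (\<phi>2 \<otimes> h1)) (\<phi>1 \<otimes> h2))) =
      sw h (\<lambda>h1 h2. double_mult \<alpha> (incl (S h1))
       (double_mult \<alpha> (incl_dual (dual_sw \<phi> (\<lambda>\<phi>1 \<phi>2. dual_S' \<phi>2 \<star> \<phi>1))) (incl h2)))"
      by (subst tsum_swap) (simp add: clinear_tsum[OF clinear_incl_dual] tl tr)
    also have "\<dots> = \<langle>\<phi>, \<one>\<rangle> *\<^sub>C sw h (\<lambda>h1 h2. incl (S h1 \<cdot> h2))"
      by (simp add: dual_S'_left clinear_scale[OF clinear_incl_dual] incl_dual_counit sl sr double_one_mult[OF \<alpha>]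
        incl_mult[OF \<alpha>] tsum_scale)
    also have "sw h (\<lambda>h1 h2. incl (S h1 \<cdot> h2)) = \<epsilon> h *\<^sub>C double_one"
      by (subst sw_antipode_left[where G=incl]) (auto intro!: clinear_incl simp: incl_one)
    finally show ?thesis by simp
  qed
  then show "tsum (coact id X) (\<lambda>U W. double_mult \<alpha> (conv_inv \<alpha> U) W) = \<epsilon> (hat \<one> X) *\<^sub>C double_one"
    unfolding coact_def counit_hat_one by (simp add: tsum_tsum tsum_pure lin tsum_scaleC)
qed

section \<open>The Hopf structure of D(H) and the bicomodule structure of A(H)\<close>

lemma hopf_algebra_double: "hopf_algebra (drinfeld_double K)"
proof -
  interpret D: bialgebra "drinfeld_double K" by (rule bialgebra_double)
  note [lin] = clinear_conv_inv[OF hopf_auto_id, THEN clinear_compose]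
    clinear_double_mult[OF hopf_auto_id]
  have "is_antipode (drinfeld_double K) (conv_inv id)"
    unfolding is_antipode_def double_simps
    by (simp add: clinear_conv_inv[OF hopf_auto_id] tsum_eq_lift lin conv_inv_left[OF hopf_auto_id] conv_inv_right[OF hopf_auto_id])
  then show ?thesis by unfold_locales blast
qed

lemma unital_algebra_anti: "unital_algebra (anti_drinfeld_double K)"
  using unital_algebra_double[OF hopf_auto_S2] by (simp add: anti_drinfeld_double_def S_def)

lemma bicomodule_algebra_anti:
  "bicomodule_algebra (drinfeld_double K) (anti_drinfeld_double K) (left_coaction K) (right_coaction K)"
proof -
  interpret D: hopf_algebra "drinfeld_double K" by (rule hopf_algebra_double)
  interpret A: unital_algebra "anti_drinfeld_double K" by (rule unital_algebra_anti)
  have anti: "anti_drinfeld_double K = twisted_double_alg K (S \<circ> S)"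
    by (simp add: anti_drinfeld_double_def S_def)
  show ?thesis
    unfolding right_coaction_eq left_coaction_eq
  proof unfold_locales
    show "algebra_hom (anti_drinfeld_double K) (tensor_alg (anti_drinfeld_double K) (drinfeld_double K)) (coact id)"
      unfolding tensor_alg_double anti by (intro coact_hom hopf_auto_id hopf_auto_S2) simp
    show "algebra_hom (anti_drinfeld_double K) (tensor_alg (drinfeld_double K) (anti_drinfeld_double K)) (coact (S \<circ> S))"
      unfolding tensor_alg_double anti by (intro coact_hom hopf_auto_id hopf_auto_S2) simp
    \<comment> \<open>The pairs (\<gamma>, \<delta>) in the three coassociativity laws are (id, id),
      (id, S^2) and (S^2, id); the composite \<gamma>\<delta> is again the twist of the coaction on
      the right-hand side.\<close>
    fix X
    show "tensor_assoc (tensor_map (coact id) id (coact id X)) = tensor_map id (comult (drinfeld_double K)) (coact id X)"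
      unfolding double_simps by (intro coact_coassoc hopf_auto_id) simp
    show "tensor_assoc (tensor_map (comult (drinfeld_double K)) id (coact (S \<circ> S) X)) = tensor_map id (coact (S \<circ> S)) (coact (S \<circ> S) X)"
      unfolding double_simps by (intro coact_coassoc hopf_auto_id hopf_auto_S2) simp
    show "tensor_assoc (tensor_map (coact (S \<circ> S)) id (coact id X)) = tensor_map id (coact id) (coact (S \<circ> S) X)"
      by (intro coact_coassoc hopf_auto_id hopf_auto_S2) simp
    show "tensor_lift (\<lambda>a0 a1. counit (drinfeld_double K) a1 *\<^sub>C a0) (coact id X) = X"
      using coact_counit_right by (simp add: double_simps tsum_eq_lift lin)
    show "tensor_lift (\<lambda>a1 a0. counit (drinfeld_double K) a1 *\<^sub>C a0) (coact (S \<circ> S) X) = X"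
      using coact_counit_left[OF hopf_auto_S2] by (simp add: double_simps tsum_eq_lift lin)
  qed
qed

section \<open>Coinvariants and canonical maps\<close>

text \<open>The functional X |-> \<epsilon>(X(1)) takes the value 1 at the unit. It therefore reads
  off the scalar and makes the unit map injective.\<close>

lemma bij_betw_multiples_of_one:
  assumes "\<And>X. X \<in> C \<Longrightarrow> X = \<epsilon> (hat \<one> X) *\<^sub>C double_one" "\<And>a. a *\<^sub>C double_one \<in> C"
  shows "bij_betw (\<lambda>a. a *\<^sub>C double_one) UNIV C"
proof (rule bij_betwI')
  show "(a *\<^sub>C double_one = b *\<^sub>C double_one) = (a = b)" for a b
  proof
    assume "a *\<^sub>C double_one = b *\<^sub>C double_one"
    then have "\<epsilon> (hat \<one> (a *\<^sub>C double_one)) = \<epsilon> (hat \<one> (b *\<^sub>C double_one))" by (simp only:)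
    then show "a = b" by (simp add: hat_scaleC hat_double_one counit_scaleC)
  qed simp
qed (use assms in auto)

lemma right_galois_anti:
  "right_galois_object (drinfeld_double K) (anti_drinfeld_double K) (right_coaction K)"
  unfolding right_galois_object_def right_coaction_eq
proof
  have "bij_betw (\<lambda>a. a *\<^sub>C double_one) UNIV {X. coact id X = X \<otimes> double_one}"
  proof (rule bij_betw_multiples_of_one)
    fix X assume "X \<in> {X. coact id X = X \<otimes> double_one}"
    then have X: "coact id X = X \<otimes> double_one" by simp
    \<comment> \<open>Applying the counit to the first leg of the coinvariance equation leaves X on
      one side and a multiple of the unit on the other.\<close>
    have "X = tsum (X \<otimes> double_one) (\<lambda>U W. \<epsilon> (hat \<one> U) *\<^sub>C W)"
      using coact_counit_left[OF hopf_auto_id, of X] by (simp add: X)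
    also have "\<dots> = \<epsilon> (hat \<one> X) *\<^sub>C double_one" by (rule tsum_pure) (intro lin)+
    finally show "X = \<epsilon> (hat \<one> X) *\<^sub>C double_one" .
  next
    show "a *\<^sub>C double_one \<in> {X. coact id X = X \<otimes> double_one}" for a
      by (simp add: clinear_scale[OF clinear_coact[OF auto_clinear[OF hopf_auto_id]]] coact_one hopf_auto_id scaleC_tensor)
  qed
  then show "bij_betw (\<lambda>c. c *\<^sub>C one (anti_drinfeld_double K)) UNIV {a. coact id a = a \<otimes> one (drinfeld_double K)}"
    by (simp add: double_simps)
  show "bij (tensor_lift (\<lambda>p p'. tensor_lift (\<lambda>p'0 p'1. mult (anti_drinfeld_double K) p p'0 \<otimes> p'1) (coact id p'))
     :: ('k dual \<otimes> 'k) \<otimes> ('k dual \<otimes> 'k) \<Rightarrow> _)"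
    using bij_right_galois_map[OF bialgebra_double unital_algebra_anti clinear_conv_inv[OF hopf_auto_S2]]
    by (simp add: double_simps conv_inv_left[OF hopf_auto_S2] conv_inv_right[OF hopf_auto_S2])
qed

text \<open>The left canonical map is the one of the untwisted coaction followed by the bijection
  \<open>id \<otimes> S\<^sup>2\<close> on the \<open>D(H)\<close> factor.\<close>

lemma coact_S2: "coact (S \<circ> S) X = tensor_map (tensor_map id (S \<circ> S)) id (coact id X)"
proof (rule hat2_eqI)
  fix x y
  note [lin] = auto_clinear[OF hopf_auto_S2]
  have c: "clinear id" "clinear (tensor_map id (S \<circ> S))"
    using auto_clinear[OF hopf_auto_S2] clinear_tensor_map[OF _ _ clinear_ident, of id "S \<circ> S"]
    by (auto simp: id_def clinear_ident)
  have h: "hat y (tensor_map id (S \<circ> S) U) = S (S (hat y U))" for U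
    by (induction U rule: tensor_induct)
      (simp_all add: o_def id_def clinear_add[OF c(2)[unfolded o_def id_def]] clinear_add[OF clinear_hat']
        clinear_add[OF clinear_S] tensor_map_pure lin S_scaleC)
  have "hat2 y x (tensor_map (tensor_map id (S \<circ> S)) id (coact id X)) = tsum (coact id X) (\<lambda>U W. S (S (hat y U)) \<otimes> hat x W)"
    by (simp add: tensor_map_tsum[OF c(2,1)] tensor_map_tsum_arg clinear_hat' tensor_map_pure h)
  also have "\<dots> = sw (hat (x \<cdot> y) X) (\<lambda>h h'. S (S h) \<otimes> h')"
    by (subst tsum_hat_coact[OF c(1), where M="\<lambda>p q. S (S p) \<otimes> q"]) (auto intro!: lin)
  finally show "hat2 y x (coact (S \<circ> S) X) = hat2 y x (tensor_map (tensor_map id (S \<circ> S)) id (coact id X))"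
    by (simp add: hat2_coact auto_clinear[OF hopf_auto_S2])
qed

lemma left_galois_anti:
  "left_galois_object (drinfeld_double K) (anti_drinfeld_double K) (left_coaction K)"
  unfolding left_galois_object_def left_coaction_eq
proof
  have "bij_betw (\<lambda>a. a *\<^sub>C double_one) UNIV {X. coact (S \<circ> S) X = double_one \<otimes> X}"
  proof (rule bij_betw_multiples_of_one)
    fix X assume "X \<in> {X. coact (S \<circ> S) X = double_one \<otimes> X}"
    then have X: "coact (S \<circ> S) X = double_one \<otimes> X" by simp
    show "X = \<epsilon> (hat \<one> X) *\<^sub>C double_one"
    proof (rule hat_eqI)
      fix y
      have "sw (hat y X) (\<lambda>h h'. S (S h) \<otimes> h') = \<epsilon> y *\<^sub>C (\<one> \<otimes> hat \<one> X)"
        using hat2_coact[OF auto_clinear[OF hopf_auto_S2], of y \<one> X]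
        by (simp add: X one_mult tensor_map_pure clinear_hat' hat_double_one scaleC_tensor)
      \<comment> \<open>The counit must now act on the second leg, so the surviving leg is
        S^2(h_(1)); \<open>S'\<close> applied twice removes the twist and recovers X(y).\<close>
      then have "tsum (sw (hat y X) (\<lambda>h h'. S (S h) \<otimes> h')) (\<lambda>p q. \<epsilon> q *\<^sub>C S' (S' p)) =
        tsum (\<epsilon> y *\<^sub>C (\<one> \<otimes> hat \<one> X)) (\<lambda>p q. \<epsilon> q *\<^sub>C S' (S' p))" by simp
      then show "hat y X = hat y (\<epsilon> (hat \<one> X) *\<^sub>C double_one)"
        by (simp add: tsum_tsum tsum_pure lin sw_counit_right clinear_scale[of "\<lambda>t. tsum t _"]
          hat_scaleC hat_double_one mult.commute)
    qed
  next
    show "a *\<^sub>C double_one \<in> {X. coact (S \<circ> S) X = double_one \<otimes> X}" for a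
      by (simp add: clinear_scale[OF clinear_coact[OF auto_clinear[OF hopf_auto_S2]]] coact_one hopf_auto_S2 tensor_scaleC)
  qed
  then show "bij_betw (\<lambda>c. c *\<^sub>C one (anti_drinfeld_double K)) UNIV {a. coact (S \<circ> S) a = one (drinfeld_double K) \<otimes> a}"
    by (simp add: double_simps)
  define \<theta> where "\<theta> = (tensor_map (tensor_map id (S \<circ> S)) id
    :: ('k dual \<otimes> 'k) \<otimes> ('k dual \<otimes> 'k) \<Rightarrow> ('k dual \<otimes> 'k) \<otimes> ('k dual \<otimes> 'k))"
  define \<theta>' where "\<theta>' = (tensor_map (tensor_map id (S' \<circ> S')) id
    :: ('k dual \<otimes> 'k) \<otimes> ('k dual \<otimes> 'k) \<Rightarrow> ('k dual \<otimes> 'k) \<otimes> ('k dual \<otimes> 'k))"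
  define f where "f = (tensor_lift (\<lambda>q q'. tensor_lift (\<lambda>a b. a \<otimes> mult (anti_drinfeld_double K) b q') (coact id q))
     :: ('k dual \<otimes> 'k) \<otimes> ('k dual \<otimes> 'k) \<Rightarrow> ('k dual \<otimes> 'k) \<otimes> ('k dual \<otimes> 'k))"
  have c: "clinear (S \<circ> S)" "clinear (S' \<circ> S')" "clinear id"
    by (simp_all add: lin o_def id_def)
  have c': "clinear (tensor_map id (S \<circ> S))" "clinear (tensor_map id (S' \<circ> S'))"
    using clinear_tensor_map[OF c(3,1) clinear_ident] clinear_tensor_map[OF c(3,2) clinear_ident] by auto
  have c'': "clinear \<theta>" "clinear \<theta>'"
    using clinear_tensor_map[OF c'(1) c(3) clinear_ident] clinear_tensor_map[OF c'(2) c(3) clinear_ident]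
    unfolding \<theta>_def \<theta>'_def by auto
  have i: "tensor_map (\<lambda>x. x) (\<lambda>x. x) t = t" for t :: "'x::complex_vector \<otimes> 'y::complex_vector"
    by (simp add: tensor_map_tsum clinear_ident tsum_pure_eq)
  have "\<theta>' (\<theta> t) = t" "\<theta> (\<theta>' t) = t" for t
    unfolding \<theta>_def \<theta>'_def by (simp_all add: tensor_map_comp c c' i)
  then have "bij \<theta>" by (intro o_bij[of \<theta>']) auto
  moreover have "bij f"
    unfolding f_def
    using bij_left_galois_map[OF bialgebra_double unital_algebra_anti clinear_conv_inv[OF hopf_auto_S2]]
    by (simp add: double_simps conv_inv_left[OF hopf_auto_S2] conv_inv_right[OF hopf_auto_S2])
  ultimately have "bij (\<theta> \<circ> f)" by (rule bij_comp[rotated])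
  moreover have "tensor_lift (\<lambda>q q'. tensor_lift (\<lambda>q1 q0. q1 \<otimes> mult (anti_drinfeld_double K) q0 q') (coact (S \<circ> S) q)) = \<theta> \<circ> f"
  proof
    fix t
    note [lin] = clinear_double_mult[OF hopf_auto_S2] c''[THEN clinear_compose] c'[THEN clinear_compose]
      clinear_coact[OF auto_clinear[OF hopf_auto_S2], THEN clinear_compose]
      clinear_coact[OF auto_clinear[OF hopf_auto_id], THEN clinear_compose]
    have e: "tsum (coact (S \<circ> S) q) (\<lambda>q1 q0. q1 \<otimes> double_mult (S \<circ> S) q0 q') = \<theta> (tsum (coact id q) (\<lambda>a b. a \<otimes> double_mult (S \<circ> S) b q'))" for q q'
      unfolding clinear_tsum[OF c''(1)] unfolding coact_S2 \<theta>_def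
      by (simp add: tensor_map_tsum[OF c'(1) c(3)] tsum_tsum tsum_pure lin tensor_map_pure c' c)
    show "tensor_lift (\<lambda>q q'. tensor_lift (\<lambda>q1 q0. q1 \<otimes> mult (anti_drinfeld_double K) q0 q') (coact (S \<circ> S) q)) t = (\<theta> \<circ> f) t"
      unfolding comp_apply[of \<theta> f t] f_def double_simps
      by (simp add: tsum_eq_lift lin e clinear_tsum[OF c''(1)])
  qed
  ultimately show "bij (tensor_lift (\<lambda>q q'. tensor_lift (\<lambda>q1 q0. q1 \<otimes> mult (anti_drinfeld_double K) q0 q') (coact (S \<circ> S) q))
     :: ('k dual \<otimes> 'k) \<otimes> ('k dual \<otimes> 'k) \<Rightarrow> _)"
    by (simp only:)
qed

end

theorem theorem4p1:
  fixes H :: "('h::complex_vector) bialg"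
  assumes "\<exists>B :: 'h set. finite_dimensional_vector_space scaleC B"
    and "hopf_algebra H"
  shows "bicomodule_algebra (drinfeld_double H) (anti_drinfeld_double H)
           (left_coaction H) (right_coaction H)
         \<and> right_galois_object (drinfeld_double H) (anti_drinfeld_double H) (right_coaction H)
         \<and> left_galois_object (drinfeld_double H) (anti_drinfeld_double H) (left_coaction H)"
proof -
  obtain B :: "'h set" where B: "finite_dimensional_vector_space scaleC B" using assms(1) by blast
  then obtain c where c: "dual_basis B c" by (rule ex_dual_basis)
  interpret fd_hopf H B c
    using assms(2) B c by (intro fd_hopf.intro fd_hopf_algebra.intro fd_hopf_algebra_axioms.intro)
  show ?thesis
    using bicomodule_algebra_anti right_galois_anti left_galois_anti by blast
qed

end
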